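(* Let $q$ be an odd prime power, $F=\mathbb F_q((\pi))$ with ring of integers $\mathcal O=\mathbb F_q[[\pi]]$, $G=Sp_4(F)$, $K=Sp_4(\mathcal O)$ and $\Gamma=Sp_4(\mathbb F_q[\pi^{-1}])$, a lattice in $G$. For every $p\in(4,\infty]$ there exists a function $\phi_p\in C_0(\Gamma)$ vanishing at infinity such that for every finitely supported $f:\Gamma\to\mathbb C$ satisfying $f(\gamma)=f(\gamma')$ whenever $\gamma,\gamma'\in\Gamma$ and $\gamma\in K\gamma'K$, one has for all $\gamma\in\Gamma$ $$|f(\gamma)|\le\phi_p(\gamma)\,\|m_f\|_{ML^p(L\Gamma)}.$$
   Context: $Sp_4(R)=\{A\in M_{4\times4}(R):A^tJA=J\}$ with $J_{14}=J_{23}=1$, $J_{32}=J_{41}=-1$, other entries $0$. $L(\Gamma)$ is the group von Neumann algebra with trace $\tau(x)=\langle\delta_1,x\delta_1\rangle$; for $p<\infty$, $\|x\|_{L^p(L\Gamma)}=\tau(|x|^p)^{1/p}$, and for $p=\infty$, $\|\varphi\|_{L^\infty(L\Gamma)}:=\|\varphi\|_{C^*_r(\Gamma)}$ (operator norm of $\lambda(\varphi)$ on $\ell^2\Gamma$). The Fourier multiplier norm is $\|m_f\|_{ML^p(L\Gamma)}=\sup\{\|f\varphi\|_{L^p(L\Gamma)}:\varphi\in\mathbb C\Gamma\text{ finitely supported},\|\varphi\|_{L^p(L\Gamma)}\le1\}$ (pointwise product $f\varphi$). *)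

theory Defs
  imports "HOL-Analysis.Analysis" "HOL-Probability.Probability"
    "HOL-Computational_Algebra.Formal_Laurent_Series"
begin

text \<open>Symplectic form J (0-based indices of type 4: paper's (1,4),(2,3) entries are 1,
  (3,2),(4,1) entries are -1).\<close>
definition Jsp :: "'a::comm_ring_1 ^4^4" where
  "Jsp = (\<chi> i j. if (i = 0 \<and> j = 3) \<or> (i = 1 \<and> j = 2) then 1
                  else if (i = 2 \<and> j = 1) \<or> (i = 3 \<and> j = 0) then -1 else 0)"

definition Sp4 :: "'a::comm_ring_1 set \<Rightarrow> ('a^4^4) set" where
  "Sp4 R = {A. (\<forall>i j. A$i$j \<in> R) \<and> transpose A ** Jsp ** A = Jsp}"

definition intO :: "'k::field fls set" where
  "intO = {x. 0 \<le> fls_subdegree x}"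

definition polyinv :: "'k::field fls set" where
  "polyinv = {x. \<forall>n::int. n > 0 \<longrightarrow> fls_nth x n = 0}"

abbreviation Gam :: "('k::field fls ^4^4) set" where "Gam \<equiv> Sp4 polyinv"
abbreviation Kcpt :: "('k::field fls ^4^4) set" where "Kcpt \<equiv> Sp4 intO"

definition ginv :: "'k::field fls ^4^4 \<Rightarrow> 'k fls ^4^4" where
  "ginv A = (THE B. B ** A = mat 1 \<and> A ** B = mat 1)"

definition finsupp :: "('k::field fls ^4^4 \<Rightarrow> complex) \<Rightarrow> bool" where
  "finsupp a \<longleftrightarrow> finite {g \<in> Gam. a g \<noteq> 0}"

text \<open>Convolution in the group algebra of Gamma (first factor finitely supported).\<close>
definition conv :: "('k::field fls ^4^4 \<Rightarrow> complex) \<Rightarrow> ('k fls ^4^4 \<Rightarrow> complex)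
     \<Rightarrow> ('k fls ^4^4 \<Rightarrow> complex)" where
  "conv a b = (\<lambda>g. \<Sum>h\<in>{h \<in> Gam. a h \<noteq> 0}. a h * b (ginv h ** g))"

definition delta1 :: "'k::field fls ^4^4 \<Rightarrow> complex" where
  "delta1 g = (if g = mat 1 then 1 else 0)"

definition adj :: "('k::field fls ^4^4 \<Rightarrow> complex) \<Rightarrow> ('k fls ^4^4 \<Rightarrow> complex)" where
  "adj a = (\<lambda>g. cnj (a (ginv g)))"

definition gtrace :: "('k::field fls ^4^4 \<Rightarrow> complex) \<Rightarrow> complex" where
  "gtrace a = a (mat 1)"

text \<open>Spectral measure of x*x (x = lambda(a)) with respect to the trace tau:
  the compactly supported Borel measure on the reals whose moments are tau((x*x)^n).\<close>
definition spec_meas :: "('k::field fls ^4^4 \<Rightarrow> complex) \<Rightarrow> real measure" where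
  "spec_meas a = (THE \<mu>. sets \<mu> = sets (borel :: real measure) \<and> finite_measure \<mu> \<and>
       (\<exists>B. emeasure \<mu> (- {0..B}) = 0) \<and>
       (\<forall>n::nat. (\<integral>t. t ^ n \<partial>\<mu>) = Re (gtrace (((conv (conv (adj a) a)) ^^ n) delta1))))"

text \<open>||a||_p = tau(|x|^p)^(1/p) for p < infinity.\<close>
definition Lp_fin :: "real \<Rightarrow> ('k::field fls ^4^4 \<Rightarrow> complex) \<Rightarrow> real" where
  "Lp_fin p a = (\<integral>t. t powr (p / 2) \<partial>(spec_meas a)) powr (1 / p)"

definition l2sq :: "('k::field fls ^4^4 \<Rightarrow> complex) \<Rightarrow> real" where
  "l2sq b = (\<Sum>g\<in>{g \<in> Gam. b g \<noteq> 0}. (cmod (b g))^2)"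

text \<open>Operator norm of lambda(a) on l^2(Gamma) (finitely supported vectors are dense).\<close>
definition opnorm :: "('k::field fls ^4^4 \<Rightarrow> complex) \<Rightarrow> real" where
  "opnorm a = Sup {sqrt (l2sq (conv a b)) | b. finsupp b \<and> l2sq b \<le> 1}"

definition Lp :: "ereal \<Rightarrow> ('k::field fls ^4^4 \<Rightarrow> complex) \<Rightarrow> real" where
  "Lp p a = (if p = \<infinity> then opnorm a else Lp_fin (real_of_ereal p) a)"

definition mult_norm :: "ereal \<Rightarrow> ('k::field fls ^4^4 \<Rightarrow> complex) \<Rightarrow> ereal" where
  "mult_norm p f = Sup {ereal (Lp p (\<lambda>g. f g * \<phi> g)) | \<phi>. finsupp \<phi> \<and> Lp p \<phi> \<le> 1}"

end

theory Submission
  imports Defs "HOL-Computational_Algebra.Fundamental_Theorem_Algebra"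
begin

text \<open>
  By the Cartan decomposition, \<open>f\<close> only depends on the largest degrees \<open>i\<close> and \<open>i + j\<close> in \<open>\<pi>\<^sup>-\<^sup>1\<close> of
  the entries and of the \<open>2 \<times> 2\<close> minors. To compare two values of \<open>f\<close>, take an element \<open>\<phi>\<close> of the group
  algebra of a finite unipotent subgroup \<open>H\<close> (translated by an element of the lattice) which is the
  difference of two uniform probability measures, \<open>f\<close> being constant on the support of each. The trivial
  character bounds the difference of the two values by \<open>|H|\<^bsup>1/p\<^esup> \<parallel>f \<phi>\<parallel>\<^sub>p\<close>, and
  \<open>\<parallel>\<phi>\<parallel>\<^sub>p\<^sup>p \<le> \<parallel>\<phi>\<parallel>\<^sub>\<infinity>\<^bsup>p-2\<^esup> \<parallel>\<phi>\<parallel>\<^sub>2\<^sup>2\<close>. If the measures live near a parabola in the Siegel radical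
  (\<open>i\<close> is fixed and \<open>j\<close> moves by one), or near a level set of the central coordinate in the Heisenberg radical
  (\<open>i + j\<close> is fixed and \<open>i\<close> moves by one), expanding \<open>\<phi>\<^sup>* \<phi>\<close> shows that the operator norm is exponentially
  small in \<open>i - j\<close>, respectively in \<open>j\<close>, and the product decays as soon as \<open>p > 4\<close>. A zigzag of such moves leads
  from any \<open>(i, j)\<close> to infinity, where \<open>f\<close> vanishes, with total error tending to zero as \<open>i\<close> grows.
\<close>

text \<open>The exponent 4 comes from counting. In both moves there is a gap \<open>R\<close> such
  that the test element has operator norm about q^(-R/2), while |H| times its squared l2 norm is
  about q^R. The p-th power of the loss is then q^(-R(p-2)/2 + R) = q^(-R(p-4)/2), which decays in
  \<open>R\<close> exactly when p > 4. Supports are kept inside one coset of a finite subgroup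
  because L^p norms are defined here through the moments of x^* x. For such x these moments come
  from a finite Gram matrix, so the spectral measure has finitely many atoms. Operator norms are
  still estimated on all finitely supported vectors of the lattice. Neither move suffices alone: one
  never changes \<open>i\<close>, and the other runs along a line of constant i + j, where its error
  grows as \<open>j\<close> shrinks. Combining them near j = i/2 makes both errors about
  \<theta>^(i/2). Passing from \<open>i\<close> to i + 1 takes at most i + 1 moves, so the total
  cost is the tail of a convergent series that does not depend on \<open>f\<close>.\<close>

no_notation fps_nth (infixl "$" 75)

section \<open>Spectral decomposition of finite Gram matrices\<close>

text \<open>Gaussian elimination: a pivot vector nonzero at \<open>s\<close> clears this coordinate
  from the other vectors, and one vector and one coordinate are lost.\<close>

lemma exists_linear_dependence:
  fixes u :: "'i \<Rightarrow> 'a \<Rightarrow> complex"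
  assumes "finite S" "finite I" "card S < card I"
  shows "\<exists>c. (\<exists>i\<in>I. c i \<noteq> 0) \<and> (\<forall>s\<in>S. (\<Sum>i\<in>I. c i * u i s) = 0)"
  using assms
proof (induction S arbitrary: I u rule: finite_induct)
  case empty
  then have "I \<noteq> {}" by auto
  then show ?case by (intro exI[of _ "\<lambda>_. 1"]) auto
next
  case (insert s S)
  show ?case
  proof (cases "\<forall>i\<in>I. u i s = 0")
    case True
    have "card S < card I" using insert by simp
    from insert.IH[OF insert.prems(1) this, of u] True show ?thesis by auto
  next
    case False
    then obtain j where j: "j \<in> I" "u j s \<noteq> 0" by auto
    define J where "J = I - {j}"
    have fJ: "finite J" and jJ: "j \<notin> J" and IJ: "I = insert j J"
      using insert.prems j by (auto simp: J_def)
    have "card S < card J" using insert j IJ fJ jJ by simp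
    from insert.IH[OF fJ this, of "\<lambda>i r. u i r - (u i s / u j s) * u j r"]
    obtain c where c: "\<exists>i\<in>J. c i \<noteq> 0"
      "\<And>r. r \<in> S \<Longrightarrow> (\<Sum>i\<in>J. c i * (u i r - (u i s / u j s) * u j r)) = 0" by blast
    define c' where "c' = c(j := - (\<Sum>i\<in>J. c i * u i s) / u j s)"
    have eqJ: "(\<Sum>i\<in>J. c' i * u i r) = (\<Sum>i\<in>J. c i * u i r)" for r
      by (intro sum.cong) (auto simp: c'_def jJ)
    have "(\<Sum>i\<in>I. c' i * u i s) = 0"
      unfolding IJ using fJ jJ j eqJ[of s] by (simp add: c'_def)
    moreover have "(\<Sum>i\<in>I. c' i * u i r) = 0" if "r \<in> S" for r
    proof -
      have "0 = (\<Sum>i\<in>J. c i * u i r) - (\<Sum>i\<in>J. c i * u i s) / u j s * u j r"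
        using c(2)[OF that] by (simp add: right_diff_distrib sum_subtractf sum_distrib_right sum_divide_distrib mult.assoc)
      then show ?thesis unfolding IJ using fJ jJ eqJ[of r] by (simp add: c'_def)
    qed
    moreover have "\<exists>i\<in>I. c' i \<noteq> 0"
      using c(1) jJ IJ by (auto simp: c'_def)
    ultimately show ?thesis by auto
  qed
qed

text \<open>\<open>B\<close> is a matrix with rows indexed by \<open>Y\<close> and columns by
  \<open>H\<close>; \<open>mv v\<close> is B v. The operator \<open>T\<close> is B^* B, set to zero
  off \<open>H\<close> so that relations between its iterates are equations between total
  functions.\<close>

locale gram =
  fixes H :: "'a set" and Y :: "'b set" and B :: "'b \<Rightarrow> 'a \<Rightarrow> complex"
  assumes finH: "finite H" and finY: "finite Y"
begin

definition mv :: "('a \<Rightarrow> complex) \<Rightarrow> 'b \<Rightarrow> complex" where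
  "mv v y = (\<Sum>g\<in>H. B y g * v g)"

definition T :: "('a \<Rightarrow> complex) \<Rightarrow> 'a \<Rightarrow> complex" where
  "T v g = (if g \<in> H then (\<Sum>h\<in>H. (\<Sum>y\<in>Y. cnj (B y g) * B y h) * v h) else 0)"

definition ip :: "('a \<Rightarrow> complex) \<Rightarrow> ('a \<Rightarrow> complex) \<Rightarrow> complex" where
  "ip u v = (\<Sum>g\<in>H. cnj (u g) * v g)"

definition vanishes_off where "vanishes_off v \<longleftrightarrow> (\<forall>g. g \<notin> H \<longrightarrow> v g = (0::complex))"

text \<open>The vector P(T) v, by Horner's scheme.\<close>

definition ap :: "complex poly \<Rightarrow> ('a \<Rightarrow> complex) \<Rightarrow> 'a \<Rightarrow> complex" where
  "ap P v = fold_coeffs (\<lambda>a w g. a * v g + T w g) P (\<lambda>_. 0)"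

lemma T_add: "T (\<lambda>g. u g + v g) = (\<lambda>g. T u g + T v g)"
  by (auto simp: T_def sum.distrib distrib_left)

lemma T_scale: "T (\<lambda>g. c * v g) = (\<lambda>g. c * T v g)"
  by (auto simp: T_def sum_distrib_left mult_ac)

lemma T_zero [simp]: "T (\<lambda>g. 0) = (\<lambda>g. 0)"
  by (auto simp: T_def)

lemma T_sum: "T (\<lambda>g. \<Sum>l\<in>L. u l g) = (\<lambda>g. \<Sum>l\<in>L. T (u l) g)"
proof (cases "finite L")
  case True then show ?thesis by (induction L) (simp_all add: T_add)
qed simp

lemma T_off: "g \<notin> H \<Longrightarrow> T v g = 0"
  by (simp add: T_def)

lemma T_diff: "T (\<lambda>g. u g - v g) = (\<lambda>g. T u g - T v g)"
  using T_add[of u "\<lambda>g. (-1) * v g"] T_scale[of "-1" v] by simp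

lemma ap_0 [simp]: "ap 0 v = (\<lambda>_. 0)" by (simp add: ap_def)

lemma ap_pCons [simp]: "ap (pCons a P) v = (\<lambda>g. a * v g + T (ap P v) g)"
proof (cases "P = 0 \<and> a = 0")
  case False then show ?thesis by (auto simp: ap_def)
qed (auto simp: ap_def)

lemma ap_smult: "ap (smult c P) v = (\<lambda>g. c * ap P v g)"
  by (induction P) (auto simp: T_scale algebra_simps)

lemma ap_add: "ap (P + Q) v = (\<lambda>g. ap P v g + ap Q v g)"
  by (induction P Q rule: poly_induct2) (auto simp: T_add algebra_simps)

text \<open>Q(T) commutes with T - r, so a linear factor may be applied to the vector first.\<close>

lemma ap_factor: "ap ([:-r, 1:] * Q) v = ap Q (\<lambda>g. T v g - r * v g)"
proof -
  have lin: "ap Q (\<lambda>g. T v g - r * v g) = (\<lambda>g. T (ap Q v) g - r * ap Q v g)"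
    by (induction Q) (auto simp: T_add T_diff T_scale algebra_simps)
  have "[:-r, 1:] * Q = pCons 0 Q + smult (-r) Q" by simp
  then show ?thesis unfolding lin by (simp only: ap_add ap_smult ap_pCons) simp
qed

lemma ap_monomials: "ap P v g = (\<Sum>i\<le>degree P. coeff P i * (T ^^ i) v g)"
proof (induction P arbitrary: g)
  case (pCons a P)
  have "T (ap P v) g = T (\<lambda>g. \<Sum>i\<le>degree P. coeff P i * (T ^^ i) v g) g"
    using pCons.IH by (metis (no_types, lifting) ext)
  also have "\<dots> = (\<Sum>i\<le>degree P. coeff P i * (T ^^ Suc i) v g)"
    by (simp add: T_sum T_scale)
  finally show ?case
    by (cases "P = 0") (simp_all add: degree_pCons_eq sum.atMost_Suc_shift del: sum.atMost_Suc)
qed simp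

lemma ip_T: "ip u (T v) = (\<Sum>y\<in>Y. cnj (mv u y) * mv v y)"
proof -
  have "ip u (T v) = (\<Sum>g\<in>H. \<Sum>h\<in>H. \<Sum>y\<in>Y. cnj (B y g * u g) * (B y h * v h))"
    by (simp add: ip_def T_def sum_distrib_left sum_distrib_right mult_ac)
  also have "\<dots> = (\<Sum>g\<in>H. \<Sum>y\<in>Y. \<Sum>h\<in>H. cnj (B y g * u g) * (B y h * v h))"
    by (intro sum.cong refl sum.swap)
  also have "\<dots> = (\<Sum>y\<in>Y. \<Sum>g\<in>H. \<Sum>h\<in>H. cnj (B y g * u g) * (B y h * v h))"
    by (rule sum.swap)
  also have "\<dots> = (\<Sum>y\<in>Y. cnj (mv u y) * mv v y)"
    by (simp add: mv_def sum_product)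
  finally show ?thesis .
qed

lemma ip_cnj: "ip v u = cnj (ip u v)"
  by (simp add: ip_def mult.commute)

lemma T_selfadjoint: "ip (T u) v = ip u (T v)"
  by (subst ip_cnj) (simp add: ip_T mult.commute)

lemma ip_T_self: "ip v (T v) = of_real (\<Sum>y\<in>Y. (cmod (mv v y))\<^sup>2)"
  by (simp add: ip_T complex_norm_square mult.commute flip: of_real_power)

lemma ip_self: "ip v v = of_real (\<Sum>g\<in>H. (cmod (v g))\<^sup>2)"
  by (simp add: ip_def complex_norm_square mult.commute flip: of_real_power)

lemma ip_self_0: "vanishes_off v \<Longrightarrow> ip v v = 0 \<Longrightarrow> v = (\<lambda>_. 0)"
proof -
  assume v: "vanishes_off v" and "ip v v = 0"
  then have "(\<Sum>g\<in>H. (cmod (v g))\<^sup>2) = 0" by (simp only: ip_self of_real_eq_0_iff)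
  then have "\<forall>g\<in>H. v g = 0" using finH by (simp add: sum_nonneg_eq_0_iff)
  then show ?thesis using v by (auto simp: vanishes_off_def)
qed

lemma ip_scale_right: "ip u (\<lambda>g. c * v g) = c * ip u v"
  by (simp add: ip_def sum_distrib_left mult_ac)
lemma ip_scale_left: "ip (\<lambda>g. c * u g) v = cnj c * ip u v"
  by (simp add: ip_def sum_distrib_left mult_ac)
lemma ip_diff_right: "ip u (\<lambda>g. v g - w g) = ip u v - ip u w"
  by (simp add: ip_def sum_subtractf right_diff_distrib)
lemma ip_sum_right: "ip u (\<lambda>g. \<Sum>l\<in>L. v l g) = (\<Sum>l\<in>L. ip u (v l))"
  unfolding ip_def sum_distrib_left by (rule sum.swap)
lemma ip_sum_left: "ip (\<lambda>g. \<Sum>l\<in>L. u l g) v = (\<Sum>l\<in>L. ip (u l) v)"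
  unfolding ip_def cnj_sum sum_distrib_right by (rule sum.swap)

lemma eigenvalue_nonneg:
  assumes "vanishes_off v" "T v = (\<lambda>g. r * v g)" "v \<noteq> (\<lambda>_. 0)"
  shows "r = of_real (Re r)" "Re r * (\<Sum>g\<in>H. (cmod (v g))\<^sup>2) = (\<Sum>y\<in>Y. (cmod (mv v y))\<^sup>2)"
    "(\<Sum>g\<in>H. (cmod (v g))\<^sup>2) > 0" "Re r \<ge> 0"
proof -
  define N where "N = (\<Sum>g\<in>H. (cmod (v g))\<^sup>2)"
  have "N \<noteq> 0" using ip_self_0[OF assms(1)] assms(3) unfolding ip_self N_def by (metis of_real_0)
  moreover have "N \<ge> 0" by (auto simp: N_def intro: sum_nonneg)
  ultimately show Npos: "(\<Sum>g\<in>H. (cmod (v g))\<^sup>2) > 0" by (simp add: N_def)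
  have e: "r * of_real N = of_real (\<Sum>y\<in>Y. (cmod (mv v y))\<^sup>2)"
    using ip_T_self[of v] unfolding assms(2) ip_scale_right ip_self N_def .
  have "Im r * N = 0" using arg_cong[OF e, of Im] by simp
  with Npos show "r = of_real (Re r)" by (simp add: N_def complex_eq_iff)
  show e2: "Re r * (\<Sum>g\<in>H. (cmod (v g))\<^sup>2) = (\<Sum>y\<in>Y. (cmod (mv v y))\<^sup>2)"
    using arg_cong[OF e, of Re] by (simp add: N_def)
  have "(\<Sum>y\<in>Y. (cmod (mv v y))\<^sup>2) \<ge> 0" by (auto intro: sum_nonneg)
  with e2 Npos show "Re r \<ge> 0" by (metis linorder_not_less mult_neg_pos)
qed

text \<open>Induction on the degree of an annihilating polynomial. After a root \<open>r\<close> is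
  split off, the eigencomponents of (T - r) v are lifted to components of \<open>v\<close> through
  division by l - r. Only a component with l = r resists, and self-adjointness rules it out.\<close>

lemma eigen_decomposition:
  assumes "P \<noteq> 0" "vanishes_off v" "ap P v = (\<lambda>_. 0)"
  shows "\<exists>L u. finite L \<and> (\<forall>l\<in>L. vanishes_off (u l) \<and> T (u l) = (\<lambda>g. l * u l g)) \<and>
    v = (\<lambda>g. \<Sum>l\<in>L. u l g)"
  using assms
proof (induction "degree P" arbitrary: P v)
  case 0
  then obtain a where "P = [:a:]" "a \<noteq> 0" by (metis degree_eq_zeroE pCons_0_0)
  then have "v = (\<lambda>_. 0)" using 0(4) by (auto simp: fun_eq_iff)
  then show ?case by (intro exI[of _ "{}"]) auto
next
  case (Suc n)
  have "\<not> constant (poly P)" using Suc(2) by (simp add: constant_degree)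
  then obtain r where "poly P r = 0" using fundamental_theorem_of_algebra by blast
  then obtain Q where Q: "P = [:-r, 1:] * Q" by (auto simp: poly_eq_0_iff_dvd elim: dvdE)
  with Suc.prems have Q0: "Q \<noteq> 0" by auto
  have dQ: "n = degree Q" using Suc(2) Q0 unfolding Q by (subst (asm) degree_mult_eq) auto
  define v' where "v' = (\<lambda>g. T v g - r * v g)"
  have v'o: "vanishes_off v'" using Suc.prems(2) by (auto simp: vanishes_off_def v'_def T_off)
  have "ap Q v' = (\<lambda>_. 0)" using Suc.prems(3) unfolding Q ap_factor v'_def .
  from Suc(1)[OF dQ Q0 v'o this] obtain L u where L: "finite L"
    "\<And>l. l \<in> L \<Longrightarrow> vanishes_off (u l)" "\<And>l. l \<in> L \<Longrightarrow> T (u l) = (\<lambda>g. l * u l g)"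
    "v' = (\<lambda>g. \<Sum>l\<in>L. u l g)" by blast
  define w where "w = (\<lambda>g. v g - (\<Sum>l\<in>L-{r}. 1 / (l - r) * u l g))"
  define z where "z = (\<lambda>g. T w g - r * w g)"
  have wo: "vanishes_off w" using Suc.prems(2) L(2) by (auto simp: vanishes_off_def w_def)
  have zo: "vanishes_off z" using wo by (auto simp: vanishes_off_def z_def T_off)
  have zg: "z g = (\<Sum>l\<in>L. u l g) - (\<Sum>l\<in>L-{r}. u l g)" for g
  proof -
    have "T w g = T v g - (\<Sum>l\<in>L-{r}. 1 / (l - r) * (l * u l g))"
      unfolding w_def by (simp only: T_diff T_sum T_scale) (simp add: L(3))
    then have "z g = v' g - (\<Sum>l\<in>L-{r}. 1 / (l - r) * (l * u l g) - r * (1 / (l - r) * u l g))"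
      by (simp add: z_def v'_def w_def sum_subtractf sum_distrib_left algebra_simps)
    also have "(\<Sum>l\<in>L-{r}. 1 / (l - r) * (l * u l g) - r * (1 / (l - r) * u l g)) = (\<Sum>l\<in>L-{r}. u l g)"
    proof (rule sum.cong[OF refl])
      fix l assume "l \<in> L - {r}"
      then have "l - r \<noteq> 0" by auto
      then show "1 / (l - r) * (l * u l g) - r * (1 / (l - r) * u l g) = u l g"
        by (simp add: diff_divide_distrib[symmetric] left_diff_distrib[symmetric])
    qed
    finally show ?thesis by (simp add: L(4))
  qed
  have Tz: "T z = (\<lambda>g. r * z g)"
  proof (cases "r \<in> L")
    case True
    then have "z = u r" using L(1) by (auto simp: zg sum.remove)
    then show ?thesis using L(3)[OF True] by simp
  next
    case False
    then have "z = (\<lambda>_. 0)" by (auto simp: zg)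
    then show ?thesis by simp
  qed
  \<comment> \<open>No Jordan block: z = (T - r) w and T z = r z with \<open>r\<close> real give <z,
    z> = <(T - r) z, w> = 0.\<close>
  have z0: "z = (\<lambda>_. 0)"
  proof (rule ccontr)
    assume nz: "z \<noteq> (\<lambda>_. 0)"
    have "ip z z = ip z (T w) - r * ip z w"
      by (subst (2) z_def) (simp add: ip_diff_right ip_scale_right)
    also have "\<dots> = cnj r * ip z w - r * ip z w"
      by (simp add: T_selfadjoint[symmetric] Tz ip_scale_left)
    also have "cnj r = r" using eigenvalue_nonneg(1)[OF zo Tz nz] by (metis complex_cnj_complex_of_real)
    finally show False using ip_self_0[OF zo] nz by simp
  qed
  have Tw: "T w = (\<lambda>g. r * w g)" using z0 by (auto simp: z_def fun_eq_iff)
  define u' where "u' = (\<lambda>l g. if l = r then w g else 1 / (l - r) * u l g)"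
  have "T (u' l) = (\<lambda>g. l * u' l g) \<and> vanishes_off (u' l)" if "l \<in> insert r L" for l
  proof (cases "l = r")
    case True then show ?thesis using Tw wo by (simp add: u'_def)
  next
    case False
    then have "l \<in> L" using that by simp
    have "u' l = (\<lambda>g. 1 / (l - r) * u l g)" using False by (simp add: u'_def)
    then show ?thesis using L(2)[OF \<open>l \<in> L\<close>]
      by (simp only: T_scale L(3)[OF \<open>l \<in> L\<close>]) (auto simp: vanishes_off_def)
  qed
  moreover have "v = (\<lambda>g. \<Sum>l\<in>insert r L. u' l g)"
  proof
    fix g
    have "(\<Sum>l\<in>insert r L. u' l g) = u' r g + (\<Sum>l\<in>L-{r}. u' l g)"
      using L(1) by (rule sum.insert_remove)
    also have "(\<Sum>l\<in>L-{r}. u' l g) = (\<Sum>l\<in>L-{r}. 1 / (l - r) * u l g)"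
      by (intro sum.cong) (auto simp: u'_def)
    finally show "v g = (\<Sum>l\<in>insert r L. u' l g)" by (simp add: u'_def w_def)
  qed
  ultimately show ?case using L(1)
    by (intro exI[of _ "insert r L"] exI[of _ u']) auto
qed

text \<open>The |H| + 1 iterates of \<open>v\<close> live in a space of dimension |H|.\<close>

lemma annihilating_poly: "\<exists>P. P \<noteq> 0 \<and> ap P v = (\<lambda>_. 0)" if "vanishes_off v"
proof -
  have vo: "vanishes_off ((T ^^ i) v)" for i
    using that by (cases i) (auto simp: vanishes_off_def T_off)
  obtain c where c: "\<exists>i\<in>{..card H}. c i \<noteq> 0"
    "\<And>s. s \<in> H \<Longrightarrow> (\<Sum>i\<in>{..card H}. c i * (T ^^ i) v s) = 0"
    using exists_linear_dependence[of H "{..card H}" "\<lambda>i. (T ^^ i) v"] finH by auto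
  define P where "P = (\<Sum>i\<le>card H. monom (c i) i)"
  have cf: "coeff P i = (if i \<le> card H then c i else 0)" for i
    by (simp add: P_def coeff_sum)
  have "P \<noteq> 0" using c(1) cf by (metis atMost_iff coeff_0)
  have dg: "degree P \<le> card H" by (rule degree_le) (auto simp: cf)
  have "ap P v g = 0" for g
  proof -
    have "ap P v g = (\<Sum>i\<le>card H. coeff P i * (T ^^ i) v g)"
      unfolding ap_monomials using dg by (intro sum.mono_neutral_left) (auto simp: coeff_eq_0)
    also have "\<dots> = (\<Sum>i\<le>card H. c i * (T ^^ i) v g)" by (simp add: cf)
    also have "\<dots> = 0"
    proof (cases "g \<in> H")
      case True then show ?thesis using c(2) by simp
    next
      case False then show ?thesis using vo unfolding vanishes_off_def by simp
    qed
    finally show ?thesis .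
  qed
  then show ?thesis using \<open>P \<noteq> 0\<close> by (intro exI[of _ P]) auto
qed

text \<open>The spectral measure of \<open>T\<close> at the basis vector of \<open>e\<close>: the
  mass at \<open>l\<close> is the squared norm of the component of this vector in the eigenspace of
  \<open>l\<close>. The last clause is the contribution of the trivial character: when all row and
  column sums equal \<open>s\<close>, the constant vector has eigenvalue |s|^2, and its overlap with
  the basis vector forces an atom of mass at least 1/|H| there.\<close>

lemma spectral_weights:
  assumes "e \<in> H"
  obtains L :: "real set" and w :: "real \<Rightarrow> real" where
    "finite L" "\<And>l. l \<in> L \<Longrightarrow> 0 \<le> l" "\<And>l. l \<in> L \<Longrightarrow> 0 \<le> w l"
    "\<And>n. (T ^^ n) (\<lambda>g. if g = e then 1 else 0) e = of_real (\<Sum>l\<in>L. w l * l ^ n)"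
    "\<And>C l. (\<And>v. (\<Sum>y\<in>Y. (cmod (mv v y))\<^sup>2) \<le> C * (\<Sum>g\<in>H. (cmod (v g))\<^sup>2)) \<Longrightarrow> l \<in> L \<Longrightarrow> l \<le> C"
    "\<And>s. (\<And>y. y \<in> Y \<Longrightarrow> (\<Sum>g\<in>H. B y g) = s) \<Longrightarrow> (\<And>g. g \<in> H \<Longrightarrow> (\<Sum>y\<in>Y. B y g) = s) \<Longrightarrow>
        (cmod s)\<^sup>2 \<in> L \<and> 1 / card H \<le> w ((cmod s)\<^sup>2)"
proof -
  define \<delta> :: "'a \<Rightarrow> complex" where "\<delta> = (\<lambda>g. if g = e then 1 else 0)"
  have do: "vanishes_off \<delta>" using assms by (auto simp: \<delta>_def vanishes_off_def)
  obtain L0 u where L0: "finite L0" "\<And>l. l \<in> L0 \<Longrightarrow> vanishes_off (u l)"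
    "\<And>l. l \<in> L0 \<Longrightarrow> T (u l) = (\<lambda>g. l * u l g)" "\<delta> = (\<lambda>g. \<Sum>l\<in>L0. u l g)"
    using annihilating_poly[OF do] eigen_decomposition[OF _ do] by metis
  define L1 where "L1 = {l\<in>L0. u l \<noteq> (\<lambda>_. 0)}"
  have L1: "finite L1" "\<And>l. l \<in> L1 \<Longrightarrow> vanishes_off (u l)"
    "\<And>l. l \<in> L1 \<Longrightarrow> T (u l) = (\<lambda>g. l * u l g)" "\<And>l. l \<in> L1 \<Longrightarrow> u l \<noteq> (\<lambda>_. 0)"
    using L0 by (auto simp: L1_def)
  have dL1: "\<delta> g = (\<Sum>l\<in>L1. u l g)" for g
    unfolding L0(4) using L0(1) by (intro sum.mono_neutral_right) (auto simp: L1_def)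
  note ev = eigenvalue_nonneg[OF L1(2) L1(3) L1(4)]
  have re: "of_real (Re l) = l" if "l \<in> L1" for l using ev(1)[OF that that that] by simp
  have orth: "ip (u l) (u m) = 0" if "l \<in> L1" "m \<in> L1" "l \<noteq> m" for l m
  proof -
    have "m * ip (u l) (u m) = ip (u l) (T (u m))" using that by (simp add: L1(3) ip_scale_right)
    also have "\<dots> = ip (T (u l)) (u m)" by (simp add: T_selfadjoint)
    also have "\<dots> = cnj l * ip (u l) (u m)" using that by (simp add: L1(3) ip_scale_left)
    also have "cnj l = l" using re[OF that(1)] by (metis complex_cnj_complex_of_real)
    finally show ?thesis using that by simp
  qed
  define N where "N = (\<lambda>l. \<Sum>g\<in>H. (cmod (u l g))\<^sup>2)"
  have pow: "(T ^^ n) \<delta> = (\<lambda>g. \<Sum>l\<in>L1. l ^ n * u l g)" for n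
  proof (induction n)
    case 0 then show ?case using dL1 by auto
  next
    case (Suc n)
    have "(T ^^ Suc n) \<delta> = T (\<lambda>g. \<Sum>l\<in>L1. l ^ n * u l g)" using Suc by simp
    also have "\<dots> = (\<lambda>g. \<Sum>l\<in>L1. l ^ Suc n * u l g)"
      by (simp add: T_sum T_scale L1(3) mult_ac cong: sum.cong)
    finally show ?case .
  qed
  have ipd: "ip \<delta> v = v e" for v
    using assms finH by (simp add: ip_def \<delta>_def if_distrib[of cnj] if_distrib[of "\<lambda>x. x * _"] cong: if_cong)
  have moment: "(T ^^ n) \<delta> e = (\<Sum>l\<in>L1. l ^ n * of_real (N l))" for n
  proof -
    have "(T ^^ n) \<delta> e = ip \<delta> ((T ^^ n) \<delta>)" by (simp add: ipd)
    also have "\<dots> = ip (\<lambda>g. \<Sum>l\<in>L1. u l g) (\<lambda>g. \<Sum>l\<in>L1. l ^ n * u l g)"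
      using dL1 pow by (metis (no_types, lifting) ext)
    also have "\<dots> = (\<Sum>m\<in>L1. \<Sum>l\<in>L1. m ^ n * ip (u l) (u m))"
      by (simp add: ip_sum_left ip_sum_right ip_scale_right) (rule sum.swap)
    also have "\<dots> = (\<Sum>m\<in>L1. m ^ n * ip (u m) (u m))"
    proof (rule sum.cong[OF refl])
      fix m assume m: "m \<in> L1"
      have "(\<Sum>l\<in>L1. m ^ n * ip (u l) (u m)) = (\<Sum>l\<in>{m}. m ^ n * ip (u l) (u m))"
        using m L1(1) orth by (intro sum.mono_neutral_right) auto
      then show "(\<Sum>l\<in>L1. m ^ n * ip (u l) (u m)) = m ^ n * ip (u m) (u m)" by simp
    qed
    finally show ?thesis by (simp add: ip_self N_def)
  qed
  have inj: "inj_on Re L1" by (rule inj_onI) (metis re)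
  have cH: "card H > 0" using assms finH card_gt_0_iff by blast
  show thesis
  proof (rule that[of "Re ` L1" "\<lambda>x. N (of_real x)"])
    show "finite (Re ` L1)" using L1(1) by simp
    show "0 \<le> l" if "l \<in> Re ` L1" for l using that ev(4) by auto
    show "0 \<le> N (of_real l)" for l by (auto simp: N_def intro: sum_nonneg)
    show "(T ^^ n) (\<lambda>g. if g = e then 1 else 0) e = of_real (\<Sum>l\<in>Re ` L1. N (of_real l) * l ^ n)" for n
    proof -
      have "(T ^^ n) \<delta> e = (\<Sum>l\<in>L1. of_real (N (of_real (Re l)) * Re l ^ n))"
        unfolding moment by (intro sum.cong) (auto simp: re mult.commute)
      then show ?thesis unfolding \<delta>_def by (simp add: sum.reindex[OF inj])
    qed
    show "l \<le> C" if C: "\<And>v. (\<Sum>y\<in>Y. (cmod (mv v y))\<^sup>2) \<le> C * (\<Sum>g\<in>H. (cmod (v g))\<^sup>2)"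
      and l: "l \<in> Re ` L1" for C l
    proof -
      obtain m where m: "m \<in> L1" "l = Re m" using l by auto
      have "Re m * N m \<le> C * N m" using C[of "u m"] ev(2)[OF m(1) m(1) m(1)] by (simp add: N_def)
      moreover have "N m > 0" using ev(3)[OF m(1) m(1) m(1)] by (simp add: N_def)
      ultimately show ?thesis using m by simp
    qed
    show "(cmod s)\<^sup>2 \<in> Re ` L1 \<and> 1 / card H \<le> N (of_real ((cmod s)\<^sup>2))"
      if s1: "\<And>y. y \<in> Y \<Longrightarrow> (\<Sum>g\<in>H. B y g) = s" and s2: "\<And>g. g \<in> H \<Longrightarrow> (\<Sum>y\<in>Y. B y g) = s" for s
    proof -
      define x :: "'a \<Rightarrow> complex" where "x = (\<lambda>g. if g \<in> H then 1 else 0)"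
      define r :: complex where "r = of_real ((cmod s)\<^sup>2)"
      have mvx: "mv x y = s" if "y \<in> Y" for y using s1[OF that] by (simp add: mv_def x_def)
      have Tx: "ip v (T x) = r * ip v x" for v
      proof -
        have "ip v (T x) = (\<Sum>y\<in>Y. cnj (mv v y)) * s" by (simp add: ip_T mvx sum_distrib_right)
        also have "(\<Sum>y\<in>Y. cnj (mv v y)) = cnj (\<Sum>g\<in>H. \<Sum>y\<in>Y. B y g * v g)"
          unfolding mv_def cnj_sum by (rule sum.swap)
        also have "(\<Sum>g\<in>H. \<Sum>y\<in>Y. B y g * v g) = s * (\<Sum>g\<in>H. v g)"
          by (simp add: s2 sum_distrib_left sum_distrib_right[symmetric] cong: sum.cong)
        also have "cnj (s * (\<Sum>g\<in>H. v g)) * s = r * ip v x"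
          by (simp add: r_def complex_norm_square[symmetric] ip_def x_def mult_ac flip: of_real_power)
        finally show ?thesis .
      qed
      have ox: "ip (u m) x = 0" if "m \<in> L1" "m \<noteq> r" for m
      proof -
        have "r * ip (u m) x = ip (T (u m)) x" by (simp add: T_selfadjoint Tx)
        also have "\<dots> = cnj m * ip (u m) x" using that by (simp add: L1(3) ip_scale_left)
        also have "cnj m = m" using re[OF that(1)] by (metis complex_cnj_complex_of_real)
        finally show ?thesis using that by simp
      qed
      have one: "1 = (\<Sum>m\<in>L1. ip (u m) x)"
      proof -
        have "1 = ip \<delta> x" using assms by (simp add: ipd x_def)
        also have "\<dots> = ip (\<lambda>g. \<Sum>l\<in>L1. u l g) x" using dL1 by (metis (no_types, lifting) ext)
        finally show ?thesis by (simp add: ip_sum_left)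
      qed
      have rL: "r \<in> L1"
      proof (rule ccontr)
        assume "r \<notin> L1"
        then have "(\<Sum>m\<in>L1. ip (u m) x) = 0" using ox by (intro sum.neutral) auto
        with one show False by simp
      qed
      have "(\<Sum>m\<in>L1. ip (u m) x) = (\<Sum>m\<in>{r}. ip (u m) x)"
        using rL L1(1) ox by (intro sum.mono_neutral_right) auto
      \<comment> \<open>Only the component of eigenvalue \<open>r\<close> meets the constant vector.
        Cauchy-Schwarz against that vector, of squared norm |H|, bounds \<open>N r\<close> from
        below.\<close>
      with one have "ip (u r) x = 1" by simp
      then have "1 = cmod (\<Sum>g\<in>H. cnj (u r g))" by (simp add: ip_def x_def)
      also have "\<dots> \<le> (\<Sum>g\<in>H. cmod (u r g))" using norm_sum[of "\<lambda>g. cnj (u r g)" H] by simp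
      finally have "1 \<le> (\<Sum>g\<in>H. cmod (u r g))\<^sup>2" by (simp add: one_le_power)
      also have "\<dots> \<le> card H * N r"
        unfolding N_def using sum_squared_le_sum_of_squares[of "\<lambda>g. cmod (u r g)" H] finH
        by (simp add: mult.commute)
      finally have "1 / card H \<le> N r"
        using cH by (simp add: divide_le_eq mult.commute)
      moreover have "(cmod s)\<^sup>2 = Re r" by (simp add: r_def)
      ultimately show ?thesis using rL unfolding r_def by (metis imageI)
    qed
  qed
qed

end

section \<open>Measures determined by their moments\<close>

lemma bounded_support_integrable:
  fixes \<mu> :: "real measure"
  assumes "sets \<mu> = sets borel" "finite_measure \<mu>" "emeasure \<mu> (- {0..b}) = 0"
  shows "AE x in \<mu>. x \<in> {0..b}" "integrable \<mu> (\<lambda>x. x ^ n)"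
proof -
  interpret finite_measure \<mu> by fact
  have sp: "space \<mu> = UNIV" using assms(1) sets_eq_imp_space_eq by fastforce
  have m: "- {0..b} \<in> sets \<mu>" using assms(1) by simp
  show ae: "AE x in \<mu>. x \<in> {0..b}"
    using assms(3) m sp by (subst AE_iff_measurable[OF m]) auto
  have meas: "(\<lambda>x. x ^ n) \<in> borel_measurable \<mu>"
    using assms(1) by (simp cong: measurable_cong_sets)
  show "integrable \<mu> (\<lambda>x. x ^ n)"
  proof (rule integrable_const_bound[OF _ meas])
    show "AE x in \<mu>. norm (x ^ n) \<le> b ^ n" using ae by eventually_elim (auto intro: power_mono)
  qed
qed

text \<open>Bounded support allows integrating the exponential series term by term, so the
  characteristic function is a power series in the moments.\<close>

lemma bounded_support_char:
  fixes \<mu> :: "real measure"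
  assumes "sets \<mu> = sets borel" "finite_measure \<mu>" "emeasure \<mu> (- {0..b}) = 0"
  shows "(\<lambda>n. (\<i> * t) ^ n / fact n * of_real (\<integral>x. x ^ n \<partial>\<mu>)) sums char \<mu> t"
proof -
  note ae = bounded_support_integrable(1)[OF assms]
  note int = bounded_support_integrable(2)[OF assms]
  define B where "B = \<bar>b\<bar>"
  define f where "f = (\<lambda>n x. (\<i> * t) ^ n / fact n * complex_of_real (x ^ n))"
  have intf: "integrable \<mu> (f n)" for n
    unfolding f_def by (intro integrable_mult_right integrable_of_real int)
  have nf: "norm (f n x) = (\<bar>t\<bar> * \<bar>x\<bar>) ^ n / fact n" for n x
    by (simp add: f_def norm_mult norm_divide norm_power power_mult_distrib power_abs)
  have sumnf: "summable (\<lambda>n. norm (f n x))" for x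
    unfolding nf using summable_exp[of "\<bar>t\<bar> * \<bar>x\<bar>"] by (simp add: divide_inverse mult.commute)
  have "(\<lambda>n. integral\<^sup>L \<mu> (f n)) sums (\<integral>x. (\<Sum>n. f n x) \<partial>\<mu>)"
  proof (rule sums_integral[OF intf])
    show "AE x in \<mu>. summable (\<lambda>n. norm (f n x))" using sumnf by simp
    show "summable (\<lambda>n. \<integral>x. norm (f n x) \<partial>\<mu>)"
    proof (rule summable_comparison_test')
      show "summable (\<lambda>n. measure \<mu> (space \<mu>) * ((\<bar>t\<bar> * B) ^ n / fact n))"
        using summable_exp[of "\<bar>t\<bar> * B"] by (intro summable_mult) (simp add: divide_inverse mult.commute)
      fix n
      have "(\<integral>x. norm (f n x) \<partial>\<mu>) \<le> (\<integral>x. (\<bar>t\<bar> * B) ^ n / fact n \<partial>\<mu>)"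
      proof (rule integral_mono_AE)
        show "integrable \<mu> (\<lambda>x. norm (f n x))" using intf by simp
        show "integrable \<mu> (\<lambda>x. (\<bar>t\<bar> * B) ^ n / fact n)"
          using assms(2) by (simp add: finite_measure.integrable_const)
        show "AE x in \<mu>. norm (f n x) \<le> (\<bar>t\<bar> * B) ^ n / fact n"
          using ae by eventually_elim
            (auto simp: nf B_def intro!: divide_right_mono power_mono mult_left_mono)
      qed
      then show "norm (\<integral>x. norm (f n x) \<partial>\<mu>) \<le> measure \<mu> (space \<mu>) * ((\<bar>t\<bar> * B) ^ n / fact n)"
        by simp
    qed
  qed
  moreover have "(\<Sum>n. f n x) = iexp (t * x)" for x
  proof -
    have "f n x = (\<i> * t * x) ^ n /\<^sub>R fact n" for n
      by (simp add: f_def scaleR_conv_of_real power_mult_distrib field_simps)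
    then show ?thesis by (simp add: exp_def mult.assoc)
  qed
  moreover have "integral\<^sup>L \<mu> (f n) = (\<i> * t) ^ n / fact n * of_real (\<integral>x. x ^ n \<partial>\<mu>)" for n
    unfolding f_def by (simp only: integral_mult_right_zero integral_complex_of_real)
  ultimately show ?thesis by (simp add: char_def)
qed

text \<open>Equal moments give equal characteristic functions. The zeroth moment is normalised
  because Levy uniqueness concerns probability measures.\<close>

lemma bounded_moments_determine:
  fixes \<mu> \<nu> :: "real measure"
  assumes "sets \<mu> = sets borel" "finite_measure \<mu>" "emeasure \<mu> (- {0..b}) = 0"
    and "sets \<nu> = sets borel" "finite_measure \<nu>" "emeasure \<nu> (- {0..c}) = 0"
    and eq: "\<And>n. (\<integral>x. x ^ n \<partial>\<mu>) = (\<integral>x. x ^ n \<partial>\<nu>)" and one: "(\<integral>x. x ^ 0 \<partial>\<mu>) = 1"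
  shows "\<mu> = \<nu>"
proof (rule Levy_uniqueness)
  have rd: "real_distribution \<rho>"
    if "sets \<rho> = sets borel" "finite_measure \<rho>" "(\<integral>x. x ^ 0 \<partial>\<rho>) = 1" for \<rho> :: "real measure"
  proof -
    interpret finite_measure \<rho> by fact
    have "measure \<rho> (space \<rho>) = 1" using that(3) by simp
    then have "prob_space \<rho>" by (intro prob_spaceI) (simp add: emeasure_eq_measure)
    then show ?thesis using that(1) sets_eq_imp_space_eq[OF that(1)]
      by (auto simp: real_distribution_def real_distribution_axioms_def)
  qed
  show "real_distribution \<mu>" using rd assms by blast
  show "real_distribution \<nu>" using rd[OF assms(4,5)] eq[of 0] one by simp
  show "char \<mu> = char \<nu>"
    using sums_unique2[OF bounded_support_char[OF assms(1-3)]]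
      bounded_support_char[OF assms(4-6), folded eq] by blast
qed

text \<open>\<open>spec_meas\<close> is a definite description, so it can be evaluated only once
  uniqueness is known. The atomic measure with weights \<open>w\<close> has the prescribed moments,
  and its moments determine it.\<close>

lemma spec_meas_integral:
  fixes a :: "'k::field fls ^4^4 \<Rightarrow> complex"
  assumes L: "finite L" "\<And>l. l \<in> L \<Longrightarrow> 0 \<le> l" "\<And>l. l \<in> L \<Longrightarrow> 0 \<le> w l"
    and mom: "\<And>n. Re (gtrace (((conv (conv (adj a) a)) ^^ n) delta1)) = (\<Sum>l\<in>L. w l * l ^ n)"
  shows "(\<integral>t. t powr r \<partial>(spec_meas a)) = (\<Sum>l\<in>L. w l * l powr r)"
proof -
  define \<mu> where "\<mu> = distr (point_measure L (\<lambda>l. ennreal (w l))) borel (\<lambda>x. x)"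
  \<comment> \<open>The zeroth iterate is \<open>delta1\<close> itself, whose trace is 1.\<close>
  have one: "(\<Sum>l\<in>L. w l) = 1" using mom[of 0] by (simp add: gtrace_def delta1_def)
  have meas: "(\<lambda>x. x) \<in> measurable (point_measure L (\<lambda>l. ennreal (w l))) borel"
    by (simp add: point_measure_def measurable_count_space_eq1)
  have int: "(\<integral>t. g t \<partial>\<mu>) = (\<Sum>l\<in>L. w l * g l)" if "g \<in> borel_measurable borel" for g :: "real \<Rightarrow> real"
    unfolding \<mu>_def using that meas L
    by (subst integral_distr) (auto simp: lebesgue_integral_point_measure_finite)
  have s: "sets \<mu> = sets borel" by (simp add: \<mu>_def)
  have fin: "finite_measure \<mu>"
    unfolding \<mu>_def
    by (intro finite_measure.finite_measure_distr finite_measureI meas)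
       (use L in \<open>simp add: space_point_measure emeasure_point_measure_finite2 emeasure_point_measure_finite\<close>)
  have supp: "emeasure \<mu> (- {0..Max (insert 0 L)}) = 0"
  proof -
    have "(\<lambda>x. x) -` (- {0..Max (insert 0 L)}) \<inter> L = {}" using L(1,2) by auto
    then show ?thesis unfolding \<mu>_def using meas
      by (subst emeasure_distr) (auto simp: space_point_measure)
  qed
  have momu: "(\<integral>t. t ^ n \<partial>\<mu>) = (\<Sum>l\<in>L. w l * l ^ n)" for n by (rule int) simp
  have "spec_meas a = \<mu>"
    unfolding spec_meas_def
  proof (rule the_equality)
    show "sets \<mu> = sets borel \<and> finite_measure \<mu> \<and> (\<exists>B. emeasure \<mu> (- {0..B}) = 0) \<and>
       (\<forall>n. (\<integral>t. t ^ n \<partial>\<mu>) = Re (gtrace ((conv (conv (adj a) a) ^^ n) delta1)))"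
      using s fin supp momu mom by auto
    fix \<nu> :: "real measure"
    assume \<nu>: "sets \<nu> = sets borel \<and> finite_measure \<nu> \<and> (\<exists>B. emeasure \<nu> (- {0..B}) = 0) \<and>
       (\<forall>n. (\<integral>t. t ^ n \<partial>\<nu>) = Re (gtrace ((conv (conv (adj a) a) ^^ n) delta1)))"
    then obtain B where B: "emeasure \<nu> (- {0..B}) = 0" by blast
    have "(\<integral>t. t ^ 0 \<partial>\<nu>) = (\<Sum>l\<in>L. w l * l ^ 0)" using \<nu> mom by metis
    then have nu1: "(\<integral>t. t ^ 0 \<partial>\<nu>) = 1" using one by simp
    show "\<nu> = \<mu>"
      by (rule bounded_moments_determine[OF _ _ B s fin supp]) (use \<nu> nu1 in \<open>simp_all add: momu mom\<close>)
  qed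
  then show ?thesis by (simp add: int)
qed

section \<open>The symplectic group\<close>

text \<open>Elements of the type \<open>4\<close> are residues modulo 4. The library enumerates them
  as 1, 2, 3, 4 with 4 = 0, whereas the symplectic form is indexed by 0, 1, 2, 3.\<close>

lemma four_eq_zero: "(4::4) = 0" by simp

lemma sum_4': "sum f (UNIV::4 set) = f 0 + f 1 + f 2 + f 3"
  using sum_4[of f] four_eq_zero by (simp add: add_ac)

lemma forall_4': "(\<forall>i::4. P i) \<longleftrightarrow> P 0 \<and> P 1 \<and> P 2 \<and> P 3"
  using forall_4[of P] four_eq_zero by auto

lemma exhaust_4': "(i::4) = 0 \<or> i = 1 \<or> i = 2 \<or> i = 3"
  using exhaust_4[of i] four_eq_zero by auto

lemma Jsp_squared: "Jsp ** Jsp = (- mat 1 :: 'a::comm_ring_1 ^4^4)"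
  by (simp add: vec_eq_iff matrix_matrix_mult_def Jsp_def mat_def sum_4' forall_4')

lemma matrix_mult_minus_left: "(- A) ** (B :: 'a::comm_ring_1 ^'n^'m) = - (A ** B)"
  by (simp add: vec_eq_iff matrix_matrix_mult_def sum_negf)

lemma matrix_mult_minus_right: "A ** (- B :: 'a::comm_ring_1 ^'n^'m) = - (A ** B)"
  by (simp add: vec_eq_iff matrix_matrix_mult_def sum_negf)

text \<open>As J^2 = -1, the relation A^t J A = J exhibits -J A^t J as an inverse of
  \<open>A\<close>. Its entries are signed entries of \<open>A\<close>, so it stays in every
  coefficient ring.\<close>

definition symp_inv :: "'a::comm_ring_1 ^4^4 \<Rightarrow> 'a ^4^4" where
  "symp_inv A = - (Jsp ** transpose A ** Jsp)"

lemma symp_inv_left: "transpose A ** Jsp ** A = Jsp \<Longrightarrow> symp_inv A ** A = mat 1"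
  by (simp add: symp_inv_def matrix_mult_minus_left matrix_mul_assoc[symmetric])
     (simp add: matrix_mul_assoc Jsp_squared)

lemma symp_inv_right:
  fixes A :: "'a::field ^4^4"
  shows "transpose A ** Jsp ** A = Jsp \<Longrightarrow> A ** symp_inv A = mat 1"
  using symp_inv_left matrix_left_right_inverse by blast

lemma symp_rows:
  fixes A :: "'a::field ^4^4"
  assumes "transpose A ** Jsp ** A = Jsp"
  shows "A ** Jsp ** transpose A = Jsp"
proof -
  have "A ** (Jsp ** transpose A ** Jsp) = - mat 1"
    using symp_inv_right[OF assms] by (simp add: symp_inv_def matrix_mult_minus_right) (metis minus_minus)
  then have "A ** (Jsp ** transpose A ** Jsp) ** Jsp = - Jsp" by (simp add: matrix_mult_minus_left)
  then have "A ** Jsp ** transpose A ** (Jsp ** Jsp) = - Jsp" by (simp add: matrix_mul_assoc)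
  then show ?thesis by (simp add: Jsp_squared matrix_mult_minus_right)
qed

definition subring_set :: "'a::comm_ring_1 set \<Rightarrow> bool" where
  "subring_set R \<longleftrightarrow> 0 \<in> R \<and> 1 \<in> R \<and> (\<forall>x\<in>R. \<forall>y\<in>R. x + y \<in> R \<and> x * y \<in> R) \<and> (\<forall>x\<in>R. - x \<in> R)"

lemma subring_set_mult: "subring_set R \<Longrightarrow> (\<And>i j. A$i$j \<in> R) \<Longrightarrow> (\<And>i j. B$i$j \<in> R) \<Longrightarrow>
   ((A::'a::comm_ring_1^4^4) ** B)$i$j \<in> R"
  by (simp add: matrix_matrix_mult_def sum_4' subring_set_def)

lemma Sp4_mult: "subring_set R \<Longrightarrow> A \<in> Sp4 R \<Longrightarrow> B \<in> Sp4 R \<Longrightarrow> A ** B \<in> Sp4 R"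
proof -
  assume R: "subring_set R" and A: "A \<in> Sp4 R" and B: "B \<in> Sp4 R"
  have "transpose (A ** B) ** Jsp ** (A ** B) = transpose B ** (transpose A ** Jsp ** A) ** B"
    by (simp add: matrix_transpose_mul matrix_mul_assoc)
  then show ?thesis using A B by (auto simp: Sp4_def intro!: subring_set_mult[OF R])
qed

lemma Sp4_one: "subring_set R \<Longrightarrow> mat 1 \<in> Sp4 R"
  by (auto simp: Sp4_def transpose_mat mat_def subring_set_def)
     (metis matrix_mul_lid matrix_mul_rid mat_def transpose_mat)

lemma Sp4_symp_inv:
  fixes A :: "'a::field ^4^4"
  assumes R: "subring_set R" and A: "A \<in> Sp4 R"
  shows "symp_inv A \<in> Sp4 R"
proof -
  have J: "Jsp $ i $ j \<in> R" for i j using R by (auto simp: Jsp_def subring_set_def)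
  have "(Jsp ** transpose A ** Jsp) $ i $ j \<in> R" for i j
    using A by (intro subring_set_mult[OF R] J) (auto simp: transpose_def Sp4_def)
  moreover have "transpose (symp_inv A) ** Jsp ** symp_inv A = Jsp"
  proof -
    have a: "transpose A ** Jsp ** A = Jsp" using A by (simp add: Sp4_def)
    have 1: "A ** symp_inv A = mat 1" using symp_inv_right[OF a] .
    then have 2: "transpose (symp_inv A) ** transpose A = mat 1"
      by (metis matrix_transpose_mul transpose_mat)
    have "transpose (symp_inv A) ** Jsp ** symp_inv A
       = transpose (symp_inv A) ** (transpose A ** Jsp ** A) ** symp_inv A" using a by simp
    also have "\<dots> = (transpose (symp_inv A) ** transpose A) ** Jsp ** (A ** symp_inv A)"
      by (simp add: matrix_mul_assoc)
    finally show ?thesis using 1 2 by simp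
  qed
  ultimately show ?thesis using R by (auto simp: Sp4_def symp_inv_def subring_set_def)
qed

lemma subring_polyinv: "subring_set (polyinv :: 'k::field fls set)"
proof -
  have "x * y \<in> polyinv" if "x \<in> polyinv" "y \<in> polyinv" for x y :: "'k fls"
    unfolding polyinv_def
  proof safe
    fix n :: int assume "n > 0"
    show "fls_nth (x * y) n = 0"
      unfolding fls_times_nth(2)
    proof (rule sum.neutral, safe)
      fix i
      show "fls_nth x i * fls_nth y (n - i) = 0"
        using that \<open>n > 0\<close> by (cases "i > 0") (auto simp: polyinv_def)
    qed
  qed
  then show ?thesis by (auto simp: subring_set_def polyinv_def)
qed

lemma subring_intO: "subring_set (intO :: 'k::field fls set)"
proof -
  have "x + y \<in> intO" if "x \<in> intO" "y \<in> intO" for x y :: "'k fls"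
  proof (cases "x + y = 0")
    case False
    have "min (fls_subdegree x) (fls_subdegree y) \<le> fls_subdegree (x + y)"
      using fls_plus_subdegree[OF False] .
    then show ?thesis using that by (auto simp: intO_def)
  qed (simp add: intO_def)
  moreover have "x * y \<in> intO" if "x \<in> intO" "y \<in> intO" for x y :: "'k fls"
    using that by (cases "x = 0 \<or> y = 0") (auto simp: intO_def)
  ultimately show ?thesis by (auto simp: subring_set_def intO_def)
qed

lemma ginv_eq: "A \<in> Sp4 R \<Longrightarrow> ginv A = symp_inv A"
  unfolding ginv_def
proof (rule the_equality)
  assume "A \<in> Sp4 R"
  then have a: "transpose A ** Jsp ** A = Jsp" by (simp add: Sp4_def)
  show "symp_inv A ** A = mat 1 \<and> A ** symp_inv A = mat 1"
    using symp_inv_left[OF a] symp_inv_right[OF a] by simp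
  fix B assume "B ** A = mat 1 \<and> A ** B = mat 1"
  then show "B = symp_inv A"
    by (metis symp_inv_right[OF a] matrix_mul_assoc matrix_mul_lid matrix_mul_rid)
qed

lemma Gam_mult: "g \<in> Gam \<Longrightarrow> h \<in> Gam \<Longrightarrow> g ** h \<in> Gam"
  by (rule Sp4_mult[OF subring_polyinv])
lemma Gam_one: "mat 1 \<in> Gam" by (rule Sp4_one[OF subring_polyinv])
lemma Gam_ginv: "g \<in> Gam \<Longrightarrow> ginv g \<in> Gam"
  using Sp4_symp_inv[OF subring_polyinv] ginv_eq by metis
lemma ginv_left: "g \<in> Gam \<Longrightarrow> ginv g ** g = mat 1"
  by (simp add: ginv_eq) (simp add: Sp4_def symp_inv_left)
lemma ginv_right: "g \<in> Gam \<Longrightarrow> g ** ginv g = mat 1"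
  by (simp add: ginv_eq) (simp add: Sp4_def symp_inv_right)
lemma ginv_cancel: "g \<in> Gam \<Longrightarrow> ginv g ** (g ** x) = x" "g \<in> Gam \<Longrightarrow> g ** (ginv g ** x) = x"
  by (simp_all add: matrix_mul_assoc ginv_left ginv_right)
lemma ginv_unique: "g \<in> Gam \<Longrightarrow> g ** h = mat 1 \<Longrightarrow> ginv g = h"
  by (metis ginv_cancel(1) matrix_mul_rid)
lemma ginv_ginv: "g \<in> Gam \<Longrightarrow> ginv (ginv g) = g"
  by (intro ginv_unique Gam_ginv ginv_left)
lemma ginv_mult: "g \<in> Gam \<Longrightarrow> h \<in> Gam \<Longrightarrow> ginv (g ** h) = ginv h ** ginv g"
  by (intro ginv_unique Gam_mult) (simp_all add: matrix_mul_assoc[symmetric] ginv_cancel ginv_right)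

lemma conv_finite:
  assumes "finite S" "S \<subseteq> Gam" "\<And>h. h \<in> Gam \<Longrightarrow> a h \<noteq> 0 \<Longrightarrow> h \<in> S"
  shows "conv a b g = (\<Sum>h\<in>S. a h * b (ginv h ** g))"
  unfolding conv_def using assms by (intro sum.mono_neutral_left) auto

lemma l2sq_finite:
  assumes "finite S" "S \<subseteq> Gam" "\<And>h. h \<in> Gam \<Longrightarrow> b h \<noteq> 0 \<Longrightarrow> h \<in> S"
  shows "l2sq b = (\<Sum>h\<in>S. (cmod (b h))\<^sup>2)"
  unfolding l2sq_def using assms by (intro sum.mono_neutral_left) auto

section \<open>Elements supported on a coset of a finite subgroup\<close>

lemma finsuppI: "finite S \<Longrightarrow> (\<And>h. h \<in> Gam \<Longrightarrow> b h \<noteq> 0 \<Longrightarrow> h \<in> S) \<Longrightarrow> finsupp b"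
  unfolding finsupp_def by (rule finite_subset[of _ S]) auto

lemma l2sq_nonneg: "0 \<le> l2sq b"
  by (auto simp: l2sq_def intro: sum_nonneg)

lemma translate_support:
  assumes "g \<in> Gam" "finsupp b"
  defines "S \<equiv> (\<lambda>h. g ** h) ` {h \<in> Gam. b h \<noteq> 0}"
  shows "finite S" "S \<subseteq> Gam" "\<And>h. h \<in> Gam \<Longrightarrow> b (ginv g ** h) \<noteq> 0 \<Longrightarrow> h \<in> S"
proof -
  show "finite S" "S \<subseteq> Gam" using assms by (auto simp: finsupp_def intro: Gam_mult)
  fix h assume "h \<in> Gam" "b (ginv g ** h) \<noteq> 0"
  then show "h \<in> S" unfolding S_def using assms(1)
    by (intro image_eqI[of _ _ "ginv g ** h"]) (auto simp: ginv_cancel intro: Gam_mult Gam_ginv)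
qed

lemma l2sq_translate:
  assumes "g \<in> Gam" "finsupp b"
  shows "l2sq (\<lambda>h. b (ginv g ** h)) = l2sq b"
proof -
  have "inj_on (\<lambda>h. g ** h) {h \<in> Gam. b h \<noteq> 0}"
    by (rule inj_on_inverseI[of _ "\<lambda>h. ginv g ** h"]) (use assms in \<open>simp add: ginv_cancel\<close>)
  then show ?thesis
    by (subst l2sq_finite[OF translate_support[OF assms]]) (auto simp: sum.reindex ginv_cancel assms l2sq_def)
qed

lemma finsupp_translate_sum:
  assumes "finite I" "\<And>i. i \<in> I \<Longrightarrow> g i \<in> Gam" "finsupp b"
  shows "finsupp (\<lambda>h. \<Sum>i\<in>I. a i * b (ginv (g i) ** h))"
proof (rule finsuppI)
  show "finite (\<Union>i\<in>I. (\<lambda>h. g i ** h) ` {h \<in> Gam. b h \<noteq> 0})"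
    using assms translate_support(1) by blast
  fix h assume "h \<in> Gam" "(\<Sum>i\<in>I. a i * b (ginv (g i) ** h)) \<noteq> 0"
  then obtain i where "i \<in> I" "b (ginv (g i) ** h) \<noteq> 0" by (metis (no_types, lifting) mult_zero_right sum.neutral)
  then show "h \<in> (\<Union>i\<in>I. (\<lambda>h. g i ** h) ` {h \<in> Gam. b h \<noteq> 0})"
    using translate_support(3)[OF assms(2) assms(3) \<open>h \<in> Gam\<close>] by blast
qed

text \<open>Cauchy-Schwarz over \<open>I\<close> and translation invariance, without any
  cancellation: coefficients of modulus 1 give the trivial factor |I|^2.\<close>

lemma l2sq_translate_sum_le:
  assumes I: "finite I" "\<And>i. i \<in> I \<Longrightarrow> g i \<in> Gam" and b: "finsupp b"
  shows "l2sq (\<lambda>h. \<Sum>i\<in>I. a i * b (ginv (g i) ** h)) \<le> card I * (\<Sum>i\<in>I. (cmod (a i))\<^sup>2) * l2sq b"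
proof -
  define S where "S = (\<Union>i\<in>I. (\<lambda>h. g i ** h) ` {h \<in> Gam. b h \<noteq> 0})"
  have S: "finite S" "S \<subseteq> Gam" using assms translate_support(1,2) by (auto simp: S_def intro!: Gam_mult)
  have iS: "h \<in> S" if "i \<in> I" "h \<in> Gam" "b (ginv (g i) ** h) \<noteq> 0" for i h
    using translate_support(3)[OF I(2)[OF that(1)] b that(2,3)] that(1) by (auto simp: S_def)
  have l2i: "(\<Sum>h\<in>S. (cmod (b (ginv (g i) ** h)))\<^sup>2) = l2sq b" if "i \<in> I" for i
    using l2sq_finite[OF S, of "\<lambda>h. b (ginv (g i) ** h)"] iS[OF that] l2sq_translate[OF I(2)[OF that] b] by simp
  have "l2sq (\<lambda>h. \<Sum>i\<in>I. a i * b (ginv (g i) ** h)) = (\<Sum>h\<in>S. (cmod (\<Sum>i\<in>I. a i * b (ginv (g i) ** h)))\<^sup>2)"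
    by (rule l2sq_finite[OF S]) (metis (no_types, lifting) iS mult_zero_right sum.neutral)
  also have "\<dots> \<le> (\<Sum>h\<in>S. card I * (\<Sum>i\<in>I. (cmod (a i))\<^sup>2 * (cmod (b (ginv (g i) ** h)))\<^sup>2))"
  proof (rule sum_mono)
    fix h
    have "(cmod (\<Sum>i\<in>I. a i * b (ginv (g i) ** h)))\<^sup>2 \<le> (\<Sum>i\<in>I. cmod (a i) * cmod (b (ginv (g i) ** h)))\<^sup>2"
      by (intro power_mono order.trans[OF norm_sum]) (auto simp: norm_mult)
    also have "\<dots> \<le> card I * (\<Sum>i\<in>I. (cmod (a i) * cmod (b (ginv (g i) ** h)))\<^sup>2)"
      using sum_squared_le_sum_of_squares[of "\<lambda>i. cmod (a i) * cmod (b (ginv (g i) ** h))" I] I(1)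
      by (simp add: mult.commute)
    finally show "(cmod (\<Sum>i\<in>I. a i * b (ginv (g i) ** h)))\<^sup>2
        \<le> card I * (\<Sum>i\<in>I. (cmod (a i))\<^sup>2 * (cmod (b (ginv (g i) ** h)))\<^sup>2)"
      by (simp add: power_mult_distrib)
  qed
  also have "\<dots> = card I * (\<Sum>i\<in>I. (cmod (a i))\<^sup>2 * (\<Sum>h\<in>S. (cmod (b (ginv (g i) ** h)))\<^sup>2))"
    unfolding sum_distrib_left[symmetric] by (subst sum.swap) (simp add: sum_distrib_left)
  also have "\<dots> = card I * (\<Sum>i\<in>I. (cmod (a i))\<^sup>2) * l2sq b"
    by (simp add: l2i sum_distrib_right cong: sum.cong)
  finally show ?thesis .
qed

definition fin_subgroup :: "('k::field fls ^4^4) set \<Rightarrow> bool" where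
  "fin_subgroup H \<longleftrightarrow> finite H \<and> H \<subseteq> Gam \<and> mat 1 \<in> H \<and> (\<forall>g\<in>H. \<forall>h\<in>H. g ** h \<in> H) \<and> (\<forall>g\<in>H. ginv g \<in> H)"

text \<open>Left convolution by an element supported on g0 H maps functions on \<open>H\<close> to
  functions on g0 H, and a^* a is supported on \<open>H\<close>. The spectral theory of such an
  element is therefore that of a finite matrix.\<close>

locale coset_support =
  fixes H :: "('k::field fls ^4^4) set" and g0 :: "'k fls ^4^4" and a :: "'k fls ^4^4 \<Rightarrow> complex"
    and Y :: "('k fls ^4^4) set"
  assumes H: "fin_subgroup H" and g0: "g0 \<in> Gam" and Y_def: "Y = (\<lambda>h. g0 ** h) ` H"
    and supp: "\<And>g. g \<in> Gam \<Longrightarrow> a g \<noteq> 0 \<Longrightarrow> g \<in> Y"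
begin

lemma H': "finite H" "H \<subseteq> Gam" "mat 1 \<in> H" "\<And>g h. g \<in> H \<Longrightarrow> h \<in> H \<Longrightarrow> g ** h \<in> H" "\<And>g. g \<in> H \<Longrightarrow> ginv g \<in> H"
  using H by (auto simp: fin_subgroup_def)

lemma HG: "h \<in> H \<Longrightarrow> h \<in> Gam" using H'(2) by auto

lemma Y: "finite Y" "Y \<subseteq> Gam"
  using H' g0 by (auto simp: Y_def intro: Gam_mult)

lemma YG: "y \<in> Y \<Longrightarrow> y \<in> Gam" using Y(2) by auto

lemma YH: "y \<in> Y \<Longrightarrow> h \<in> H \<Longrightarrow> y ** h \<in> Y"
  using H' by (auto simp: Y_def matrix_mul_assoc[symmetric])

lemma YY: "y \<in> Y \<Longrightarrow> x \<in> Y \<Longrightarrow> ginv y ** x \<in> H"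
  using H' g0 by (auto simp: Y_def ginv_mult HG matrix_mul_assoc[symmetric] ginv_cancel)

lemma Y_quot: "y \<in> Y \<Longrightarrow> h \<in> Gam \<Longrightarrow> y ** h \<in> Y \<Longrightarrow> h \<in> H"
  using YY[of y "y ** h"] by (simp add: ginv_cancel YG)

lemma bij_H_Y: "y \<in> Y \<Longrightarrow> bij_betw (\<lambda>g. y ** ginv g) H Y"
  by (rule bij_betw_byWitness[of _ "\<lambda>x. ginv x ** y"])
     (auto simp: ginv_mult ginv_ginv ginv_cancel HG YG H' Gam_ginv Gam_mult matrix_mul_assoc[symmetric] ginv_left
       intro!: YH YY)

lemma bij_Y_Y: "g \<in> H \<Longrightarrow> bij_betw (\<lambda>y. y ** ginv g) Y Y"
  by (rule bij_betw_byWitness[of _ "\<lambda>x. x ** g"])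
     (auto simp: HG H' matrix_mul_assoc[symmetric] ginv_left ginv_right intro!: YH)

lemma bij_H_H: "g \<in> H \<Longrightarrow> bij_betw (\<lambda>h. g ** ginv h) H H"
  by (rule bij_betw_byWitness[of _ "\<lambda>x. ginv x ** g"])
     (auto simp: ginv_mult ginv_ginv ginv_cancel HG H' Gam_ginv Gam_mult matrix_mul_assoc[symmetric] ginv_left)

text \<open>The matrix of left convolution by \<open>a\<close>, from functions on \<open>H\<close>
  to functions on \<open>Y\<close>.\<close>

sublocale gram H Y "\<lambda>y g. a (y ** ginv g)"
  by standard (use H' Y in auto)

lemma conv_sum: "conv a b g = (\<Sum>h\<in>Y. a h * b (ginv h ** g))"
  by (rule conv_finite[OF Y supp])

lemma conv_coset: "y \<in> Y \<Longrightarrow> conv a b y = mv b y"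
proof -
  assume y: "y \<in> Y"
  have "conv a b y = (\<Sum>h\<in>Y. a h * b (ginv h ** y))" by (rule conv_sum)
  also have "\<dots> = (\<Sum>g\<in>H. a (y ** ginv g) * b (ginv (y ** ginv g) ** y))"
    by (rule sum.reindex_bij_betw[OF bij_H_Y[OF y], symmetric])
  also have "\<dots> = mv b y" unfolding mv_def using y
    by (intro sum.cong) (auto simp: ginv_mult ginv_ginv Gam_ginv HG YG matrix_mul_assoc[symmetric] ginv_left)
  finally show ?thesis .
qed

lemma modulus_square: "h \<in> Gam \<Longrightarrow> conv (adj a) a h = (\<Sum>x\<in>Y. cnj (a x) * a (x ** h))"
proof -
  assume h: "h \<in> Gam"
  have inj: "inj_on ginv Y" by (rule inj_on_inverseI[of _ ginv]) (simp add: ginv_ginv YG)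
  have "conv (adj a) a h = (\<Sum>x\<in>ginv ` Y. adj a x * a (ginv x ** h))"
  proof (rule conv_finite)
    show "finite (ginv ` Y)" "ginv ` Y \<subseteq> Gam" using Y by (auto intro: Gam_ginv)
    show "x \<in> ginv ` Y" if "x \<in> Gam" "adj a x \<noteq> 0" for x
      using that supp[of "ginv x"] by (intro image_eqI[of _ _ "ginv x"]) (auto simp: adj_def ginv_ginv Gam_ginv)
  qed
  also have "\<dots> = (\<Sum>x\<in>Y. cnj (a x) * a (x ** h))"
    by (simp add: sum.reindex[OF inj] adj_def ginv_ginv YG cong: sum.cong)
  finally show ?thesis .
qed

text \<open>The value of a^* a at g h^(-1) is the (g, h) entry of the Gram matrix, by the
  substitution x = y g^(-1) in the sum over the coset.\<close>

lemma conv_modulus_square: "g \<in> H \<Longrightarrow> conv (conv (adj a) a) b g = T b g"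
proof -
  assume g: "g \<in> H"
  let ?K = "conv (adj a) a"
  have "?K h = 0" if h: "h \<in> Gam" "h \<notin> H" for h
    unfolding modulus_square[OF h(1)]
    by (rule sum.neutral) (metis Gam_mult YG Y_quot h mult_zero_right supp)
  then have "conv ?K b g = (\<Sum>h\<in>H. ?K h * b (ginv h ** g))"
    by (intro conv_finite H'(1,2)) auto
  also have "\<dots> = (\<Sum>h\<in>H. ?K (g ** ginv h) * b (ginv (g ** ginv h) ** g))"
    by (rule sum.reindex_bij_betw[OF bij_H_H[OF g], symmetric])
  also have "\<dots> = (\<Sum>h\<in>H. (\<Sum>y\<in>Y. cnj (a (y ** ginv g)) * a (y ** ginv h)) * b h)"
  proof (rule sum.cong[OF refl])
    fix h assume h: "h \<in> H"
    have "?K (g ** ginv h) = (\<Sum>x\<in>Y. cnj (a x) * a (x ** (g ** ginv h)))"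
      using g h by (intro modulus_square Gam_mult Gam_ginv HG)
    also have "\<dots> = (\<Sum>y\<in>Y. cnj (a (y ** ginv g)) * a (y ** ginv g ** (g ** ginv h)))"
      by (rule sum.reindex_bij_betw[OF bij_Y_Y[OF g], symmetric])
    also have "\<dots> = (\<Sum>y\<in>Y. cnj (a (y ** ginv g)) * a (y ** ginv h))"
      using g by (simp add: matrix_mul_assoc[symmetric] ginv_cancel HG)
    finally show "?K (g ** ginv h) * b (ginv (g ** ginv h) ** g)
      = (\<Sum>y\<in>Y. cnj (a (y ** ginv g)) * a (y ** ginv h)) * b h"
      using g h by (simp add: ginv_mult ginv_ginv Gam_ginv HG matrix_mul_assoc[symmetric] ginv_left)
  qed
  also have "\<dots> = T b g" using g by (simp add: T_def)
  finally show ?thesis .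
qed

lemma T_cong: "(\<And>h. h \<in> H \<Longrightarrow> u h = v h) \<Longrightarrow> T u g = T v g"
  by (simp add: T_def)

lemma conv_modulus_square_power:
  "g \<in> H \<Longrightarrow> ((conv (conv (adj a) a)) ^^ n) delta1 g = (T ^^ n) (\<lambda>g. if g = mat 1 then 1 else 0) g"
proof (induction n arbitrary: g)
  case 0 then show ?case by (simp add: delta1_def)
next
  case (Suc n)
  have "((conv (conv (adj a) a)) ^^ Suc n) delta1 g = T (((conv (conv (adj a) a)) ^^ n) delta1) g"
    using conv_modulus_square[OF Suc.prems] by simp
  also have "\<dots> = T ((T ^^ n) (\<lambda>g. if g = mat 1 then 1 else 0)) g"
    using Suc.IH by (intro T_cong)
  finally show ?case by simp
qed

lemma conv_bound_coset:
  assumes op: "\<And>b. finsupp b \<Longrightarrow> l2sq (conv a b) \<le> C * l2sq b"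
  shows "(\<Sum>y\<in>Y. (cmod (mv v y))\<^sup>2) \<le> C * (\<Sum>g\<in>H. (cmod (v g))\<^sup>2)"
proof -
  define b where "b = (\<lambda>g. if g \<in> H then v g else 0)"
  have fb: "finsupp b" by (rule finsuppI[OF H'(1)]) (auto simp: b_def split: if_splits)
  have lb: "l2sq b = (\<Sum>g\<in>H. (cmod (v g))\<^sup>2)"
    by (subst l2sq_finite[OF H'(1,2)]) (auto simp: b_def split: if_splits)
  have mvb: "mv b y = mv v y" for y by (simp add: mv_def b_def cong: sum.cong)
  have "l2sq (conv a b) = (\<Sum>y\<in>Y. (cmod (conv a b y))\<^sup>2)"
  proof (rule l2sq_finite[OF Y])
    fix g assume g: "g \<in> Gam" "conv a b g \<noteq> 0"
    then have "(\<Sum>h\<in>Y. a h * b (ginv h ** g)) \<noteq> 0" using conv_finite[OF Y supp] by simp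
    then obtain h where "h \<in> Y" "b (ginv h ** g) \<noteq> 0" by (metis (no_types, lifting) mult_zero_right sum.neutral)
    then have "ginv h ** g \<in> H" by (auto simp: b_def split: if_splits)
    then show "g \<in> Y" using YH[OF \<open>h \<in> Y\<close>] by (metis YG \<open>h \<in> Y\<close> ginv_cancel(2))
  qed
  then show ?thesis using op[OF fb] by (simp add: lb conv_coset mvb cong: sum.cong)
qed

lemma Lp_fin_spectral:
  obtains L w where "finite L" "\<And>l. l \<in> L \<Longrightarrow> 0 \<le> l" "\<And>l. l \<in> L \<Longrightarrow> 0 \<le> w l"
    "\<And>p. Lp_fin p a = (\<Sum>l\<in>L. w l * l powr (p / 2)) powr (1 / p)"
    "(\<Sum>l\<in>L. w l * l) = l2sq a"
    "\<And>C l. (\<And>b. finsupp b \<Longrightarrow> l2sq (conv a b) \<le> C * l2sq b) \<Longrightarrow> l \<in> L \<Longrightarrow> l \<le> C"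
    "(cmod (\<Sum>y\<in>Y. a y))\<^sup>2 \<in> L" "1 / card H \<le> w ((cmod (\<Sum>y\<in>Y. a y))\<^sup>2)"
proof -
  obtain L w where L: "finite L" "\<And>l. l \<in> L \<Longrightarrow> 0 \<le> l" "\<And>l. l \<in> L \<Longrightarrow> 0 \<le> w l"
    "\<And>n. (T ^^ n) (\<lambda>g. if g = mat 1 then 1 else 0) (mat 1) = of_real (\<Sum>l\<in>L. w l * l ^ n)"
    "\<And>C l. (\<And>v. (\<Sum>y\<in>Y. (cmod (mv v y))\<^sup>2) \<le> C * (\<Sum>g\<in>H. (cmod (v g))\<^sup>2)) \<Longrightarrow> l \<in> L \<Longrightarrow> l \<le> C"
    "\<And>s. (\<And>y. y \<in> Y \<Longrightarrow> (\<Sum>g\<in>H. a (y ** ginv g)) = s) \<Longrightarrow> (\<And>g. g \<in> H \<Longrightarrow> (\<Sum>y\<in>Y. a (y ** ginv g)) = s) \<Longrightarrow>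
        (cmod s)\<^sup>2 \<in> L \<and> 1 / card H \<le> w ((cmod s)\<^sup>2)"
    by (rule spectral_weights[OF H'(3)]) blast
  have mom: "Re (gtrace (((conv (conv (adj a) a)) ^^ n) delta1)) = (\<Sum>l\<in>L. w l * l ^ n)" for n
    using conv_modulus_square_power[OF H'(3), of n] L(4)[of n] by (simp add: gtrace_def)
  \<comment> \<open>Every row and every column of the matrix lists the values of \<open>a\<close> on
    \<open>Y\<close> exactly once.\<close>
  have s: "(cmod (\<Sum>y\<in>Y. a y))\<^sup>2 \<in> L \<and> 1 / card H \<le> w ((cmod (\<Sum>y\<in>Y. a y))\<^sup>2)"
    by (rule L(6)) (rule sum.reindex_bij_betw[OF bij_H_Y] sum.reindex_bij_betw[OF bij_Y_Y], assumption)+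
  have "(\<Sum>l\<in>L. w l * l) = Re (T (\<lambda>g. if g = mat 1 then 1 else 0) (mat 1))"
    using L(4)[of 1] by simp
  also have "T (\<lambda>g. if g = mat 1 then 1 else 0) (mat 1) = (\<Sum>y\<in>Y. cnj (a (y ** ginv (mat 1))) * a (y ** ginv (mat 1)))"
    using H' by (simp add: T_def if_distrib cong: if_cong)
  also have "\<dots> = (\<Sum>y\<in>Y. of_real ((cmod (a y))\<^sup>2))"
    using ginv_unique[OF Gam_one, of "mat 1 :: 'k fls ^4^4"]
    by (simp add: complex_norm_square mult.commute flip: of_real_power)
  also have "Re \<dots> = l2sq a" using l2sq_finite[OF Y supp] by simp
  finally have l2: "(\<Sum>l\<in>L. w l * l) = l2sq a" .
  show thesis
  proof (rule that[OF L(1-3)])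
    show "Lp_fin p a = (\<Sum>l\<in>L. w l * l powr (p / 2)) powr (1 / p)" for p
      unfolding Lp_fin_def using spec_meas_integral[OF L(1-3) mom] by simp
    show "l \<le> C" if "\<And>b. finsupp b \<Longrightarrow> l2sq (conv a b) \<le> C * l2sq b" "l \<in> L" for C l
      using L(5)[OF conv_bound_coset that(2)] that(1) by blast
  qed (use l2 s in auto)
qed

text \<open>On the spectrum l <= C^2, hence l^(p/2) <= C^(p-2) l, and the first moment is the
  squared l2 norm.\<close>

lemma Lp_fin_upper:
  assumes op: "\<And>b. finsupp b \<Longrightarrow> l2sq (conv a b) \<le> C\<^sup>2 * l2sq b" and C: "C > 0" and p: "p > 2"
  shows "Lp_fin p a \<le> (C powr (p - 2) * l2sq a) powr (1 / p)"
proof -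
  obtain L w where L: "finite L" "\<And>l. l \<in> L \<Longrightarrow> 0 \<le> l" "\<And>l. l \<in> L \<Longrightarrow> 0 \<le> w l"
    "\<And>p. Lp_fin p a = (\<Sum>l\<in>L. w l * l powr (p / 2)) powr (1 / p)"
    "(\<Sum>l\<in>L. w l * l) = l2sq a"
    "\<And>C l. (\<And>b. finsupp b \<Longrightarrow> l2sq (conv a b) \<le> C * l2sq b) \<Longrightarrow> l \<in> L \<Longrightarrow> l \<le> C"
    by (rule Lp_fin_spectral) blast
  have "(\<Sum>l\<in>L. w l * l powr (p / 2)) \<le> (\<Sum>l\<in>L. w l * l * C powr (p - 2))"
  proof (rule sum_mono)
    fix l assume l: "l \<in> L"
    have "l powr (p / 2) = l * l powr (p / 2 - 1)"
      using L(2)[OF l] p by (cases "l = 0") (auto simp: powr_diff)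
    also have "\<dots> \<le> l * (C\<^sup>2) powr (p / 2 - 1)"
      using L(2)[OF l] L(6)[OF op l] p by (intro mult_left_mono powr_mono2) auto
    also have "(C\<^sup>2) powr (p / 2 - 1) = C powr (p - 2)"
      using C by (simp add: powr_powr flip: powr_numeral)
    finally show "w l * l powr (p / 2) \<le> w l * l * C powr (p - 2)"
      using mult_left_mono[OF _ L(3)[OF l]] by (simp add: mult.assoc)
  qed
  also have "\<dots> = C powr (p - 2) * l2sq a"
    by (simp add: L(5)[symmetric] sum_distrib_right[symmetric] mult.commute)
  finally show ?thesis unfolding L(4) using p L(2,3)
    by (intro powr_mono2) (auto intro!: sum_nonneg)
qed

text \<open>Only the atom of the trivial character is kept; its mass of at least 1/|H| produces the
  factor |H|^(1/p).\<close>

lemma Lp_fin_lower: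
  assumes p: "p > 0"
  shows "cmod (\<Sum>y\<in>Y. a y) \<le> card H powr (1 / p) * Lp_fin p a"
proof -
  define s where "s = cmod (\<Sum>y\<in>Y. a y)"
  obtain L w where L: "finite L" "\<And>l. l \<in> L \<Longrightarrow> 0 \<le> l" "\<And>l. l \<in> L \<Longrightarrow> 0 \<le> w l"
    "\<And>p. Lp_fin p a = (\<Sum>l\<in>L. w l * l powr (p / 2)) powr (1 / p)"
    "s\<^sup>2 \<in> L" "1 / card H \<le> w (s\<^sup>2)"
    unfolding s_def by (rule Lp_fin_spectral) blast
  have s0: "s \<ge> 0" by (simp add: s_def)
  have cH: "card H > 0" using H'(1,3) card_gt_0_iff by blast
  have sp: "(s\<^sup>2) powr (p / 2) = s powr p"
    using s0 p by (cases "s = 0") (simp_all add: powr_powr flip: powr_numeral)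
  have "1 / card H * s powr p \<le> w (s\<^sup>2) * (s\<^sup>2) powr (p / 2)"
    unfolding sp using L(6) by (intro mult_right_mono) auto
  also have "\<dots> \<le> (\<Sum>l\<in>L. w l * l powr (p / 2))"
    using L by (intro member_le_sum) auto
  finally have "s powr p \<le> card H * (\<Sum>l\<in>L. w l * l powr (p / 2))"
    using cH by (simp add: field_simps)
  then have "(s powr p) powr (1 / p) \<le> (card H * (\<Sum>l\<in>L. w l * l powr (p / 2))) powr (1 / p)"
    using p by (intro powr_mono2) auto
  then show ?thesis unfolding L(4) s_def[symmetric] using s0 p L(2,3)
    by (simp add: powr_powr powr_mult sum_nonneg)
qed

lemma opnorm_lower: "cmod (\<Sum>y\<in>Y. a y) \<le> opnorm a"
proof -
  note fa = conv_sum
  define M where "M = card Y * (\<Sum>i\<in>Y. (cmod (a i))\<^sup>2)"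
  have M0: "M \<ge> 0" by (simp add: M_def sum_nonneg)
  have bd: "l2sq (conv a b) \<le> M * l2sq b" if "finsupp b" for b
    unfolding fa M_def using that Y YG by (intro l2sq_translate_sum_le) auto
  \<comment> \<open>\<open>opnorm\<close> is a supremum of reals, so some upper bound must be known
    before the supremum dominates its elements.\<close>
  have bdd: "bdd_above {sqrt (l2sq (conv a b)) | b. finsupp b \<and> l2sq b \<le> 1}"
  proof (rule bdd_aboveI)
    fix x assume "x \<in> {sqrt (l2sq (conv a b)) | b. finsupp b \<and> l2sq b \<le> 1}"
    then obtain b where b: "x = sqrt (l2sq (conv a b))" "finsupp b" "l2sq b \<le> 1" by blast
    have "l2sq (conv a b) \<le> M" using bd[OF b(2)] mult_left_mono[OF b(3) M0] by simp
    then show "x \<le> sqrt M" using b by simp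
  qed
  \<comment> \<open>The test vector is the normalised indicator function of \<open>H\<close>, whose
    convolution with \<open>a\<close> is constant on \<open>Y\<close>.\<close>
  define r where "r = 1 / sqrt (card H)"
  define b where "b = (\<lambda>g. if g \<in> H then complex_of_real r else 0)"
  have cH: "card H > 0" using H'(1,3) card_gt_0_iff by blast
  have cY: "card Y = card H" using bij_betw_same_card[OF bij_H_Y[of g0]] H'(3) unfolding Y_def
    by (metis image_eqI matrix_mul_rid)
  have fb: "finsupp b" by (rule finsuppI[OF H'(1)]) (auto simp: b_def split: if_splits)
  have lb: "l2sq b = 1"
    using cH by (subst l2sq_finite[OF H'(1,2)]) (auto simp: b_def r_def norm_divide power_divide split: if_splits)
  have "mv b y = r * (\<Sum>y\<in>Y. a y)" if "y \<in> Y" for y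
    using sum.reindex_bij_betw[OF bij_H_Y[OF that], of a]
    by (simp add: mv_def b_def sum_distrib_right[symmetric])
  then have eq: "conv a b y = r * (\<Sum>y\<in>Y. a y)" if "y \<in> Y" for y using that conv_coset by simp
  have "(cmod (\<Sum>y\<in>Y. a y))\<^sup>2 = (\<Sum>y\<in>Y. (cmod (conv a b y))\<^sup>2)"
    using cH by (simp add: eq norm_mult norm_divide power_mult_distrib r_def power_divide cY cong: sum.cong)
  also have "\<dots> \<le> l2sq (conv a b)"
  proof -
    have "finsupp (conv a b)" unfolding fa using Y YG fb by (intro finsupp_translate_sum) auto
    then have "l2sq (conv a b) = (\<Sum>y\<in>Y \<union> {g\<in>Gam. conv a b g \<noteq> 0}. (cmod (conv a b y))\<^sup>2)"
      using Y by (intro l2sq_finite) (auto simp: finsupp_def)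
    then show ?thesis using Y \<open>finsupp (conv a b)\<close> by (auto simp: finsupp_def intro!: sum_mono2)
  qed
  finally have "cmod (\<Sum>y\<in>Y. a y) \<le> sqrt (l2sq (conv a b))" by (rule real_le_rsqrt)
  also have "\<dots> \<le> opnorm a" unfolding opnorm_def
    using fb lb by (intro cSup_upper bdd) auto
  finally show ?thesis .
qed

end

lemma opnorm_upper:
  assumes op: "\<And>b. finsupp b \<Longrightarrow> l2sq (conv a b) \<le> C\<^sup>2 * l2sq b" and C: "C > 0"
  shows "opnorm a \<le> C"
  unfolding opnorm_def
proof (rule cSup_least)
  show "{sqrt (l2sq (conv a b)) | b. finsupp b \<and> l2sq b \<le> 1} \<noteq> {}"
    by (auto intro!: exI[of _ "\<lambda>_. 0"] simp: finsupp_def l2sq_def)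
  fix x assume "x \<in> {sqrt (l2sq (conv a b)) | b. finsupp b \<and> l2sq b \<le> 1}"
  then obtain b where b: "x = sqrt (l2sq (conv a b))" "finsupp b" "l2sq b \<le> 1" by blast
  have "l2sq (conv a b) \<le> C\<^sup>2" using op[OF b(2)] mult_left_mono[OF b(3), of "C\<^sup>2"] by simp
  then show "x \<le> C" using b C by (simp add: real_le_lsqrt)
qed

lemma mult_norm_ge: "finsupp \<phi> \<Longrightarrow> Lp p \<phi> \<le> 1 \<Longrightarrow> ereal (Lp p (\<lambda>g. f g * \<phi> g)) \<le> mult_norm p f"
  unfolding mult_norm_def by (rule Sup_upper) auto

text \<open>For \<open>p < \<infinity>\<close> this is \<open>|H|\<^bsup>1/p\<^esup>\<close> times the interpolation bound for the \<open>L\<^sup>p\<close> norm of an element with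
  operator norm \<open>C\<close>, where \<open>Q\<close> is \<open>|H|\<close> times its squared \<open>\<ell>\<^sup>2\<close> norm.\<close>

definition sep_const :: "ereal \<Rightarrow> real \<Rightarrow> real \<Rightarrow> real" where
  "sep_const p C Q = (if p = \<infinity> then C else (C powr (real_of_ereal p - 2) * Q) powr (1 / real_of_ereal p))"

lemma multiplier_pairing_bound:
  fixes Q :: real
  assumes H: "fin_subgroup H" and g0: "g0 \<in> Gam" and Y: "Y = (\<lambda>h. g0 ** h) ` H"
    and supp: "\<And>g. g \<in> Gam \<Longrightarrow> \<phi> g \<noteq> 0 \<Longrightarrow> g \<in> Y"
    and op: "\<And>b. finsupp b \<Longrightarrow> l2sq (conv \<phi> b) \<le> C\<^sup>2 * l2sq b" and C: "C > 0"
    and Q: "l2sq \<phi> \<le> Q" "Q > 0" and p: "p > 2"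
  shows "ereal (cmod (\<Sum>y\<in>Y. f y * \<phi> y)) \<le> ereal (sep_const p C (card H * Q)) * mult_norm p f"
proof -
  define r where "r = real_of_ereal p"
  \<comment> \<open>\<open>B\<close> bounds the norm of \<open>\<phi>\<close>, so that
    \<open>\<psi>\<close>, which is \<open>\<phi>\<close> divided by \<open>B\<close>, is admissible
    in the supremum defining \<open>mult_norm\<close>.\<close>
  define B where "B = (if p = \<infinity> then C else (C powr (r - 2) * Q) powr (1 / r))"
  have B: "B > 0" using C Q by (auto simp: B_def)
  define \<psi> where "\<psi> = (\<lambda>g. of_real (1 / B) * \<phi> g)"
  interpret \<phi>: coset_support H g0 \<phi> Y by standard (use assms in auto)
  interpret \<psi>: coset_support H g0 \<psi> Y by standard (use assms in \<open>auto simp: \<psi>_def\<close>)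
  interpret f\<psi>: coset_support H g0 "\<lambda>g. f g * \<psi> g" Y by standard (use assms in \<open>auto simp: \<psi>_def\<close>)
  have conv\<psi>: "conv \<psi> b = (\<lambda>g. of_real (1 / B) * conv \<phi> b g)" for b
    unfolding fun_eq_iff \<phi>.conv_sum \<psi>.conv_sum by (simp add: \<psi>_def sum_divide_distrib)
  have l2scale: "l2sq (\<lambda>g. of_real (1 / B) * b g) = l2sq b / B\<^sup>2" for b
    using B by (simp add: l2sq_def norm_divide power_divide sum_divide_distrib)
  have op\<psi>: "l2sq (conv \<psi> b) \<le> (C / B)\<^sup>2 * l2sq b" if "finsupp b" for b
    unfolding conv\<psi> l2scale using op[OF that] B by (simp add: power_divide divide_right_mono)
  have fin: "finsupp \<psi>" by (rule finsuppI[OF \<psi>.Y(1) \<psi>.supp])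
  have CB: "C / B > 0" using C B by simp
  define s where "s = cmod (\<Sum>y\<in>Y. f y * \<phi> y)"
  have s\<psi>: "cmod (\<Sum>y\<in>Y. f y * \<psi> y) = s / B"
  proof -
    have "(\<Sum>y\<in>Y. f y * \<psi> y) = of_real (1 / B) * (\<Sum>y\<in>Y. f y * \<phi> y)"
      by (simp add: \<psi>_def sum_distrib_left mult_ac)
    then show ?thesis using B by (simp add: s_def norm_mult norm_divide)
  qed
  define m where "m = Lp p (\<lambda>g. f g * \<psi> g)"
  have cH: "card H > 0" using \<phi>.H'(1,3) card_gt_0_iff by blast
  have "Lp p \<psi> \<le> 1 \<and> s \<le> sep_const p C (card H * Q) * m"
  proof (cases "p = \<infinity>")
    case True
    have "Lp p \<psi> \<le> C / B" using True opnorm_upper[OF op\<psi> CB] by (simp add: Lp_def)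
    moreover have "s / B \<le> m" using f\<psi>.opnorm_lower True unfolding s\<psi> by (simp add: m_def Lp_def)
    ultimately show ?thesis using True B by (simp add: B_def sep_const_def field_simps)
  next
    case False
    then have r: "r > 2" using p unfolding r_def by (cases p) auto
    have Br: "B powr r = C powr (r - 2) * Q" using False r C Q by (simp add: B_def powr_powr)
    have "Lp p \<psi> \<le> ((C / B) powr (r - 2) * l2sq \<psi>) powr (1 / r)"
      using False \<psi>.Lp_fin_upper[OF op\<psi> CB r] by (simp add: Lp_def r_def)
    also have "\<dots> \<le> ((C / B) powr (r - 2) * (Q / B\<^sup>2)) powr (1 / r)"
      unfolding \<psi>_def l2scale using Q(1) r B l2sq_nonneg[of \<phi>]
      by (intro powr_mono2 mult_left_mono divide_right_mono) auto
    also have "(C / B) powr (r - 2) * (Q / B\<^sup>2) = C powr (r - 2) * Q / B powr r"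
    proof -
      have "B powr r = B powr (r - 2) * B\<^sup>2"
        using B by (simp flip: powr_add powr_numeral)
      then show ?thesis using B C by (simp add: powr_divide)
    qed
    also have "\<dots> = 1" using Br B C Q by simp
    finally have 1: "Lp p \<psi> \<le> 1" by simp
    have "s / B \<le> card H powr (1 / r) * m"
      using f\<psi>.Lp_fin_lower[of r] r False unfolding s\<psi> by (simp add: m_def Lp_def r_def)
    then have "s \<le> (card H powr (1 / r) * B) * m" using B by (simp add: field_simps)
    also have "card H powr (1 / r) * B = sep_const p C (card H * Q)"
      using False C Q cH by (simp add: B_def sep_const_def r_def powr_mult mult_ac)
    finally show ?thesis using 1 by simp
  qed
  then have *: "Lp p \<psi> \<le> 1" "s \<le> sep_const p C (card H * Q) * m" by auto
  have "sep_const p C (card H * Q) \<ge> 0" using C by (simp add: sep_const_def)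
  then have "ereal (sep_const p C (card H * Q)) * ereal m \<le> ereal (sep_const p C (card H * Q)) * mult_norm p f"
    unfolding m_def by (intro ereal_mult_left_mono mult_norm_ge fin *(1)) auto
  then show ?thesis using *(2) unfolding s_def[symmetric] by (simp add: order.trans[rotated])
qed

section \<open>Separating the values of a multiplier\<close>

lemma translate_correlation_le:
  assumes g: "g \<in> Gam" "h \<in> Gam" and c: "finsupp c" and S: "finite S" "S \<subseteq> Gam"
    "\<And>x. x \<in> Gam \<Longrightarrow> c (ginv g ** x) \<noteq> 0 \<Longrightarrow> x \<in> S" "\<And>x. x \<in> Gam \<Longrightarrow> c (ginv h ** x) \<noteq> 0 \<Longrightarrow> x \<in> S"
  shows "cmod (\<Sum>x\<in>S. c (ginv g ** x) * cnj (c (ginv h ** x))) \<le> l2sq c"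
proof -
  have 1: "(\<Sum>x\<in>S. (cmod (c (ginv g ** x)))\<^sup>2) = l2sq c"
    unfolding l2sq_translate[OF g(1) c, symmetric] by (rule l2sq_finite[OF S(1,2,3), symmetric])
  have 2: "(\<Sum>x\<in>S. (cmod (c (ginv h ** x)))\<^sup>2) = l2sq c"
    unfolding l2sq_translate[OF g(2) c, symmetric] by (rule l2sq_finite[OF S(1,2,4), symmetric])
  have "cmod (\<Sum>x\<in>S. c (ginv g ** x) * cnj (c (ginv h ** x)))
     \<le> (\<Sum>x\<in>S. ((cmod (c (ginv g ** x)))\<^sup>2 + (cmod (c (ginv h ** x)))\<^sup>2) / 2)"
  proof (rule order.trans[OF norm_sum], rule sum_mono)
    fix x
    show "cmod (c (ginv g ** x) * cnj (c (ginv h ** x))) \<le> ((cmod (c (ginv g ** x)))\<^sup>2 + (cmod (c (ginv h ** x)))\<^sup>2) / 2"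
      using sum_squares_bound[of "cmod (c (ginv g ** x))" "cmod (c (ginv h ** x))"] by (simp add: norm_mult)
  qed
  also have "\<dots> = l2sq c" by (simp add: sum_divide_distrib[symmetric] sum.distrib 1 2)
  finally show ?thesis .
qed

lemma l2sq_scale: "l2sq (\<lambda>x. of_real r * u x) = r\<^sup>2 * l2sq u"
  by (cases "r = 0") (simp_all add: l2sq_def norm_mult power_mult_distrib sum_distrib_left)

definition add_subgroup :: "'s::ab_group_add set \<Rightarrow> bool" where
  "add_subgroup S \<longleftrightarrow> finite S \<and> 0 \<in> S \<and> (\<forall>x\<in>S. \<forall>y\<in>S. x + y \<in> S \<and> x - y \<in> S)"

lemma add_subgroup_shift: "add_subgroup S \<Longrightarrow> s \<in> S \<Longrightarrow> bij_betw (\<lambda>x. x + s) S S"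
  by (rule bij_betw_byWitness[of _ "\<lambda>x. x - s"]) (auto simp: add_subgroup_def)

text \<open>The \<open>T\<^sup>*T\<close> argument: expanding the square, only differences \<open>d \<in> D\<close> survive.\<close>

lemma l2sq_translate_sum_cancel:
  fixes S :: "'s::ab_group_add set"
  assumes S: "add_subgroup S" and \<sigma>: "\<And>s. s \<in> S \<Longrightarrow> \<sigma> s \<in> Gam" and c: "finsupp c" and D: "D \<subseteq> S"
    and good: "\<And>d x. d \<in> S - D \<Longrightarrow> x \<in> Gam \<Longrightarrow> (\<Sum>s\<in>S. c (ginv (ginv (\<sigma> s) ** \<sigma> (s + d)) ** x)) = 0"
  shows "l2sq (\<lambda>x. \<Sum>s\<in>S. c (ginv (\<sigma> s) ** x)) \<le> real (card S) * real (card D) * l2sq c"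
proof -
  have Sf: "finite S" and Sadd: "\<And>s d. s \<in> S \<Longrightarrow> d \<in> S \<Longrightarrow> s + d \<in> S" using S by (auto simp: add_subgroup_def)
  define \<Omega> where "\<Omega> = (\<Union>s\<in>S. (\<lambda>h. \<sigma> s ** h) ` {h \<in> Gam. c h \<noteq> 0})"
  have O: "finite \<Omega>" "\<Omega> \<subseteq> Gam" using Sf \<sigma> c translate_support(1,2) by (auto simp: \<Omega>_def intro!: Gam_mult)
  have iO: "h \<in> \<Omega>" if "s \<in> S" "h \<in> Gam" "c (ginv (\<sigma> s) ** h) \<noteq> 0" for s h
    using translate_support(3)[OF \<sigma>[OF that(1)] c that(2,3)] that(1) by (auto simp: \<Omega>_def)
  define A where "A = (\<lambda>s t. \<Sum>x\<in>\<Omega>. c (ginv (\<sigma> s) ** x) * cnj (c (ginv (\<sigma> t) ** x)))"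
  have Ale: "cmod (A s t) \<le> l2sq c" if "s \<in> S" "t \<in> S" for s t
    unfolding A_def using that O c iO \<sigma> by (intro translate_correlation_le) auto
  \<comment> \<open>By translation invariance a correlation depends only on the quotient of the two
    group elements, the quantity that \<open>good\<close> controls.\<close>
  have A2: "A s t = (\<Sum>h | h \<in> Gam \<and> c h \<noteq> 0. c h * cnj (c (ginv (ginv (\<sigma> s) ** \<sigma> t) ** h)))"
    if "s \<in> S" "t \<in> S" for s t
  proof -
    let ?G = "{h \<in> Gam. c h \<noteq> 0}"
    have inj: "inj_on (\<lambda>h. \<sigma> s ** h) ?G"
      by (rule inj_on_inverseI[of _ "\<lambda>h. ginv (\<sigma> s) ** h"]) (use \<sigma> that in \<open>simp add: ginv_cancel\<close>)
    have "A s t = (\<Sum>x\<in>(\<lambda>h. \<sigma> s ** h) ` ?G. c (ginv (\<sigma> s) ** x) * cnj (c (ginv (\<sigma> t) ** x)))"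
      unfolding A_def
    proof (rule sum.mono_neutral_right)
      show "(\<lambda>h. \<sigma> s ** h) ` ?G \<subseteq> \<Omega>" using that by (auto simp: \<Omega>_def)
      show "\<forall>x\<in>\<Omega> - (\<lambda>h. \<sigma> s ** h) ` ?G. c (ginv (\<sigma> s) ** x) * cnj (c (ginv (\<sigma> t) ** x)) = 0"
        using translate_support(3)[OF \<sigma>[OF that(1)] c] O(2) by auto
    qed (use O in auto)
    also have "\<dots> = (\<Sum>h\<in>?G. c h * cnj (c (ginv (\<sigma> t) ** (\<sigma> s ** h))))"
      using \<sigma> that by (simp add: sum.reindex[OF inj] ginv_cancel)
    also have "\<dots> = (\<Sum>h\<in>?G. c h * cnj (c (ginv (ginv (\<sigma> s) ** \<sigma> t) ** h)))"
      using \<sigma> that by (simp add: ginv_mult ginv_ginv Gam_ginv matrix_mul_assoc)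
    finally show ?thesis .
  qed
  have "of_real (l2sq (\<lambda>x. \<Sum>s\<in>S. c (ginv (\<sigma> s) ** x))) = (\<Sum>s\<in>S. \<Sum>t\<in>S. A s t)"
  proof -
    have "l2sq (\<lambda>x. \<Sum>s\<in>S. c (ginv (\<sigma> s) ** x)) = (\<Sum>x\<in>\<Omega>. (cmod (\<Sum>s\<in>S. c (ginv (\<sigma> s) ** x)))\<^sup>2)"
      by (rule l2sq_finite[OF O]) (metis (no_types, lifting) iO sum.neutral)
    then have "of_real (l2sq (\<lambda>x. \<Sum>s\<in>S. c (ginv (\<sigma> s) ** x)))
        = (\<Sum>x\<in>\<Omega>. \<Sum>s\<in>S. \<Sum>t\<in>S. c (ginv (\<sigma> s) ** x) * cnj (c (ginv (\<sigma> t) ** x)))"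
      by (simp only: of_real_sum complex_norm_square cnj_sum sum_product)
    also have "\<dots> = (\<Sum>s\<in>S. \<Sum>x\<in>\<Omega>. \<Sum>t\<in>S. c (ginv (\<sigma> s) ** x) * cnj (c (ginv (\<sigma> t) ** x)))"
      by (rule sum.swap)
    also have "\<dots> = (\<Sum>s\<in>S. \<Sum>t\<in>S. A s t)"
      unfolding A_def by (intro sum.cong refl sum.swap)
    finally show ?thesis .
  qed
  also have "\<dots> = (\<Sum>s\<in>S. \<Sum>d\<in>S. A s (s + d))"
  proof (rule sum.cong[OF refl])
    fix s assume "s \<in> S"
    from sum.reindex_bij_betw[OF add_subgroup_shift[OF S this], of "A s"]
    show "(\<Sum>t\<in>S. A s t) = (\<Sum>d\<in>S. A s (s + d))" by (simp add: add.commute)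
  qed
  also have "\<dots> = (\<Sum>d\<in>S. \<Sum>s\<in>S. A s (s + d))" by (rule sum.swap)
  also have "\<dots> = (\<Sum>d\<in>D. \<Sum>s\<in>S. A s (s + d))"
  proof (rule sum.mono_neutral_right[OF Sf D], rule ballI)
    fix d assume d: "d \<in> S - D"
    have "(\<Sum>s\<in>S. A s (s + d)) = (\<Sum>s\<in>S. \<Sum>h | h \<in> Gam \<and> c h \<noteq> 0. c h * cnj (c (ginv (ginv (\<sigma> s) ** \<sigma> (s + d)) ** h)))"
      using d by (intro sum.cong refl A2 Sadd) auto
    also have "\<dots> = (\<Sum>h | h \<in> Gam \<and> c h \<noteq> 0. c h * cnj (\<Sum>s\<in>S. c (ginv (ginv (\<sigma> s) ** \<sigma> (s + d)) ** h)))"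
      by (subst sum.swap) (simp add: sum_distrib_left)
    also have "\<dots> = 0" using good[OF d] by (intro sum.neutral) auto
    finally show "(\<Sum>s\<in>S. A s (s + d)) = 0" .
  qed
  finally have eq: "of_real (l2sq (\<lambda>x. \<Sum>s\<in>S. c (ginv (\<sigma> s) ** x))) = (\<Sum>d\<in>D. \<Sum>s\<in>S. A s (s + d))" .
  have "l2sq (\<lambda>x. \<Sum>s\<in>S. c (ginv (\<sigma> s) ** x)) = cmod (\<Sum>d\<in>D. \<Sum>s\<in>S. A s (s + d))"
    unfolding eq[symmetric] by (simp add: l2sq_nonneg)
  also have "\<dots> \<le> (\<Sum>d\<in>D. \<Sum>s\<in>S. l2sq c)"
    using D by (intro order.trans[OF norm_sum] sum_mono) (auto intro!: Ale Sadd)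
  also have "\<dots> = real (card S) * real (card D) * l2sq c" by simp
  finally show ?thesis .
qed

lemma point_masses:
  fixes a :: "'i \<Rightarrow> complex"
  assumes I: "finite I" "inj_on P I" "P ` I \<subseteq> Gam"
    and \<phi>_def: "\<phi> = (\<lambda>g. \<Sum>i\<in>I. if g = P i then a i else (0::complex))"
  shows "\<And>i. i \<in> I \<Longrightarrow> \<phi> (P i) = a i" "\<And>g. \<phi> g \<noteq> 0 \<Longrightarrow> g \<in> P ` I"
    "conv \<phi> b x = (\<Sum>i\<in>I. a i * b (ginv (P i) ** x))"
    "l2sq \<phi> = (\<Sum>i\<in>I. (cmod (a i))\<^sup>2)"
    "finite Y \<Longrightarrow> P ` I \<subseteq> Y \<Longrightarrow> (\<Sum>y\<in>Y. f y * \<phi> y) = (\<Sum>i\<in>I. f (P i) * a i)"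
proof -
  show 1: "\<phi> (P i) = a i" if "i \<in> I" for i
  proof -
    have "\<phi> (P i) = (\<Sum>j\<in>I. if j = i then a j else 0)"
      unfolding \<phi>_def using I(2) that by (intro sum.cong) (auto dest: inj_onD)
    then show ?thesis using I(1) that by simp
  qed
  show 2: "g \<in> P ` I" if "\<phi> g \<noteq> 0" for g
  proof (rule ccontr)
    assume "g \<notin> P ` I"
    then have "\<phi> g = 0" unfolding \<phi>_def by (intro sum.neutral) auto
    with that show False by simp
  qed
  have fin: "finite (P ` I)" "P ` I \<subseteq> Gam" using I by auto
  show "conv \<phi> b x = (\<Sum>i\<in>I. a i * b (ginv (P i) ** x))"
  proof -
    have "conv \<phi> b x = (\<Sum>h\<in>P ` I. \<phi> h * b (ginv h ** x))" by (rule conv_finite[OF fin]) (rule 2)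
    then show ?thesis by (simp add: sum.reindex[OF I(2)] 1)
  qed
  show "l2sq \<phi> = (\<Sum>i\<in>I. (cmod (a i))\<^sup>2)"
  proof -
    have "l2sq \<phi> = (\<Sum>h\<in>P ` I. (cmod (\<phi> h))\<^sup>2)" by (rule l2sq_finite[OF fin]) (rule 2)
    then show ?thesis by (simp add: sum.reindex[OF I(2)] 1)
  qed
  show "(\<Sum>y\<in>Y. f y * \<phi> y) = (\<Sum>i\<in>I. f (P i) * a i)" if "finite Y" "P ` I \<subseteq> Y"
  proof -
    have "(\<Sum>y\<in>Y. f y * \<phi> y) = (\<Sum>y\<in>P ` I. f y * \<phi> y)"
      using that 2 by (intro sum.mono_neutral_right) auto
    then show ?thesis by (simp add: sum.reindex[OF I(2)] 1)
  qed
qed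

text \<open>Shifting \<open>s\<close> by \<open>s0\<close> moves \<open>L s\<close> by
  \<open>L s0\<close>, which is z1 - z2 up to an element of \<open>W\<close>; the average over
  \<open>W\<close> absorbs that element.\<close>

lemma shifted_sums_eq:
  fixes S :: "'s::ab_group_add set" and W :: "'z::ab_group_add set"
  assumes S: "add_subgroup S" and W: "add_subgroup W"
    and s0: "s0 \<in> S" "\<And>s. s \<in> S \<Longrightarrow> L (s + s0) = L s + L s0" "L s0 + z2 - z1 \<in> W"
  shows "(\<Sum>s\<in>S. \<Sum>w\<in>W. q (L s + (z2 + w))) = (\<Sum>s\<in>S. \<Sum>w\<in>W. q (L s + (z1 + w)) :: complex)"
proof -
  have "(\<Sum>s\<in>S. \<Sum>w\<in>W. q (L s + (z2 + w))) = (\<Sum>s\<in>S. \<Sum>w\<in>W. q (L (s + s0) + (z2 + w)))"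
    by (rule sum.reindex_bij_betw[OF add_subgroup_shift[OF S s0(1)], symmetric])
  also have "\<dots> = (\<Sum>s\<in>S. \<Sum>w\<in>W. q (L s + (z1 + (w + (L s0 + z2 - z1)))))"
    by (rule sum.cong[OF refl], rule sum.cong[OF refl], rule arg_cong[of _ _ q]) (simp add: s0(2))
  also have "\<dots> = (\<Sum>s\<in>S. \<Sum>w\<in>W. q (L s + (z1 + w)))"
  proof (rule sum.cong[OF refl])
    fix s
    show "(\<Sum>w\<in>W. q (L s + (z1 + (w + (L s0 + z2 - z1))))) = (\<Sum>w\<in>W. q (L s + (z1 + w)))"
      using sum.reindex_bij_betw[OF add_subgroup_shift[OF W s0(3)], of "\<lambda>w. q (L s + (z1 + w))"] .
  qed
  finally show ?thesis .
qed

text \<open>The common frame of both moves. The test element is the difference of the uniform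
  measures on the points \<sigma>(s) \<zeta>(z1 + w) and on the points \<sigma>(s) \<zeta>(z2 + w).
  Condition \<open>good\<close> says that for a difference \<open>d\<close> outside \<open>D\<close>
  the parameter \<open>L s\<close> sweeps through the direction z1 - z2 modulo \<open>W\<close>, so
  the two measures cancel after summation over \<open>s\<close>. Only |D| of the |S| differences
  contribute, whence the operator norm bound 2 sqrt(|D| / |S|).\<close>

lemma multiplier_difference_bound:
  fixes S :: "'s::ab_group_add set" and W Z :: "'z::ab_group_add set"
    and \<sigma> :: "'s \<Rightarrow> 'k::field fls ^4^4" and \<zeta> :: "'z \<Rightarrow> 'k fls ^4^4"
  assumes H: "fin_subgroup H" and g0: "g0 \<in> Gam" and Y: "Y = (\<lambda>h. g0 ** h) ` H"
    and S: "add_subgroup S" and W: "add_subgroup W" and Z: "add_subgroup Z" "W \<subseteq> Z" "z1 \<in> Z" "z2 \<in> Z"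
    and \<sigma>: "\<And>s. s \<in> S \<Longrightarrow> \<sigma> s \<in> Gam" and \<zeta>: "\<And>z. z \<in> Z \<Longrightarrow> \<zeta> z \<in> Gam"
    and hom: "\<And>x y. x \<in> Z \<Longrightarrow> y \<in> Z \<Longrightarrow> \<zeta> (x + y) = \<zeta> x ** \<zeta> y"
    and mem: "\<And>s z. s \<in> S \<Longrightarrow> z \<in> Z \<Longrightarrow> \<sigma> s ** \<zeta> z \<in> Y"
    and inj: "\<And>s z s' z'. s \<in> S \<Longrightarrow> z \<in> Z \<Longrightarrow> s' \<in> S \<Longrightarrow> z' \<in> Z \<Longrightarrow> \<sigma> s ** \<zeta> z = \<sigma> s' ** \<zeta> z' \<Longrightarrow> s = s' \<and> z = z'"
    and z12: "z1 - z2 \<notin> W"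
    and D: "D \<subseteq> S" "D \<noteq> {}"
    and good: "\<And>d. d \<in> S - D \<Longrightarrow> \<exists>g\<in>Gam. \<exists>L. \<exists>s0\<in>S. L s0 + z2 - z1 \<in> W \<and>
        (\<forall>s\<in>S. L s \<in> Z \<and> L (s + s0) = L s + L s0 \<and> ginv (\<sigma> s) ** \<sigma> (s + d) = g ** \<zeta> (L s))"
    and f1: "\<And>s w. s \<in> S \<Longrightarrow> w \<in> W \<Longrightarrow> f (\<sigma> s ** \<zeta> (z1 + w)) = F1"
    and f2: "\<And>s w. s \<in> S \<Longrightarrow> w \<in> W \<Longrightarrow> f (\<sigma> s ** \<zeta> (z2 + w)) = F2"
    and p: "p > 2"
  shows "ereal (cmod (F1 - F2)) \<le>
    ereal (sep_const p (2 * sqrt (card D / card S)) (card H * (2 / (card S * card W)))) * mult_norm p f"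
proof -
  have Sf: "finite S" "S \<noteq> {}" and Wf: "finite W" "W \<noteq> {}" using S W by (auto simp: add_subgroup_def)
  have Zadd: "x + y \<in> Z" if "x \<in> Z" "y \<in> Z" for x y using Z(1) that by (auto simp: add_subgroup_def)
  have cS: "card S > 0" and cW: "card W > 0" and cD: "card D > 0"
    using Sf Wf D finite_subset[OF D(1)] by (auto simp: card_gt_0_iff)
  define I where "I = S \<times> W \<times> (UNIV :: bool set)"
  define zz where "zz = (\<lambda>e. if e then z1 else z2)"
  define P where "P = (\<lambda>(s, w, e). \<sigma> s ** \<zeta> (zz e + w))"
  define \<alpha> where "\<alpha> = 1 / (real (card S) * real (card W))"
  define a where "a = (\<lambda>(s::'s, w::'z, e). if e then complex_of_real \<alpha> else - complex_of_real \<alpha>)"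
  define \<phi> where "\<phi> = (\<lambda>g. \<Sum>i\<in>I. if g = P i then a i else 0)"
  have zzZ: "zz e + w \<in> Z" if "w \<in> W" for e w using that Z by (auto simp: zz_def intro!: Zadd)
  have If: "finite I" using Sf Wf by (simp add: I_def)
  have cI: "card I = card S * card W * 2" by (simp add: I_def card_cartesian_product mult_ac)
  have injP: "inj_on P I"
  proof (rule inj_onI)
    fix i j assume ij: "i \<in> I" "j \<in> I" "P i = P j"
    obtain s w e s' w' e' where i: "i = (s, w, e)" and j: "j = (s', w', e')" by (metis prod_cases3)
    have m: "s \<in> S" "w \<in> W" "s' \<in> S" "w' \<in> W" using ij by (auto simp: I_def i j)
    have "s = s' \<and> zz e + w = zz e' + w'"
      using ij(3) m by (intro inj zzZ) (auto simp: P_def i j)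
    moreover have "w - w' \<in> W" "w' - w \<in> W" using m W by (auto simp: add_subgroup_def)
    moreover have "z1 - z2 = x' - x" if "z1 + x = z2 + x'" for x x' using that by (simp add: algebra_simps)
    ultimately have "e = e'" using z12 unfolding zz_def by metis
    then show "i = j" using \<open>s = s' \<and> zz e + w = zz e' + w'\<close> by (simp add: i j)
  qed
  have PG: "P ` I \<subseteq> Gam"
    by (auto simp: I_def P_def intro!: Gam_mult \<sigma> \<zeta> zzZ)
  have PY: "P ` I \<subseteq> Y" by (auto simp: I_def P_def intro!: mem zzZ)
  note pm = point_masses[OF If injP PG \<phi>_def]
  have Yf: "finite Y" using H by (simp add: Y fin_subgroup_def)
  define C where "C = 2 * sqrt (card D / card S)"
  have C: "C > 0" using cS cD by (simp add: C_def)
  have op: "l2sq (conv \<phi> b) \<le> C\<^sup>2 * l2sq b" if b: "finsupp b" for b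
  proof -
    define J where "J = W \<times> (UNIV :: bool set)"
    define \<epsilon> where "\<epsilon> = (\<lambda>(w::'z, e). if e then 1 else (-1::complex))"
    \<comment> \<open>Convolution by \<open>\<phi>\<close> is split into an inner sum over
      \<open>W\<close> and the sign, bounded trivially by (2 |W|)^2, and an outer sum over
      \<open>S\<close>, which carries all the cancellation.\<close>
    define c where "c = (\<lambda>x. \<Sum>j\<in>J. \<epsilon> j * b (ginv (\<zeta> (zz (snd j) + fst j)) ** x))"
    have Jf: "finite J" and cJ: "card J = 2 * card W" using Wf by (auto simp: J_def card_cartesian_product)
    have \<zeta>J: "\<zeta> (zz (snd j) + fst j) \<in> Gam" if "j \<in> J" for j using that by (auto simp: J_def intro!: \<zeta> zzZ)
    have fc: "finsupp c" unfolding c_def by (rule finsupp_translate_sum[OF Jf \<zeta>J b])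
    have "l2sq c \<le> card J * (\<Sum>j\<in>J. (cmod (\<epsilon> j))\<^sup>2) * l2sq b"
      unfolding c_def by (rule l2sq_translate_sum_le[OF Jf \<zeta>J b])
    also have "(\<Sum>j\<in>J. (cmod (\<epsilon> j))\<^sup>2) = card J"
      by (simp add: \<epsilon>_def case_prod_beta if_distrib cong: if_cong)
    finally have lc: "l2sq c \<le> (2 * real (card W))\<^sup>2 * l2sq b" by (simp add: cJ power2_eq_square)
    have conv\<phi>: "conv \<phi> b = (\<lambda>x. of_real \<alpha> * (\<Sum>s\<in>S. c (ginv (\<sigma> s) ** x)))"
    proof
      fix x
      have "conv \<phi> b x = (\<Sum>s\<in>S. \<Sum>j\<in>J. a (s, j) * b (ginv (P (s, j)) ** x))"
        unfolding pm(3) by (simp add: I_def J_def sum.cartesian_product)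
      also have "\<dots> = (\<Sum>s\<in>S. \<Sum>j\<in>J. of_real \<alpha> * (\<epsilon> j * b (ginv (\<zeta> (zz (snd j) + fst j)) ** (ginv (\<sigma> s) ** x))))"
      proof (intro sum.cong refl)
        fix s j assume sj: "s \<in> S" "j \<in> J"
        have "a (s, j) = of_real \<alpha> * \<epsilon> j" by (simp add: a_def \<epsilon>_def case_prod_beta)
        moreover have "ginv (P (s, j)) ** x = ginv (\<zeta> (zz (snd j) + fst j)) ** (ginv (\<sigma> s) ** x)"
          using \<sigma>[OF sj(1)] \<zeta>J[OF sj(2)] by (simp add: P_def case_prod_beta ginv_mult matrix_mul_assoc)
        ultimately show "a (s, j) * b (ginv (P (s, j)) ** x)
            = of_real \<alpha> * (\<epsilon> j * b (ginv (\<zeta> (zz (snd j) + fst j)) ** (ginv (\<sigma> s) ** x)))" by simp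
      qed
      finally show "conv \<phi> b x = of_real \<alpha> * (\<Sum>s\<in>S. c (ginv (\<sigma> s) ** x))"
        by (simp add: c_def sum_distrib_left)
    qed
    have cexp: "c x = (\<Sum>w\<in>W. b (ginv (\<zeta> (z1 + w)) ** x)) - (\<Sum>w\<in>W. b (ginv (\<zeta> (z2 + w)) ** x))" for x
    proof -
      have "c x = (\<Sum>w\<in>W. \<Sum>e\<in>UNIV. \<epsilon> (w, e) * b (ginv (\<zeta> (zz e + w)) ** x))"
        unfolding c_def J_def sum.cartesian_product by (simp add: case_prod_beta)
      then show ?thesis by (simp add: UNIV_bool \<epsilon>_def zz_def sum_subtractf)
    qed
    have "l2sq (\<lambda>x. \<Sum>s\<in>S. c (ginv (\<sigma> s) ** x)) \<le> real (card S) * real (card D) * l2sq c"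
    proof (rule l2sq_translate_sum_cancel[OF S \<sigma> fc D(1)])
      fix d x assume d: "d \<in> S - D" and x: "x \<in> (Gam :: ('k fls ^4^4) set)"
      from good[OF d] obtain g L s0 where g: "g \<in> Gam" "s0 \<in> S" "L s0 + z2 - z1 \<in> W"
        "\<And>s. s \<in> S \<Longrightarrow> L s \<in> Z" "\<And>s. s \<in> S \<Longrightarrow> L (s + s0) = L s + L s0"
        "\<And>s. s \<in> S \<Longrightarrow> ginv (\<sigma> s) ** \<sigma> (s + d) = g ** \<zeta> (L s)" by blast
      define q where "q = (\<lambda>z. b (ginv (\<zeta> z) ** (ginv g ** x)))"
      have qq: "b (ginv (\<zeta> z) ** (ginv (g ** \<zeta> (L s)) ** x)) = q (L s + z)" if "s \<in> S" "z \<in> Z" for s z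
        using that g by (simp add: q_def hom ginv_mult \<zeta> matrix_mul_assoc)
      have z1w: "z1 + w \<in> Z" "z2 + w \<in> Z" if "w \<in> W" for w using zzZ[OF that, of True] zzZ[OF that, of False] by (auto simp: zz_def)
      have "(\<Sum>s\<in>S. c (ginv (ginv (\<sigma> s) ** \<sigma> (s + d)) ** x)) = (\<Sum>s\<in>S. c (ginv (g ** \<zeta> (L s)) ** x))"
        by (simp add: g(6))
      also have "\<dots> = (\<Sum>s\<in>S. \<Sum>w\<in>W. q (L s + (z1 + w))) - (\<Sum>s\<in>S. \<Sum>w\<in>W. q (L s + (z2 + w)))"
        unfolding cexp by (simp add: sum_subtractf qq z1w cong: sum.cong)
      also have "\<dots> = 0" using shifted_sums_eq[OF S W g(2) g(5) g(3), of q] by simp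
      finally show "(\<Sum>s\<in>S. c (ginv (ginv (\<sigma> s) ** \<sigma> (s + d)) ** x)) = 0" .
    qed
    also have "\<dots> \<le> real (card S) * real (card D) * ((2 * real (card W))\<^sup>2 * l2sq b)" using lc by (intro mult_left_mono) auto
    finally have 3: "l2sq (\<lambda>x. \<Sum>s\<in>S. c (ginv (\<sigma> s) ** x)) \<le> real (card S) * real (card D) * ((2 * real (card W))\<^sup>2 * l2sq b)" .
    have "l2sq (conv \<phi> b) = \<alpha>\<^sup>2 * l2sq (\<lambda>x. \<Sum>s\<in>S. c (ginv (\<sigma> s) ** x))"
      unfolding conv\<phi> by (rule l2sq_scale)
    also have "\<dots> \<le> \<alpha>\<^sup>2 * (real (card S) * real (card D) * ((2 * real (card W))\<^sup>2 * l2sq b))"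
      using 3 by (intro mult_left_mono) auto
    \<comment> \<open>The size of \<open>W\<close> cancels: \<alpha>^2 |S| |D| (2 |W|)^2 = 4 |D| /
      |S|.\<close>
    also have "\<dots> = C\<^sup>2 * l2sq b"
      using cS cW by (simp add: \<alpha>_def C_def power_mult_distrib power_divide real_sqrt_pow2 divide_simps power2_eq_square)
    finally show ?thesis .
  qed
  have l2: "l2sq \<phi> \<le> 2 / (card S * card W)"
  proof -
    have "l2sq \<phi> = (\<Sum>i\<in>I. \<alpha>\<^sup>2)" unfolding pm(4)
      by (intro sum.cong) (auto simp: a_def)
    also have "\<dots> = 2 / (card S * card W)" using cS cW
      by (simp add: cI \<alpha>_def power2_eq_square)
    finally show ?thesis by simp
  qed
  have "(\<Sum>y\<in>Y. f y * \<phi> y) = (\<Sum>i\<in>I. f (P i) * a i)" by (rule pm(5)[OF Yf PY])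
  also have "\<dots> = (\<Sum>s\<in>S. \<Sum>w\<in>W. \<Sum>e\<in>UNIV. f (P (s, w, e)) * a (s, w, e))"
    by (simp add: I_def sum.cartesian_product)
  also have "\<dots> = (\<Sum>s\<in>S. \<Sum>w\<in>W. of_real \<alpha> * (F1 - F2))"
    by (intro sum.cong refl) (simp add: UNIV_bool P_def a_def zz_def f1 f2, simp add: algebra_simps)
  also have "\<dots> = F1 - F2" using cS cW by (simp add: \<alpha>_def)
  finally have eq: "(\<Sum>y\<in>Y. f y * \<phi> y) = F1 - F2" .
  have "ereal (cmod (\<Sum>y\<in>Y. f y * \<phi> y)) \<le> ereal (sep_const p C (card H * (2 / (card S * card W)))) * mult_norm p f"
    using pm(2) PY cS cW by (intro multiplier_pairing_bound[OF H g0 Y _ op C l2 _ p]) auto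
  then show ?thesis unfolding eq C_def .
qed

text \<open>Testing on a single group element, which acts as a unitary. Besides the boundedness of
  \<open>f\<close> this gives the nonnegativity of \<open>mult_norm\<close>.\<close>

lemma multiplier_value_bound:
  fixes g :: "'k::field fls ^4^4"
  assumes g: "g \<in> Gam" and p: "p > 2"
  shows "ereal (cmod (f g)) \<le> mult_norm p f"
proof -
  define \<phi> where "\<phi> = (\<lambda>h. \<Sum>i\<in>{g}. if h = i then 1 else (0::complex))"
  have g': "finite {g}" "inj_on (\<lambda>i. i) {g}" "(\<lambda>i. i) ` {g} \<subseteq> Gam" using g by auto
  note pm = point_masses[OF g' \<phi>_def]
  have H: "fin_subgroup {mat 1 :: 'k fls ^4^4}"
    using ginv_unique[OF Gam_one, of "mat 1 :: 'k fls ^4^4"] by (auto simp: fin_subgroup_def Gam_one)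
  have "ereal (cmod (\<Sum>y\<in>{g}. f y * \<phi> y)) \<le> ereal (sep_const p 1 (real (card {mat 1 :: 'k fls ^4^4}) * 1)) * mult_norm p f"
  proof (rule multiplier_pairing_bound[OF H g _ _ _ _ _ _ p])
    show "l2sq (conv \<phi> b) \<le> 1\<^sup>2 * l2sq b" if "finsupp b" for b
    proof -
      have "conv \<phi> b = (\<lambda>x. b (ginv g ** x))" using pm(3)[of b] g by (intro ext) simp
      then show ?thesis using l2sq_translate[OF g that] by simp
    qed
    show "{g} = (\<lambda>h. g ** h) ` {mat 1}" by simp
    show "h \<in> {g}" if "\<phi> h \<noteq> 0" for h using pm(2)[OF that] by simp
    show "l2sq \<phi> \<le> 1" using pm(4) by simp
  qed simp_all
  moreover have "sep_const p 1 (real (card {mat 1 :: 'k fls ^4^4}) * 1) = 1" by (simp add: sep_const_def)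
  moreover have "(\<Sum>y\<in>{g}. f y * \<phi> y) = f g" using pm(1)[of g] by simp
  ultimately show ?thesis by (metis mult_1 one_ereal_def)
qed

section \<open>Degrees and double cosets\<close>

text \<open>All degrees are degrees in \<open>\<pi>\<^sup>-\<^sup>1\<close>: \<open>dg n\<close> is \<open>\<pi>\<^bsup>-n\<^esup>\<O>\<close>, \<open>tt n\<close> is \<open>\<pi>\<^bsup>-n\<^esup>\<close>, and the zero series, whose subdegree
  is \<open>0\<close> by convention, belongs to every \<open>dg n\<close>.\<close>

definition dg :: "int \<Rightarrow> 'k::field fls set" where
  "dg n = {x. x = 0 \<or> - n \<le> fls_subdegree x}"

lemma dg_0 [simp]: "0 \<in> dg n" by (simp add: dg_def)

lemma dg_iff: "x \<in> dg n \<longleftrightarrow> (\<forall>m < -n. fls_nth x m = 0)"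
  unfolding dg_def by (cases "x = 0") (auto intro: fls_subdegree_geI)

lemma dg_add: "x \<in> dg n \<Longrightarrow> y \<in> dg n \<Longrightarrow> x + y \<in> dg n"
  by (simp add: dg_iff)

lemma dg_minus: "x \<in> dg n \<Longrightarrow> - x \<in> dg n"
  by (simp add: dg_iff)

lemma dg_diff: "x \<in> dg n \<Longrightarrow> y \<in> dg n \<Longrightarrow> x - y \<in> dg n"
  by (simp add: dg_iff)

lemma dg_mono: "x \<in> dg m \<Longrightarrow> m \<le> n \<Longrightarrow> x \<in> dg n"
  by (auto simp: dg_def)

lemma dg_mult: "x \<in> dg m \<Longrightarrow> y \<in> dg n \<Longrightarrow> x * y \<in> dg (m + n)"
  by (cases "x = 0 \<or> y = 0") (auto simp: dg_def)

lemma dg_mult': "x \<in> dg m \<Longrightarrow> y \<in> dg n \<Longrightarrow> m + n \<le> k \<Longrightarrow> x * y \<in> dg k"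
  using dg_mult dg_mono by blast

lemma dg_sum: "(\<And>i. i \<in> I \<Longrightarrow> f i \<in> dg n) \<Longrightarrow> sum f I \<in> dg n"
  by (induction I rule: infinite_finite_induct) (auto intro: dg_add)

lemma dg_1: "0 \<le> n \<Longrightarrow> 1 \<in> dg n" by (simp add: dg_def)

lemma intO_eq: "intO = dg 0" by (auto simp: intO_def dg_def)

definition exdeg :: "'k::field fls \<Rightarrow> int \<Rightarrow> bool" where
  "exdeg x n \<longleftrightarrow> x \<noteq> 0 \<and> fls_subdegree x = - n"

lemma exdeg_alt: "exdeg x n \<longleftrightarrow> x \<in> dg n \<and> x \<notin> dg (n - 1)"
  by (auto simp: exdeg_def dg_def)

lemma exdeg_nth: "exdeg x n \<longleftrightarrow> fls_nth x (- n) \<noteq> 0 \<and> (\<forall>m < -n. fls_nth x m = 0)"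
proof
  assume "exdeg x n"
  then show "fls_nth x (- n) \<noteq> 0 \<and> (\<forall>m < -n. fls_nth x m = 0)"
    unfolding exdeg_def by (metis fls_eq0_below_subdegree nth_fls_subdegree_nonzero)
next
  assume "fls_nth x (- n) \<noteq> 0 \<and> (\<forall>m < -n. fls_nth x m = 0)"
  then show "exdeg x n" unfolding exdeg_def by (auto intro: fls_subdegree_eqI)
qed

lemma exdeg_mult: "exdeg x m \<Longrightarrow> exdeg y n \<Longrightarrow> exdeg (x * y) (m + n)"
  by (simp add: exdeg_def)

lemma exdeg_add: "exdeg x n \<Longrightarrow> y \<in> dg (n - 1) \<Longrightarrow> exdeg (x + y) n"
  by (simp add: exdeg_nth dg_iff)

lemma exdeg_minus: "exdeg x n \<Longrightarrow> exdeg (- x) n" by (simp add: exdeg_def)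

lemma exdeg_divide: "x \<in> dg m \<Longrightarrow> exdeg y n \<Longrightarrow> x / y \<in> dg (m - n)"
  by (cases "x = 0") (auto simp: dg_def exdeg_def fls_divide_subdegree)

definition tt :: "int \<Rightarrow> 'k::field fls" where "tt n = fls_X_intpow (- n)"

lemma tt_nth: "fls_nth (tt n) m = (if m = - n then 1 else 0)"
  by (auto simp: tt_def)

lemma tt_ex: "exdeg (tt n) n"
  by (simp add: exdeg_nth tt_nth)

lemma tt_dg: "n \<le> m \<Longrightarrow> tt n \<in> dg m"
  by (simp add: dg_iff tt_nth)

lemma tt_nz [simp]: "tt n \<noteq> (0 :: 'k::field fls)"
  using tt_ex[of n, where 'a = 'k] by (simp add: exdeg_def)

lemma tt_add: "tt m * tt n = tt (m + n)"
  unfolding tt_def fls_X_intpow_times_fls_X_intpow by (simp add: add.commute)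

lemma tt_0 [simp]: "tt 0 = 1" by (simp add: tt_def)

lemma tt_inv: "inverse (tt n) = (tt (- n) :: 'k::field fls)"
  by (rule inverse_unique) (simp add: tt_add)

section \<open>Explicit 4 by 4 matrices and elements of the symplectic group\<close>

definition row4 :: "'a \<Rightarrow> 'a \<Rightarrow> 'a \<Rightarrow> 'a \<Rightarrow> 'a ^4" where
  "row4 a b c d = (\<chi> i. if i = 0 then a else if i = 1 then b else if i = 2 then c else d)"

lemma row4_nth [simp]: "row4 a b c d $ 0 = a" "row4 a b c d $ 1 = b" "row4 a b c d $ 2 = c" "row4 a b c d $ 3 = d"
  by (simp_all add: row4_def)

lemma row4_eq_iff [simp]: "row4 a b c d = row4 a' b' c' d' \<longleftrightarrow> a = a' \<and> b = b' \<and> c = c' \<and> d = d'"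
  by (simp add: vec_eq_iff forall_4')

lemma row4_mult: "row4 (row4 a0 a1 a2 a3) (row4 b0 b1 b2 b3) (row4 c0 c1 c2 c3) (row4 d0 d1 d2 d3) ** (B::'a::comm_ring_1^4^4) =
  row4 (a0 *s B$0 + a1 *s B$1 + a2 *s B$2 + a3 *s B$3) (b0 *s B$0 + b1 *s B$1 + b2 *s B$2 + b3 *s B$3)
    (c0 *s B$0 + c1 *s B$1 + c2 *s B$2 + c3 *s B$3) (d0 *s B$0 + d1 *s B$1 + d2 *s B$2 + d3 *s B$3)"
  by (simp add: vec_eq_iff forall_4' matrix_matrix_mult_def sum_4')

lemma row4_smult: "c *s row4 x y z w = row4 (c * x) (c * y) (c * z) (c * w)"
  by (simp add: vec_eq_iff forall_4')
lemma row4_plus: "row4 x y z w + row4 x' y' z' w' = row4 (x + x') (y + y') (z + z') (w + w')"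
  by (simp add: vec_eq_iff forall_4')

lemmas row4_calc = row4_mult row4_smult row4_plus

lemma mat_1_row4: "mat 1 = row4 (row4 1 0 0 0) (row4 0 1 0 0) (row4 0 0 1 0) (row4 0 0 0 1)"
  by (simp add: vec_eq_iff forall_4' mat_def)

lemma symplectic_iff: "transpose A ** Jsp ** A = Jsp \<longleftrightarrow>
  (\<forall>j l. A$0$j * A$3$l + A$1$j * A$2$l - A$2$j * A$1$l - A$3$j * A$0$l = Jsp$j$l)"
  for A :: "'a::comm_ring_1 ^4^4"
proof -
  have "(transpose A ** Jsp ** A) $ j $ l = A$0$j * A$3$l + A$1$j * A$2$l - A$2$j * A$1$l - A$3$j * A$0$l" for j l
    by (simp add: matrix_matrix_mult_def transpose_def sum_4') (simp add: Jsp_def algebra_simps)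
  then show ?thesis by (simp add: vec_eq_iff)
qed

lemma Sp4_iff: "A \<in> Sp4 R \<longleftrightarrow> (\<forall>i j. A$i$j \<in> R) \<and>
  (\<forall>j l. A$0$j * A$3$l + A$1$j * A$2$l - A$2$j * A$1$l - A$3$j * A$0$l = Jsp$j$l)"
  unfolding Sp4_def symplectic_iff by simp

lemma Sp4_row_form:
  fixes A :: "'a::field ^4^4"
  assumes "A \<in> Sp4 R"
  shows "A$i$0 * A$k$3 + A$i$1 * A$k$2 - A$i$2 * A$k$1 - A$i$3 * A$k$0 = Jsp$i$k"
proof -
  have "(A ** Jsp ** transpose A) $ i $ k = A$i$0 * A$k$3 + A$i$1 * A$k$2 - A$i$2 * A$k$1 - A$i$3 * A$k$0"
    by (simp add: matrix_matrix_mult_def transpose_def sum_4') (simp add: Jsp_def algebra_simps)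
  then show ?thesis using symp_rows[of A] assms by (simp add: Sp4_def)
qed

lemma Sp4_transpose: "A \<in> Sp4 R \<Longrightarrow> transpose A \<in> Sp4 R" for A :: "'a::field ^4^4"
  using symp_rows[of A] by (simp add: Sp4_def) (simp add: transpose_def)

text \<open>The unipotent radical of the stabiliser of the line spanned by the first basis vector: a
  Heisenberg group with central coordinate \<open>z\<close>.\<close>

definition heis :: "'a::comm_ring_1 \<Rightarrow> 'a \<Rightarrow> 'a \<Rightarrow> 'a ^4^4" where
  "heis x y z = row4 (row4 1 x y z) (row4 0 1 0 y) (row4 0 0 1 (-x)) (row4 0 0 0 1)"

text \<open>The abelian unipotent radical of the stabiliser of the Lagrangian plane spanned by the
  first two basis vectors; (a, b, c) are the coefficients of a binary quadratic form.\<close>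

definition siegel :: "'a::comm_ring_1 \<Rightarrow> 'a \<Rightarrow> 'a \<Rightarrow> 'a ^4^4" where
  "siegel a b c = row4 (row4 1 0 b a) (row4 0 1 c b) (row4 0 0 1 0) (row4 0 0 0 1)"

text \<open>For determinant 1 this is the copy of SL2 acting on the two middle coordinates.\<close>

definition mid :: "'a::comm_ring_1 \<Rightarrow> 'a \<Rightarrow> 'a \<Rightarrow> 'a \<Rightarrow> 'a ^4^4" where
  "mid p q r s = row4 (row4 1 0 0 0) (row4 0 p q 0) (row4 0 r s 0) (row4 0 0 0 1)"

definition diag4 :: "'a::field \<Rightarrow> 'a \<Rightarrow> 'a ^4^4" where
  "diag4 a b = row4 (row4 a 0 0 0) (row4 0 b 0 0) (row4 0 0 (inverse b) 0) (row4 0 0 0 (inverse a))"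

definition wswap :: "'a::comm_ring_1 ^4^4" where
  "wswap = row4 (row4 0 1 0 0) (row4 1 0 0 0) (row4 0 0 0 1) (row4 0 0 1 0)"

lemma subring_setD:
  assumes "subring_set R"
  shows "0 \<in> R" "1 \<in> R" "x \<in> R \<Longrightarrow> - x \<in> R" "x \<in> R \<Longrightarrow> y \<in> R \<Longrightarrow> x + y \<in> R" "x \<in> R \<Longrightarrow> y \<in> R \<Longrightarrow> x * y \<in> R"
    "x \<in> R \<Longrightarrow> y \<in> R \<Longrightarrow> x - y \<in> R"
  using assms unfolding subring_set_def by auto (metis uminus_add_conv_diff add.commute)

lemma Sp4_generators:
  assumes R: "subring_set R"
  shows "x \<in> R \<Longrightarrow> y \<in> R \<Longrightarrow> z \<in> R \<Longrightarrow> heis x y z \<in> Sp4 R"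
    "x \<in> R \<Longrightarrow> y \<in> R \<Longrightarrow> z \<in> R \<Longrightarrow> siegel x y z \<in> Sp4 R"
    "p \<in> R \<Longrightarrow> q \<in> R \<Longrightarrow> r \<in> R \<Longrightarrow> s \<in> R \<Longrightarrow> p * s - q * r = 1 \<Longrightarrow> mid p q r s \<in> Sp4 R"
    "wswap \<in> Sp4 R" "Jsp \<in> Sp4 R"
  using subring_setD[OF R]
  by (simp_all add: Sp4_iff forall_4' heis_def siegel_def mid_def wswap_def Jsp_def algebra_simps)

lemma Sp4_diag4: "a \<in> R \<Longrightarrow> inverse a \<in> R \<Longrightarrow> b \<in> R \<Longrightarrow> inverse b \<in> R \<Longrightarrow> a \<noteq> 0 \<Longrightarrow> b \<noteq> 0 \<Longrightarrow>
   0 \<in> R \<Longrightarrow> diag4 a b \<in> Sp4 R"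
  by (simp add: Sp4_iff forall_4' diag4_def Jsp_def)

section \<open>Degrees of entries and of 2 by 2 minors as invariants of double cosets\<close>

definition ent :: "int \<Rightarrow> 'k::field fls ^4^4 \<Rightarrow> bool" where
  "ent n A \<longleftrightarrow> (\<forall>i j. A$i$j \<in> dg n)"

definition minor :: "'a::comm_ring_1 ^4^4 \<Rightarrow> 4 \<Rightarrow> 4 \<Rightarrow> 4 \<Rightarrow> 4 \<Rightarrow> 'a" where
  "minor A i k j l = A$i$j * A$k$l - A$i$l * A$k$j"

definition mnr :: "int \<Rightarrow> 'k::field fls ^4^4 \<Rightarrow> bool" where
  "mnr n A \<longleftrightarrow> (\<forall>i k j l. minor A i k j l \<in> dg n)"

definition keq :: "'k::field fls ^4^4 \<Rightarrow> 'k fls ^4^4 \<Rightarrow> bool" where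
  "keq A B \<longleftrightarrow> (\<exists>k1\<in>Kcpt. \<exists>k2\<in>Kcpt. A = k1 ** B ** k2)"

lemma keqI: "k1 \<in> Kcpt \<Longrightarrow> k2 \<in> Kcpt \<Longrightarrow> A = k1 ** B ** k2 \<Longrightarrow> keq A B"
  unfolding keq_def by blast

lemma keq_trans: "keq A B \<Longrightarrow> keq B C \<Longrightarrow> keq A C"
proof -
  assume "keq A B" "keq B C"
  then obtain k1 k2 l1 l2 where k: "k1 \<in> Kcpt" "k2 \<in> Kcpt" "A = k1 ** B ** k2"
    and l: "l1 \<in> Kcpt" "l2 \<in> Kcpt" "B = l1 ** C ** l2" unfolding keq_def by blast
  have "A = (k1 ** l1) ** C ** (l2 ** k2)" by (simp add: k(3) l(3) matrix_mul_assoc)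
  then show ?thesis
    by (rule keqI[OF Sp4_mult[OF subring_intO k(1) l(1)] Sp4_mult[OF subring_intO l(2) k(2)]])
qed

lemma keq_sym:
  assumes "keq A B" shows "keq B A"
proof -
  obtain k1 k2 where k: "k1 \<in> Kcpt" "k2 \<in> Kcpt" "A = k1 ** B ** k2" using assms by (auto simp: keq_def)
  have 1: "symp_inv k1 ** k1 = mat 1" "k2 ** symp_inv k2 = mat 1"
    using k symp_inv_left symp_inv_right by (auto simp: Sp4_def)
  have "symp_inv k1 ** A ** symp_inv k2 = (symp_inv k1 ** k1) ** B ** (k2 ** symp_inv k2)"
    by (simp add: k(3) matrix_mul_assoc)
  then have "B = symp_inv k1 ** A ** symp_inv k2" by (simp add: 1)
  then show ?thesis
    by (rule keqI[OF Sp4_symp_inv[OF subring_intO k(1)] Sp4_symp_inv[OF subring_intO k(2)]])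
qed

lemma keq_mult:
  assumes "k1 \<in> Kcpt" "k2 \<in> Kcpt" shows "keq A (k1 ** A ** k2)"
  by (rule keq_sym, rule keqI[OF assms refl])

lemma keq_left: "k1 \<in> Kcpt \<Longrightarrow> keq A (k1 ** A)"
  using keq_mult[of k1 "mat 1" A] Sp4_one[OF subring_intO] by simp

lemma keq_right: "k2 \<in> Kcpt \<Longrightarrow> keq A (A ** k2)"
  using keq_mult[of "mat 1" k2 A] Sp4_one[OF subring_intO] by simp

lemma ent_mult: "ent m A \<Longrightarrow> ent n B \<Longrightarrow> ent (m + n) (A ** B)"
  unfolding ent_def matrix_matrix_mult_def by (auto intro!: dg_sum dg_mult)

text \<open>Cauchy-Binet for 2 by 2 minors, written as a sum over all ordered pairs of rows.\<close>

lemma mnr_mult_left: "ent 0 k \<Longrightarrow> mnr n A \<Longrightarrow> mnr n (k ** A)"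
proof -
  assume k: "ent 0 k" and A: "mnr n A"
  have "minor (k ** A) i i' j l = (\<Sum>p\<in>UNIV. \<Sum>r\<in>UNIV. k$i$p * k$i'$r * minor A p r j l)" for i i' j l
    unfolding minor_def matrix_matrix_mult_def vec_lambda_beta sum_product sum_subtractf[symmetric]
    by (rule sum.cong[OF refl], rule sum.cong[OF refl]) (simp add: right_diff_distrib mult_ac)
  moreover have "k$i$p * k$i'$r * minor A p r j l \<in> dg n" for i i' p r j l
    using k A unfolding ent_def mnr_def by (metis add_0 dg_mult)
  ultimately show ?thesis unfolding mnr_def by (auto intro!: dg_sum)
qed

lemma mnr_transpose: "mnr n A \<Longrightarrow> mnr n (transpose A)"
  unfolding mnr_def minor_def transpose_def by (simp add: mult.commute)

lemma mnr_mult_right: "ent 0 k \<Longrightarrow> mnr n A \<Longrightarrow> mnr n (A ** k)"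
proof -
  assume k: "ent 0 k" and A: "mnr n A"
  have "ent 0 (transpose k)" using k by (simp add: ent_def transpose_def)
  then have "mnr n (transpose k ** transpose A)" using A by (intro mnr_mult_left mnr_transpose)
  then have "mnr n (transpose (transpose k ** transpose A))" by (rule mnr_transpose)
  then show ?thesis by (simp add: matrix_transpose_mul)
qed

lemma Kcpt_ent: "k \<in> Kcpt \<Longrightarrow> ent 0 k" by (simp add: Sp4_def ent_def intO_eq)

lemma keq_ent: "keq A B \<Longrightarrow> ent n A \<longleftrightarrow> ent n B"
proof -
  have "ent n A" if AB: "keq A B" "ent n B" for A B
  proof -
    obtain k1 k2 where k: "k1 \<in> Kcpt" "k2 \<in> Kcpt" "A = k1 ** B ** k2" using AB(1) by (auto simp: keq_def)
    have "ent (0 + n + 0) A" unfolding k(3) using k AB(2) by (intro ent_mult Kcpt_ent)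
    then show ?thesis by simp
  qed
  then show "keq A B \<Longrightarrow> ?thesis" using keq_sym by blast
qed

lemma keq_mnr: "keq A B \<Longrightarrow> mnr n A \<longleftrightarrow> mnr n B"
proof -
  have "mnr n A" if AB: "keq A B" "mnr n B" for A B
  proof -
    obtain k1 k2 where k: "k1 \<in> Kcpt" "k2 \<in> Kcpt" "A = k1 ** B ** k2" using AB(1) by (auto simp: keq_def)
    show ?thesis unfolding k(3) using k AB(2) by (intro mnr_mult_right mnr_mult_left Kcpt_ent)
  qed
  then show "keq A B \<Longrightarrow> ?thesis" using keq_sym by blast
qed

text \<open>The degrees of the norms of \<open>A\<close> and of its exterior square. For
  \<open>dominant i j\<close> they are \<open>i\<close> and \<open>i + j\<close>.\<close>

definition ktype :: "'k::field fls ^4^4 \<Rightarrow> int \<Rightarrow> int \<Rightarrow> bool" where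
  "ktype A i m \<longleftrightarrow> ent i A \<and> \<not> ent (i - 1) A \<and> mnr m A \<and> \<not> mnr (m - 1) A"

lemma keq_ktype: "keq A B \<Longrightarrow> ktype A i m \<longleftrightarrow> ktype B i m"
  unfolding ktype_def using keq_ent keq_mnr by blast

lemma ent_mono: "ent m A \<Longrightarrow> m \<le> n \<Longrightarrow> ent n A" unfolding ent_def using dg_mono by blast
lemma mnr_mono: "mnr m A \<Longrightarrow> m \<le> n \<Longrightarrow> mnr n A" unfolding mnr_def using dg_mono by blast

lemma ktype_unique: "ktype A i m \<Longrightarrow> ktype A i' m' \<Longrightarrow> i = i' \<and> m = m'"
  unfolding ktype_def using ent_mono[of i A "i' - 1"] ent_mono[of i' A "i - 1"]
    mnr_mono[of m A "m' - 1"] mnr_mono[of m' A "m - 1"] by linarith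

text \<open>Row and column weights exploit the shape of a matrix whose large entries share a row or
  a column: only minors with distinct rows and distinct columns count, and the weights can bound
  these by less than twice the largest degree.\<close>

lemma mnr_from_weights:
  assumes e: "\<And>i j. A$i$j \<in> dg (r i + c j)"
    and m: "\<And>i k j l. i \<noteq> k \<Longrightarrow> j \<noteq> l \<Longrightarrow> r i + r k + c j + c l \<le> m"
  shows "mnr m A"
  unfolding mnr_def
proof (intro allI)
  fix i k j l
  show "minor A i k j l \<in> dg m"
  proof (cases "i = k \<or> j = l")
    case True then show ?thesis by (auto simp: minor_def)
  next
    case False
    then have "r i + r k + c j + c l \<le> m" using m by blast
    then show ?thesis unfolding minor_def
      by (intro dg_diff dg_mult'[OF e e]) auto
  qed
qed

section \<open>Cartan decomposition\<close>

lemma Jsp_row4: "Jsp = row4 (row4 0 0 0 1) (row4 0 0 1 0) (row4 0 (-1) 0 0) (row4 (-1) 0 0 (0::'a::comm_ring_1))"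
  by (simp add: vec_eq_iff forall_4' Jsp_def)

lemma row_to_top:
  "\<exists>k\<in>Kcpt. \<forall>A :: 'k::field fls ^4^4. (k ** A) $ 0 = A $ i"
proof -
  note gen = Sp4_generators[OF subring_intO]
  consider "i = 0" | "i = 1" | "i = 2" | "i = 3" using exhaust_4'[of i] by blast
  then show ?thesis
  proof cases
    case 1 then show ?thesis using Sp4_one[OF subring_intO] by (intro bexI[of _ "mat 1"]) auto
  next
    case 2 then show ?thesis using gen(4) by (intro bexI[of _ wswap]) (auto simp: wswap_def row4_mult)
  next
    case 3
    have "(wswap ** Jsp) ** A = wswap ** (Jsp ** A)" for A :: "'k fls ^4^4" by (simp add: matrix_mul_assoc)
    then show ?thesis using 3 Sp4_mult[OF subring_intO gen(4) gen(5)]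
      by (intro bexI[of _ "wswap ** Jsp"]) (auto simp: wswap_def Jsp_row4 row4_mult)
  next
    case 4 then show ?thesis using gen(5) by (intro bexI[of _ Jsp]) (auto simp: Jsp_row4 row4_mult)
  qed
qed

lemma column_to_left:
  "\<exists>k\<in>Kcpt. \<forall>A :: 'k::field fls ^4^4. \<forall>i. (A ** k) $ i $ 0 = A $ i $ j"
proof -
  obtain k where k: "k \<in> Kcpt" "\<And>A :: 'k fls ^4^4. (k ** A) $ 0 = A $ j" using row_to_top[of j] by blast
  have "(A ** transpose k) $ i $ 0 = A $ i $ j" for A :: "'k fls ^4^4" and i
  proof -
    have "(A ** transpose k) $ i $ 0 = (k ** transpose A) $ 0 $ i"
      by (simp add: matrix_matrix_mult_def transpose_def mult.commute)
    then show ?thesis by (simp add: k(2) transpose_def)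
  qed
  then show ?thesis using Sp4_transpose[OF k(1)] by blast
qed

lemma finite_attains_min:
  fixes f :: "'a \<Rightarrow> int"
  assumes "finite M" "M \<noteq> {}"
  obtains x where "x \<in> M" "\<And>y. y \<in> M \<Longrightarrow> f x \<le> f y"
proof -
  have "Min (f ` M) \<in> f ` M" using assms by (intro Min_in) auto
  then obtain x where "x \<in> M" "Min (f ` M) = f x" by blast
  then show thesis using that[of x] assms(1) by (metis Min_le finite_imageI imageI)
qed

lemma max_entry:
  assumes "A \<in> Sp4 (UNIV :: 'k::field fls set)"
  obtains i j n where "exdeg (A$i$j) n" "ent n A"
proof -
  define M where "M = {(i, j). A$i$j \<noteq> 0}"
  have "M \<noteq> {}"
  proof
    assume "M = {}"
    then have "A = 0" by (auto simp: M_def vec_eq_iff)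
    then show False using assms by (simp add: Sp4_iff forall_4' Jsp_def)
  qed
  moreover have "finite M" by (rule finite_subset[of _ UNIV]) auto
  ultimately obtain ij where ij: "ij \<in> M" "\<And>kl. kl \<in> M \<Longrightarrow> fls_subdegree (A$fst ij$snd ij) \<le> fls_subdegree (A$fst kl$snd kl)"
    using finite_attains_min[of M "\<lambda>ij. fls_subdegree (A$fst ij$snd ij)"] by blast
  show thesis
  proof (rule that)
    show "exdeg (A$fst ij$snd ij) (- fls_subdegree (A$fst ij$snd ij))"
      using ij(1) by (auto simp: M_def exdeg_def)
    show "ent (- fls_subdegree (A$fst ij$snd ij)) A"
      unfolding ent_def dg_def
    proof (intro allI)
      fix i j
      show "A$i$j \<in> {x. x = 0 \<or> - (- fls_subdegree (A$fst ij$snd ij)) \<le> fls_subdegree x}"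
        using ij(2)[of "(i, j)"] by (auto simp: M_def)
    qed
  qed
qed

lemma diag4_mid: "diag4 a 1 ** mid p q r s = row4 (row4 a 0 0 0) (row4 0 p q 0) (row4 0 r s 0) (row4 0 0 0 (inverse a))"
  by (simp add: diag4_def mid_def row4_calc)

lemma mid_mult: "mid p q r s ** mid p' q' r' s' = mid (p * p' + q * r') (p * q' + q * s') (r * p' + s * r') (r * q' + s * s')"
  by (simp add: mid_def row4_calc)

lemma mid_diag4: "mid p q r s ** diag4 a 1 = diag4 a 1 ** mid p q r s"
  by (simp add: diag4_def mid_def row4_calc)

text \<open>With an entry of maximal degree as pivot, all quotients by it are integral, so the
  eliminating unipotent matrices lie in K. Maximality of the pivot is kept in the conclusion because
  it later gives j <= i.\<close>

lemma reduce_first_row_column: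
  assumes A: "A \<in> Sp4 (UNIV :: 'k::field fls set)"
  obtains a p q r s n where "keq A (diag4 a 1 ** mid p q r s)" "exdeg a n" "p * s - q * r = 1"
    "ent n (diag4 a 1 ** mid p q r s)"
proof -
  obtain i j n where ij: "exdeg (A$i$j) n" "ent n A" using max_entry[OF A] .
  obtain k1 where k1: "k1 \<in> Kcpt" "\<And>A :: 'k fls ^4^4. (k1 ** A) $ 0 = A $ i" using row_to_top[of i] by blast
  obtain k2 where k2: "k2 \<in> Kcpt" "\<And>(A :: 'k fls ^4^4) i. (A ** k2) $ i $ 0 = A $ i $ j" using column_to_left[of j] by blast
  define B where "B = k1 ** A ** k2"
  have AB: "keq A B" unfolding B_def by (rule keq_mult[OF k1(1) k2(1)])
  define a where "a = B$0$0"
  have "a = A$i$j" unfolding a_def B_def by (simp add: k2(2) k1(2))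
  then have ea: "exdeg a n" using ij by simp
  then have a0: "a \<noteq> 0" by (simp add: exdeg_def)
  have nB: "ent n B" using keq_ent[OF AB] ij by simp
  have O: "B$k$l / a \<in> intO" for k l
    using exdeg_divide[OF _ ea, of "B$k$l" n] nB by (simp add: ent_def intO_eq)
  have mO: "- (B$k$l / a) \<in> intO" for k l using O subring_setD(3)[OF subring_intO] by blast
  define L where "L = transpose (heis (- (B$1$0 / a)) (- (B$2$0 / a)) (- (B$3$0 / a)))"
  have LK: "L \<in> Kcpt" unfolding L_def by (intro Sp4_transpose Sp4_generators[OF subring_intO] mO)
  have Lr: "L = row4 (row4 1 0 0 0) (row4 (- (B$1$0 / a)) 1 0 0) (row4 (- (B$2$0 / a)) 0 1 0)
     (row4 (- (B$3$0 / a)) (- (B$2$0 / a)) (B$1$0 / a) 1)"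
    by (simp add: L_def heis_def transpose_def vec_eq_iff forall_4')
  define C where "C = L ** B"
  have C0: "C$0 = B$0" by (simp add: C_def Lr row4_mult)
  \<comment> \<open>The last row of \<open>L\<close> has further nonzero entries forced by the form;
    their two contributions to the first column cancel each other.\<close>
  have C1: "C$1$0 = 0" "C$2$0 = 0" "C$3$0 = 0"
    using a0 unfolding a_def[symmetric] by (simp_all add: C_def Lr row4_mult flip: a_def)
  define U where "U = heis (- (B$0$1 / a)) (- (B$0$2 / a)) (- (B$0$3 / a))"
  have UK: "U \<in> Kcpt" unfolding U_def by (intro Sp4_generators[OF subring_intO] mO)
  define E where "E = C ** U"
  have E0: "E$i$0 = C$i$0" for i
    by (simp add: E_def U_def heis_def matrix_matrix_mult_def sum_4')
  have E1: "E$0$1 = 0" "E$0$2 = 0" "E$0$3 = 0"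
    using a0 by (simp_all add: E_def U_def heis_def matrix_matrix_mult_def sum_4' C0 flip: a_def)
  have E00: "E$0$0 = a" by (simp add: E0 C0 a_def)
  have Ec: "E$1$0 = 0" "E$2$0 = 0" "E$3$0 = 0" using C1 by (simp_all add: E0)
  have AE: "keq A E"
    using keq_trans[OF AB keq_trans[OF keq_left[OF LK] keq_right[OF UK]]] by (simp add: E_def C_def)
  have Ksub: "k \<in> Sp4 UNIV" if "k \<in> Kcpt" for k :: "'k fls ^4^4" using that by (simp add: Sp4_def)
  have SU: "subring_set (UNIV :: 'k fls set)" by (simp add: subring_set_def)
  have ESp: "E \<in> Sp4 UNIV" unfolding E_def C_def B_def
    by (intro Sp4_mult[OF SU] A Ksub k1(1) k2(1) LK UK)
  note col = ESp[unfolded Sp4_iff, THEN conjunct2, rule_format]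
  note row = Sp4_row_form[OF ESp]
  \<comment> \<open>With the first row and column cleared, the symplectic relations alone determine
    the last row and column and leave a middle block of determinant 1.\<close>
  have "a * E$3$3 = 1" using col[of 0 3] by (simp add: E00 Ec Jsp_def)
  then have 33: "E$3$3 = inverse a" by (metis inverse_unique)
  have 3: "E$3$1 = 0" "E$3$2 = 0" using col[of 0 1] col[of 0 2] a0 by (simp_all add: E00 Ec Jsp_def)
  have 4: "E$1$3 = 0" "E$2$3 = 0" using row[of 0 1] row[of 0 2] a0 by (simp_all add: E00 E1 Jsp_def)
  have det: "E$1$1 * E$2$2 - E$1$2 * E$2$1 = 1" using col[of 1 2] by (simp add: E1 3 Jsp_def mult.commute)
  have Eeq: "E = diag4 a 1 ** mid (E$1$1) (E$1$2) (E$2$1) (E$2$2)"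
    unfolding diag4_mid by (simp add: vec_eq_iff forall_4' E00 E1 Ec 3 4 33)
  have nE: "ent n E" using keq_ent[OF AE] ij by simp
  show thesis by (rule that[OF _ ea det]) (use AE nE Eeq in auto)
qed

text \<open>The Cartan decomposition of SL2. Wherever the largest entry stands, Weyl elements of
  determinant 1 bring it to the corner at the price of signs, and integral unipotent matrices clear
  its row and column.\<close>

lemma mid_reduce:
  fixes p q r s :: "'k::field fls"
  assumes det: "p * s - q * r = 1"
  obtains k1 k2 b m where "k1 \<in> Kcpt" "k2 \<in> Kcpt" "\<And>a. k1 ** (diag4 a 1 ** mid p q r s) ** k2 = diag4 a b"
    "exdeg b m" "0 \<le> m"
proof -
  have midr: "mid a b c d \<in> range (\<lambda>(p,q,r,s). mid p q r s)" for a b c d :: "'k fls"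
    by (rule range_eqI[of _ _ "(a, b, c, d)"]) simp
  \<comment> \<open>The left factor must be some \<open>mid\<close>, because at the end it has to
    commute with \<open>diag4 a 1\<close>.\<close>
  define red where "red = (\<lambda>M :: 'k fls ^4^4. \<exists>k1\<in>Kcpt. \<exists>k2\<in>Kcpt. \<exists>b m.
    k1 ** M ** k2 = mid b 0 0 (inverse b) \<and> k1 \<in> range (\<lambda>(p,q,r,s). mid p q r s) \<and> exdeg b m \<and> 0 \<le> m)"
  have redI: "red M" if "k1 \<in> Kcpt" "k2 \<in> Kcpt" "k1 ** M ** k2 = mid b 0 0 (inverse b)"
    "k1 \<in> range (\<lambda>(p,q,r,s). mid p q r s)" "exdeg b m" "0 \<le> m" for k1 k2 M b m
    unfolding red_def using that by blast
  have main: "red (mid p q r s)"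
    if det: "p * s - q * r = 1" and mx: "exdeg p m" "q \<in> dg m" "r \<in> dg m" "s \<in> dg m" for p q r s :: "'k fls" and m
  proof -
    have p0: "p \<noteq> 0" using mx by (simp add: exdeg_def)
    have O: "- (r / p) \<in> intO" "- (q / p) \<in> intO"
      using exdeg_divide[OF mx(3,1)] exdeg_divide[OF mx(2,1)] by (auto simp: intO_eq intro: dg_minus)
    have "s - r * q / p = inverse p" using det p0 by (simp add: field_simps)
    then have eq: "mid 1 0 (- (r / p)) 1 ** mid p q r s ** mid 1 (- (q / p)) 0 1 = mid p 0 0 (inverse p)"
      using p0 by (simp add: mid_mult)
    \<comment> \<open>If all entries had negative degree, so would the determinant 1.\<close>
    have "0 \<le> m"
    proof (rule ccontr)
      assume "\<not> 0 \<le> m"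
      have "p \<in> dg m" using mx(1) by (simp add: exdeg_alt)
      then have "p * s - q * r \<in> dg (m + m)" using mx by (intro dg_diff dg_mult)
      then show False using det \<open>\<not> 0 \<le> m\<close> by (simp add: dg_def)
    qed
    moreover have "mid 1 0 (- (r / p)) 1 \<in> Kcpt" "mid 1 (- (q / p)) 0 1 \<in> Kcpt"
      using O subring_setD(1,2)[OF subring_intO] by (auto intro!: Sp4_generators[OF subring_intO])
    moreover have "mid 1 0 (- (r / p)) 1 \<in> range (\<lambda>(p,q,r,s). mid p q r s)" by (rule midr)
    ultimately show ?thesis using eq mx(1) by (intro redI)
  qed
  have wK: "mid 0 1 (-1) 0 \<in> Kcpt" "mid 0 (-1) 1 0 \<in> Kcpt"
    using subring_setD(1,2,3)[OF subring_intO] by (auto intro!: Sp4_generators[OF subring_intO])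
  have "\<exists>m. (exdeg p m \<or> exdeg q m \<or> exdeg r m \<or> exdeg s m) \<and> p \<in> dg m \<and> q \<in> dg m \<and> r \<in> dg m \<and> s \<in> dg m"
  proof -
    define X where "X = {p, q, r, s} - {0}"
    have "X \<noteq> {}" using det by (auto simp: X_def)
    moreover have "finite X" by (simp add: X_def)
    ultimately obtain x where x: "x \<in> X" "\<And>y. y \<in> X \<Longrightarrow> fls_subdegree x \<le> fls_subdegree y"
      using finite_attains_min[of X fls_subdegree] by blast
    then show ?thesis
      by (intro exI[of _ "- fls_subdegree x"]) (auto simp: X_def exdeg_def dg_def)
  qed
  then obtain m where m: "exdeg p m \<or> exdeg q m \<or> exdeg r m \<or> exdeg s m" "p \<in> dg m" "q \<in> dg m" "r \<in> dg m" "s \<in> dg m"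
    by blast
  have "red (mid p q r s)"
    using m(1)
  proof (elim disjE)
    assume "exdeg p m" then show ?thesis by (rule main[OF det _ m(3-5)])
  next
    assume q: "exdeg q m"
    have d: "q * (- r) - (- p) * s = 1" using det by (simp add: algebra_simps)
    obtain k1 k2 b m' where k: "k1 \<in> Kcpt" "k2 \<in> Kcpt" "k1 ** mid q (-p) s (-r) ** k2 = mid b 0 0 (inverse b)"
      "k1 \<in> range (\<lambda>(p,q,r,s). mid p q r s)" "exdeg b m'" "0 \<le> m'"
      using main[OF d q dg_minus[OF m(2)] m(5) dg_minus[OF m(4)]] unfolding red_def by blast
    have e: "mid p q r s ** mid 0 (-1) 1 0 = mid q (-p) s (-r)" by (simp add: mid_mult)
    have "k1 ** mid p q r s ** (mid 0 (-1) 1 0 ** k2) = mid b 0 0 (inverse b)"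
      using k(3) unfolding e[symmetric] matrix_mul_assoc .
    then show ?thesis by (rule redI[OF k(1) Sp4_mult[OF subring_intO wK(2) k(2)] _ k(4-6)])
  next
    assume r: "exdeg r m"
    have d: "r * (- q) - s * (- p) = 1" using det by (simp add: algebra_simps)
    obtain k1 k2 b m' where k: "k1 \<in> Kcpt" "k2 \<in> Kcpt" "k1 ** mid r s (-p) (-q) ** k2 = mid b 0 0 (inverse b)"
      "k1 \<in> range (\<lambda>(p,q,r,s). mid p q r s)" "exdeg b m'" "0 \<le> m'"
      using main[OF d r m(5) dg_minus[OF m(2)] dg_minus[OF m(3)]] unfolding red_def by blast
    have e: "mid 0 1 (-1) 0 ** mid p q r s = mid r s (-p) (-q)" by (simp add: mid_mult)
    have "(k1 ** mid 0 1 (-1) 0) ** mid p q r s ** k2 = mid b 0 0 (inverse b)"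
      using k(3) unfolding e[symmetric] matrix_mul_assoc .
    moreover have "k1 ** mid 0 1 (-1) 0 \<in> range (\<lambda>(p,q,r,s). mid p q r s)"
      using k(4) by (auto simp: mid_mult intro: midr)
    ultimately show ?thesis by (rule redI[OF Sp4_mult[OF subring_intO k(1) wK(1)] k(2) _ _ k(5,6)])
  next
    assume s: "exdeg s m"
    have d: "s * p - (- r) * (- q) = 1" using det by (simp add: algebra_simps)
    obtain k1 k2 b m' where k: "k1 \<in> Kcpt" "k2 \<in> Kcpt" "k1 ** mid s (-r) (-q) p ** k2 = mid b 0 0 (inverse b)"
      "k1 \<in> range (\<lambda>(p,q,r,s). mid p q r s)" "exdeg b m'" "0 \<le> m'"
      using main[OF d s dg_minus[OF m(4)] dg_minus[OF m(3)] m(2)] unfolding red_def by blast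
    have e: "mid 0 1 (-1) 0 ** mid p q r s ** mid 0 (-1) 1 0 = mid s (-r) (-q) p" by (simp add: mid_mult)
    have "(k1 ** mid 0 1 (-1) 0) ** mid p q r s ** (mid 0 (-1) 1 0 ** k2) = mid b 0 0 (inverse b)"
      using k(3) unfolding e[symmetric] matrix_mul_assoc .
    moreover have "k1 ** mid 0 1 (-1) 0 \<in> range (\<lambda>(p,q,r,s). mid p q r s)"
      using k(4) by (auto simp: mid_mult intro: midr)
    ultimately show ?thesis
      by (rule redI[OF Sp4_mult[OF subring_intO k(1) wK(1)] Sp4_mult[OF subring_intO wK(2) k(2)] _ _ k(5,6)])
  qed
  then obtain k1 k2 b m' where k: "k1 \<in> Kcpt" "k2 \<in> Kcpt" "k1 ** mid p q r s ** k2 = mid b 0 0 (inverse b)"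
      "k1 \<in> range (\<lambda>(p,q,r,s). mid p q r s)" "exdeg b m'" "0 \<le> m'" unfolding red_def by blast
  have "k1 ** (diag4 a 1 ** mid p q r s) ** k2 = diag4 a b" for a
  proof -
    have "k1 ** diag4 a 1 = diag4 a 1 ** k1" using k(4) mid_diag4 by auto
    then have "k1 ** (diag4 a 1 ** mid p q r s) ** k2 = diag4 a 1 ** (k1 ** mid p q r s ** k2)"
      by (simp add: matrix_mul_assoc)
    also have "\<dots> = diag4 a b" unfolding k(3) diag4_mid by (simp add: diag4_def)
    finally show ?thesis .
  qed
  then show thesis by (rule that[OF k(1,2) _ k(5,6)])
qed

definition dominant :: "int \<Rightarrow> int \<Rightarrow> 'k::field fls ^4^4" where
  "dominant i j = diag4 (tt i) (tt j)"

lemma unit_part: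
  assumes "exdeg a n"
  obtains u where "u \<in> intO" "inverse u \<in> intO" "u \<noteq> 0" "a = u * tt n"
proof -
  have a0: "a \<noteq> 0" "fls_subdegree a = - n" using assms by (auto simp: exdeg_def)
  define u where "u = a * tt (- n)"
  have t: "tt (-n) * tt n = (1 :: 'a fls)" by (simp add: tt_add)
  have eu: "exdeg u 0" using exdeg_mult[OF assms tt_ex[of "-n"]] by (simp add: u_def)
  then have "u \<noteq> 0" "fls_subdegree u = 0" by (auto simp: exdeg_def)
  moreover have "a = u * tt n" using t by (simp add: u_def mult.assoc)
  moreover have "u \<in> intO" using eu by (simp add: intO_eq exdeg_alt)
  moreover have "inverse u \<in> intO"
    using exdeg_divide[OF dg_1[of 0] eu] by (simp add: intO_eq inverse_eq_divide)
  ultimately show thesis using that by blast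
qed

theorem cartan_decomposition:
  assumes A: "A \<in> Sp4 (UNIV :: 'k::field fls set)"
  obtains i j where "0 \<le> j" "j \<le> i" "keq A (dominant i j)"
proof -
  obtain a p q r s n where 1: "keq A (diag4 a 1 ** mid p q r s)" "exdeg a n" "p * s - q * r = 1"
    "ent n (diag4 a 1 ** mid p q r s)" by (rule reduce_first_row_column[OF A])
  obtain k1 k2 b m where 2: "k1 \<in> Kcpt" "k2 \<in> Kcpt" "k1 ** (diag4 a 1 ** mid p q r s) ** k2 = diag4 a b"
    "exdeg b m" "0 \<le> m" by (rule mid_reduce[OF 1(3)]) blast
  have 3: "keq (diag4 a 1 ** mid p q r s) (diag4 a b)" using keq_mult[OF 2(1,2)] 2(3) by metis
  \<comment> \<open>The bound by the first pivot survives the SL2 reduction, which orders the two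
    exponents.\<close>
  have "ent n (diag4 a b)" using keq_ent[OF 3] 1(4) by simp
  then have "diag4 a b $ 1 $ 1 \<in> dg n" by (simp add: ent_def)
  then have mn: "m \<le> n" using 2(4) by (auto simp: diag4_def exdeg_def dg_def)
  obtain u where u: "u \<in> intO" "inverse u \<in> intO" "u \<noteq> 0" "a = u * tt n" by (rule unit_part[OF 1(2)])
  obtain v where v: "v \<in> intO" "inverse v \<in> intO" "v \<noteq> 0" "b = v * tt m" by (rule unit_part[OF 2(4)])
  have "diag4 a b = diag4 u v ** dominant n m"
    by (simp add: dominant_def diag4_def row4_calc u(4) v(4) inverse_mult_distrib mult_ac)
  moreover have "diag4 u v \<in> Kcpt" using u v by (intro Sp4_diag4) (auto simp: intO_def)
  ultimately have "keq (diag4 a b) (dominant n m)"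
    using keq_sym[OF keq_left[of "diag4 u v" "dominant n m"]] by simp
  then have "keq A (dominant n m)" using 1(1) 3 keq_trans by blast
  then show thesis using that 2(5) mn by blast
qed

lemma ktype_dominant: "0 \<le> j \<Longrightarrow> j \<le> i \<Longrightarrow> ktype (dominant i j :: 'k::field fls ^4^4) i (i + j)"
proof -
  assume ij: "0 \<le> j" "j \<le> i"
  let ?D = "dominant i j :: 'k fls ^4^4"
  have D: "?D = row4 (row4 (tt i) 0 0 0) (row4 0 (tt j) 0 0) (row4 0 0 (tt (-j)) 0) (row4 0 0 0 (tt (-i)))"
    by (simp add: dominant_def diag4_def tt_inv)
  have "ent i ?D" unfolding ent_def D using ij by (simp add: forall_4' tt_dg)
  moreover have "\<not> ent (i - 1) ?D"
  proof
    assume "ent (i - 1) ?D"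
    then have "?D$0$0 \<in> dg (i - 1)" by (simp add: ent_def)
    then show False using tt_ex[of i, where 'a = 'k] by (simp add: D exdeg_alt)
  qed
  moreover have "mnr (i + j) ?D"
  proof (rule mnr_from_weights)
    let ?r = "\<lambda>k::4. if k = 0 then i else if k = 1 then j else if k = 2 then - j else - i"
    have "\<forall>k l. ?D$k$l \<in> dg (?r k + 0)" unfolding D by (simp add: forall_4' tt_dg)
    then show "?D$k$l \<in> dg (?r k + (\<lambda>_. 0) l)" for k l by blast
    show "?r k + ?r k' + (\<lambda>_. 0) l + (\<lambda>_. 0) l' \<le> i + j" if "k \<noteq> k'" for k k' l l'
      using that ij by auto
  qed
  moreover have "\<not> mnr (i + j - 1) ?D"
  proof
    assume "mnr (i + j - 1) ?D"
    then have "minor ?D 0 1 0 1 \<in> dg (i + j - 1)" by (simp add: mnr_def)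
    then show False using tt_ex[of "i + j", where 'a = 'k] by (simp add: D minor_def exdeg_alt tt_add)
  qed
  ultimately show ?thesis by (simp add: ktype_def)
qed

text \<open>Cartan decomposition reduces both matrices to dominant ones, and the type of
  \<open>dominant i j\<close> determines \<open>i\<close> and \<open>j\<close>. Thus values of
  \<open>f\<close> can be compared by computing degrees.\<close>

lemma ktype_keq:
  assumes "A \<in> Sp4 UNIV" "B \<in> Sp4 UNIV" "ktype A i m" "ktype B i m"
  shows "keq A B"
proof -
  obtain i1 j1 where 1: "0 \<le> j1" "j1 \<le> i1" "keq A (dominant i1 j1)" by (rule cartan_decomposition[OF assms(1)])
  obtain i2 j2 where 2: "0 \<le> j2" "j2 \<le> i2" "keq B (dominant i2 j2)" by (rule cartan_decomposition[OF assms(2)])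
  have "ktype A i1 (i1 + j1)" using keq_ktype[OF 1(3)] ktype_dominant[OF 1(1,2)] by simp
  moreover have "ktype B i2 (i2 + j2)" using keq_ktype[OF 2(3)] ktype_dominant[OF 2(1,2)] by simp
  ultimately have "i1 = i2" "j1 = j2"
    using ktype_unique[OF assms(3)] ktype_unique[OF assms(4)] by fastforce+
  then show ?thesis using 1(3) 2(3) keq_sym keq_trans by blast
qed

section \<open>Unipotent subgroups\<close>

text \<open>Polynomials in \<pi>^(-1) of degree less than \<open>n\<close>, a finite additive group
  over a finite field.\<close>

definition Pd :: "nat \<Rightarrow> 'k::field fls set" where
  "Pd n = {x. \<forall>m. fls_nth x m \<noteq> 0 \<longrightarrow> - int n < m \<and> m \<le> 0}"

lemma Pd_alt: "x \<in> Pd n \<longleftrightarrow> x \<in> polyinv \<and> x \<in> dg (int n - 1)"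
  unfolding Pd_def polyinv_def dg_iff mem_Collect_eq
proof safe
  fix m assume a: "\<forall>n>0. fls_nth x n = 0" "\<forall>m < - (int n - 1). fls_nth x m = 0" "fls_nth x m \<noteq> 0"
  show "- int n < m" using a(2)[rule_format, of m] a(3) by linarith
  show "m \<le> 0" using a(1)[rule_format, of m] a(3) by linarith
next
  fix m assume a: "\<forall>m. fls_nth x m \<noteq> 0 \<longrightarrow> - int n < m \<and> m \<le> 0"
  show "fls_nth x m = 0" if "0 < m" using a[rule_format, of m] that by linarith
  show "fls_nth x m = 0" if "m < - (int n - 1)" using a[rule_format, of m] that by linarith
qed

lemma Pd_poly: "x \<in> Pd n \<Longrightarrow> x \<in> polyinv" and Pd_dg: "x \<in> Pd n \<Longrightarrow> x \<in> dg (int n - 1)"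
  by (auto simp: Pd_alt)

lemma Pd_I: "x \<in> polyinv \<Longrightarrow> x \<in> dg m \<Longrightarrow> m \<le> int n - 1 \<Longrightarrow> x \<in> Pd n"
  using dg_mono[of x m "int n - 1"] by (simp add: Pd_alt)

lemma Pd_mono: "m \<le> n \<Longrightarrow> Pd m \<subseteq> Pd n" by (auto simp: Pd_def)

lemma Pd_add: "x \<in> Pd n \<Longrightarrow> y \<in> Pd n \<Longrightarrow> x + y \<in> Pd n"
  and Pd_diff: "x \<in> Pd n \<Longrightarrow> y \<in> Pd n \<Longrightarrow> x - y \<in> Pd n"
  and Pd_minus: "x \<in> Pd n \<Longrightarrow> - x \<in> Pd n"
  and Pd_0: "0 \<in> Pd n"
  using subring_setD[OF subring_polyinv] by (auto simp: Pd_alt intro: dg_add dg_diff dg_minus)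

lemma Pd_mult: "x \<in> Pd m \<Longrightarrow> y \<in> Pd n \<Longrightarrow> x * y \<in> Pd (m + n)"
  using subring_setD(5)[OF subring_polyinv] dg_mult'[of x "int m - 1" y "int n - 1" "int (m + n) - 1"]
  by (auto simp: Pd_alt)

lemma tt_poly: "0 \<le> n \<Longrightarrow> tt n \<in> polyinv" by (auto simp: polyinv_def tt_nth)

lemma tt_Pd: "0 \<le> k \<Longrightarrow> k < int n \<Longrightarrow> tt k \<in> Pd n" by (auto simp: Pd_def tt_nth)

lemma Pd_card: "finite (Pd n :: 'k::{field,finite} fls set) \<and> card (Pd n :: 'k fls set) = CARD('k) ^ n"
proof (induction n)
  case 0
  have "Pd 0 = {0 :: 'k fls}"
  proof -
    have "x = 0" if "x \<in> Pd 0" for x :: "'k fls"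
    proof (rule fls_eqI)
      fix m show "fls_nth x m = fls_nth 0 m" using that unfolding Pd_def by force
    qed
    then show ?thesis using Pd_0 by auto
  qed
  then show ?case by simp
next
  case (Suc n)
  define mo where "mo = (\<lambda>c :: 'k. fls_shift (int n) (fls_const c))"
  have mo: "fls_nth (mo c) m = (if m = - int n then c else 0)" for c m by (auto simp: mo_def)
  have "bij_betw (\<lambda>(c, x). mo c + x) (UNIV \<times> Pd n) (Pd (Suc n))"
  proof (rule bij_betw_byWitness[of _ "\<lambda>y. (fls_nth y (- int n), y - mo (fls_nth y (- int n)))"])
    have z: "fls_nth x (- int n) = 0" if "x \<in> Pd n" for x :: "'k fls" using that unfolding Pd_def by force
    show "\<forall>a\<in>UNIV \<times> Pd n. (fls_nth ((\<lambda>(c, x). mo c + x) a) (- int n),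
        (\<lambda>(c, x). mo c + x) a - mo (fls_nth ((\<lambda>(c, x). mo c + x) a) (- int n))) = a"
      by (auto simp: mo z)
    show "\<forall>a'\<in>Pd (Suc n). (\<lambda>(c, x). mo c + x) (fls_nth a' (- int n), a' - mo (fls_nth a' (- int n))) = a'" by auto
    show "(\<lambda>(c, x). mo c + x) ` (UNIV \<times> Pd n) \<subseteq> Pd (Suc n)"
    proof clarsimp
      fix c and x :: "'k fls" assume x: "x \<in> Pd n"
      have "mo c \<in> Pd (Suc n)" by (auto simp: Pd_def mo)
      then show "mo c + x \<in> Pd (Suc n)" using x Pd_mono[of n "Suc n"] by (intro Pd_add) auto
    qed
    show "(\<lambda>y. (fls_nth y (- int n), y - mo (fls_nth y (- int n)))) ` Pd (Suc n) \<subseteq> UNIV \<times> Pd n"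
    proof clarsimp
      fix y :: "'k fls" assume y: "y \<in> Pd (Suc n)"
      show "y - mo (fls_nth y (- int n)) \<in> Pd n"
        unfolding Pd_def mem_Collect_eq
      proof (intro allI impI)
        fix m assume m: "fls_nth (y - mo (fls_nth y (- int n))) m \<noteq> 0"
        then have "m \<noteq> - int n" "fls_nth y m \<noteq> 0" by (auto simp: mo split: if_splits)
        moreover then have "- int (Suc n) < m \<and> m \<le> 0" using y unfolding Pd_def by blast
        ultimately show "- int n < m \<and> m \<le> 0" by linarith
      qed
    qed
  qed
  then show ?case using Suc bij_betw_finite[of _ "UNIV \<times> Pd n" "Pd (Suc n)"] bij_betw_same_card[of _ "UNIV \<times> Pd n" "Pd (Suc n)"]
    by (metis card_cartesian_product finite_SigmaI finite power_Suc)
qed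

lemma Pd_subgroup: "add_subgroup (Pd n :: 'k::{field,finite} fls set)"
  using Pd_card[of n, where 'k = 'k] by (auto simp: add_subgroup_def intro: Pd_add Pd_diff Pd_0)

text \<open>The polynomial part in \<pi>^(-1). It is additive and the discarded part lies in \<pi>
  times the integers, so solutions of linear equations over the field can be rounded into the
  lattice with a controlled error.\<close>

definition polyp :: "'k::field fls \<Rightarrow> 'k fls" where
  "polyp x = Abs_fls (\<lambda>m. if m \<le> 0 then fls_nth x m else 0)"

lemma polyp_nth: "fls_nth (polyp x) m = (if m \<le> 0 then fls_nth x m else 0)"
  unfolding polyp_def
  by (rule nth_Abs_fls_ex_lower_bound) (auto intro!: exI[of _ "fls_subdegree x"])

lemma polyp_add: "polyp (x + y) = polyp x + polyp y"
  by (rule fls_eqI) (simp add: polyp_nth)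

lemma polyp_poly: "polyp x \<in> polyinv" by (simp add: polyinv_def polyp_nth)

lemma polyp_dg: "x \<in> dg n \<Longrightarrow> polyp x \<in> dg n" by (simp add: dg_iff polyp_nth)

lemma polyp_id: "x \<in> polyinv \<Longrightarrow> polyp x = x"
  by (rule fls_eqI) (auto simp: polyp_nth polyinv_def)

lemma polyp_frac: "polyp x - x \<in> dg (- 1)" by (simp add: dg_iff polyp_nth)

lemma polyp_small: "x \<in> dg (- 1) \<Longrightarrow> polyp x = 0"
  by (rule fls_eqI) (auto simp: polyp_nth dg_iff)

lemma exdeg_Pd_diff:
  assumes "d \<in> Pd n" "d \<notin> Pd m"
  obtains e where "exdeg d e" "int m \<le> e" "e \<le> int n - 1"
proof -
  have p: "d \<in> polyinv" "d \<in> dg (int n - 1)" using assms by (auto simp: Pd_alt)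
  then have "d \<notin> dg (int m - 1)" using assms(2) by (simp add: Pd_alt)
  then have "exdeg d (- fls_subdegree d)" "int m \<le> - fls_subdegree d" by (auto simp: exdeg_def dg_def)
  moreover have "- fls_subdegree d \<le> int n - 1" using p \<open>d \<notin> dg (int m - 1)\<close> by (auto simp: dg_def)
  ultimately show thesis using that by blast
qed

section \<open>Group laws of the two unipotent radicals, and the types of their elements\<close>

lemma siegel_mult: "siegel a b c ** siegel a' b' c' = siegel (a + a') (b + b') (c + c')"
  by (simp add: siegel_def row4_calc add.commute)

lemma heis_mult: "heis x y z ** heis x' y' z' = heis (x + x') (y + y') (z + z' + x * y' - y * x')"
  by (simp add: heis_def row4_calc algebra_simps)

lemma siegel_0: "siegel 0 0 0 = mat 1" by (simp add: siegel_def mat_1_row4)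
lemma heis_0: "heis 0 0 0 = mat 1" by (simp add: heis_def mat_1_row4)

lemma siegel_eq_iff: "siegel a b c = siegel a' b' c' \<longleftrightarrow> a = a' \<and> b = b' \<and> c = c'"
  by (auto simp: siegel_def)
lemma heis_eq_iff: "heis x y z = heis x' y' z' \<longleftrightarrow> x = x' \<and> y = y' \<and> z = z'"
  by (auto simp: heis_def)

lemma siegel_Gam: "a \<in> polyinv \<Longrightarrow> b \<in> polyinv \<Longrightarrow> c \<in> polyinv \<Longrightarrow> siegel a b c \<in> Gam"
  by (rule Sp4_generators(2)[OF subring_polyinv])
lemma heis_Gam: "a \<in> polyinv \<Longrightarrow> b \<in> polyinv \<Longrightarrow> c \<in> polyinv \<Longrightarrow> heis a b c \<in> Gam"
  by (rule Sp4_generators(1)[OF subring_polyinv])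

lemma ginv_siegel: "siegel a b c \<in> Gam \<Longrightarrow> ginv (siegel a b c) = siegel (-a) (-b) (-c)"
  by (rule ginv_unique) (simp_all add: siegel_mult siegel_0)
lemma ginv_heis: "heis a b c \<in> Gam \<Longrightarrow> ginv (heis a b c) = heis (-a) (-b) (-c)"
  by (rule ginv_unique) (simp_all add: heis_mult heis_0)

text \<open>Completing the square: conjugation by an integral unipotent matrix turns the quadratic
  form (a, b, c) into the diagonal form with coefficients \<open>a\<close> and c - b^2 / a.\<close>

lemma ktype_siegel:
  assumes N: "0 \<le> \<kappa>" "\<kappa> \<le> N" and a: "exdeg a N" and b: "b \<in> dg N" and c: "exdeg (c - b * b / a) \<kappa>"
  shows "ktype (siegel a b c) N (N + \<kappa>)"
proof -
  have a0: "a \<noteq> 0" using a by (simp add: exdeg_def)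
  define x where "x = - (b / a)"
  have xO: "x \<in> intO" using exdeg_divide[OF b a] by (auto simp: x_def intO_eq intro: dg_minus)
  have z: "0 \<in> intO" using subring_setD(1)[OF subring_intO] .
  define L where "L = transpose (heis x 0 0)"
  define L' where "L' = transpose (heis (- x) 0 0)"
  have K: "L \<in> Kcpt" "L' \<in> Kcpt" unfolding L_def L'_def
    using xO z subring_setD(3)[OF subring_intO xO] by (auto intro!: Sp4_transpose Sp4_generators(1)[OF subring_intO])
  have Lr: "L = row4 (row4 1 0 0 0) (row4 x 1 0 0) (row4 0 0 1 0) (row4 0 0 (- x) 1)"
    "L' = row4 (row4 1 0 0 0) (row4 (- x) 1 0 0) (row4 0 0 1 0) (row4 0 0 x 1)"
    by (simp_all add: L_def L'_def heis_def transpose_def vec_eq_iff forall_4')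
  define \<delta> where "\<delta> = c - b * b / a"
  have ax: "a * x = - b" using a0 by (simp add: x_def)
  have bx: "b * x = - (b * b / a)" by (simp add: x_def)
  have "L ** siegel a b c ** L' = siegel a 0 \<delta>"
    by (simp add: Lr siegel_def row4_calc ax bx \<delta>_def algebra_simps)
  then have k: "keq (siegel a b c) (siegel a 0 \<delta>)" using keq_mult[OF K, of "siegel a b c"] by simp
  have ad: "a \<in> dg N" "a \<notin> dg (N - 1)" and dd: "\<delta> \<in> dg \<kappa>" using a c by (auto simp: exdeg_alt \<delta>_def)
  let ?D = "siegel a 0 \<delta>"
  have "ent N ?D" unfolding ent_def using N ad dg_mono[OF dd N(2)] by (simp add: siegel_def forall_4' dg_1)
  moreover have "\<not> ent (N - 1) ?D"
  proof
    assume "ent (N - 1) ?D"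
    then have "?D$0$3 \<in> dg (N - 1)" by (simp add: ent_def)
    then show False using ad by (simp add: siegel_def)
  qed
  moreover have "mnr (N + \<kappa>) ?D"
  proof (rule mnr_from_weights)
    let ?r = "\<lambda>k::4. if k = 0 then N else if k = 1 then \<kappa> else 0"
    have "\<forall>k l. ?D$k$l \<in> dg (?r k + 0)" unfolding siegel_def using N ad dd by (simp add: forall_4' dg_1)
    then show "?D$k$l \<in> dg (?r k + (\<lambda>_. 0) l)" for k l by blast
    show "?r k + ?r k' + (\<lambda>_. 0) l + (\<lambda>_. 0) l' \<le> N + \<kappa>" if "k \<noteq> k'" for k k' l l'
      using that N by auto
  qed
  moreover have "\<not> mnr (N + \<kappa> - 1) ?D"
  proof
    assume "mnr (N + \<kappa> - 1) ?D"
    then have "minor ?D 0 1 2 3 \<in> dg (N + \<kappa> - 1)" by (simp add: mnr_def)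
    moreover have "exdeg (minor ?D 0 1 2 3) (N + \<kappa>)"
      using exdeg_minus[OF exdeg_mult[OF a c]] by (simp add: minor_def siegel_def \<delta>_def)
    ultimately show False by (simp add: exdeg_alt)
  qed
  ultimately have "ktype ?D N (N + \<kappa>)" by (simp add: ktype_def)
  then show ?thesis using keq_ktype[OF k] by simp
qed

text \<open>The entry \<open>z\<close> dominates all others, in particular \<open>w\<close> of
  degree X + s. Among the minors y w - z, in rows 0, 1 and columns 2, 3, dominates, and its degree 2
  X + s comes from y w because \<kappa> < 2 X. The bound on \<open>x\<close> prevents it from
  cancelling the leading term of \<open>w\<close>.\<close>

lemma ktype_heis:
  assumes s: "s = 0 \<or> s = 1" and X: "1 \<le> X" and x: "x \<in> dg (X - 1)" and y: "exdeg y X"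
    and z: "exdeg z \<kappa>" "X + s \<le> \<kappa>" "\<kappa> \<le> 2 * X - 1"
  shows "ktype (mid (tt s) 1 (- 1) 0 ** heis x y z) \<kappa> (2 * X + s)"
proof -
  define w where "w = tt s * y - x"
  have ew: "exdeg w (X + s)"
    using exdeg_add[OF exdeg_mult[OF tt_ex[of s] y], of "- x"] s dg_mono[OF dg_minus[OF x], of "s + X - 1"]
    by (auto simp: w_def add.commute)
  let ?D = "mid (tt s) 1 (- 1) 0 ** heis x y z"
  have D: "?D = row4 (row4 1 x y z) (row4 0 (tt s) 1 w) (row4 0 (- 1) 0 (- y)) (row4 0 0 0 1)"
    by (simp add: mid_def heis_def row4_calc w_def)
  have d: "x \<in> dg n" if "X - 1 \<le> n" for n using x that dg_mono by blast
  have yd: "y \<in> dg n" if "X \<le> n" for n using y that dg_mono by (auto simp: exdeg_alt)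
  have zd: "z \<in> dg n" if "\<kappa> \<le> n" for n using z that dg_mono by (auto simp: exdeg_alt)
  have wd: "w \<in> dg n" if "X + s \<le> n" for n using ew that dg_mono by (auto simp: exdeg_alt)
  have m1: "- 1 \<in> dg n" "- y \<in> dg m" if "0 \<le> n" "X \<le> m" for n m using that yd dg_1 dg_minus by blast+
  have "ent \<kappa> ?D" unfolding ent_def D using s X z(2,3)
    by (auto simp: forall_4' intro!: dg_1 d yd zd wd tt_dg m1)
  moreover have "\<not> ent (\<kappa> - 1) ?D"
  proof
    assume "ent (\<kappa> - 1) ?D"
    then have "?D$0$3 \<in> dg (\<kappa> - 1)" by (simp add: ent_def)
    then show False using z(1) by (simp add: D exdeg_alt)
  qed
  moreover have "mnr (2 * X + s) ?D"
  proof (rule mnr_from_weights)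
    let ?r = "\<lambda>k::4. if k = 0 then X else if k = 1 then s else if k = 2 then 0 else - X"
    let ?c = "\<lambda>k::4. if k = 0 then - X else if k = 3 then X else 0"
    have "\<forall>k l. ?D$k$l \<in> dg (?r k + ?c l)" unfolding D using s X z(2,3)
      by (auto simp: forall_4' intro!: dg_1 d yd zd wd tt_dg m1)
    then show "?D$k$l \<in> dg (?r k + ?c l)" for k l by blast
    show "?r k + ?r k' + ?c l + ?c l' \<le> 2 * X + s" if "k \<noteq> k'" "l \<noteq> l'" for k k' l l'
      using that X s by auto
  qed
  moreover have "\<not> mnr (2 * X + s - 1) ?D"
  proof
    assume "mnr (2 * X + s - 1) ?D"
    then have "minor ?D 0 1 2 3 \<in> dg (2 * X + s - 1)" by (simp add: mnr_def)
    moreover have "exdeg (y * w + (- z)) (X + (X + s))"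
      using s z(2,3) by (intro exdeg_add exdeg_mult y ew dg_minus zd) auto
    ultimately show False by (simp add: D minor_def exdeg_alt algebra_simps)
  qed
  ultimately show ?thesis by (simp add: ktype_def)
qed

section \<open>Elementary moves\<close>

definition K_invariant :: "('k::field fls ^4^4 \<Rightarrow> complex) \<Rightarrow> bool" where
  "K_invariant f \<longleftrightarrow> (\<forall>g\<in>Gam. \<forall>h\<in>Gam. keq g h \<longrightarrow> f g = f h)"

lemma Gam_UNIV: "g \<in> Gam \<Longrightarrow> g \<in> Sp4 UNIV" by (simp add: Sp4_def)

lemma K_invariant_ktype:
  "K_invariant f \<Longrightarrow> g \<in> Gam \<Longrightarrow> h \<in> Gam \<Longrightarrow> ktype g i m \<Longrightarrow> ktype h i m \<Longrightarrow> f g = f h"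
  unfolding K_invariant_def using ktype_keq Gam_UNIV by blast

lemma polyinv_simps:
  "0 \<in> polyinv" "1 \<in> polyinv" "x \<in> polyinv \<Longrightarrow> - x \<in> polyinv" "x \<in> polyinv \<Longrightarrow> y \<in> polyinv \<Longrightarrow> x + y \<in> polyinv"
  "x \<in> polyinv \<Longrightarrow> y \<in> polyinv \<Longrightarrow> x * y \<in> polyinv" "x \<in> polyinv \<Longrightarrow> y \<in> polyinv \<Longrightarrow> x - y \<in> polyinv"
  using subring_setD[OF subring_polyinv] by auto

lemma exdeg_monic_diff: "exdeg (tt k - tt (k - 1) :: 'k::field fls) k"
  using exdeg_add[OF tt_ex[of k] dg_minus[OF tt_dg[of "k - 1" "k - 1"]]] by simp

lemma exdeg_cosets:
  assumes w: "w \<in> Pd (k - 1)" and k: "1 \<le> k" and e: "e = int k \<or> e = int k - 1"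
  shows "exdeg (tt e + w) e"
  using exdeg_add[OF tt_ex[of e] dg_mono[OF Pd_dg[OF w]]] e k by auto

lemma monic_diff_notin: "1 \<le> k \<Longrightarrow> tt (int k) - tt (int k - 1) \<notin> (Pd (k - 1) :: 'k::field fls set)"
proof
  assume k: "1 \<le> k" and "tt (int k) - tt (int k - 1) \<in> (Pd (k - 1) :: 'k fls set)"
  then have "tt (int k) - tt (int k - 1) \<in> (dg (int (k - 1) - 1) :: 'k fls set)" by (rule_tac Pd_dg)
  then have "tt (int k) - tt (int k - 1) \<in> (dg (int k - 1) :: 'k fls set)" by (rule dg_mono) (use k in auto)
  then show False using exdeg_monic_diff[of "int k", where 'k = 'k] by (simp add: exdeg_alt)
qed

text \<open>Here the support is the thickened parabola \<open>c = \<pi>\<^sup>N b\<^sup>2\<close> inside the coset \<open>a = \<pi>\<^bsup>-N\<^esup>\<close> of the Siegel radical, with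
  \<open>\<pi>\<^sup>N b\<^sup>2\<close> truncated to its polynomial part. A difference \<open>d\<close> of two values of \<open>b\<close> acts on the coordinate \<open>c\<close>
  through \<open>2 \<pi>\<^sup>N d b\<close>, which for \<open>d\<close> of degree at least \<open>k\<close> equidistributes the two cosets being compared.\<close>

theorem siegel_move:
  fixes f :: "'k::{finite,field} fls ^4^4 \<Rightarrow> complex"
  assumes f: "K_invariant f" and two: "(2::'k) \<noteq> 0" and p: "p > 2" and k: "1 \<le> k" "k \<le> N"
    and g: "g \<in> Gam" "ktype g (int N) (int N + int k)" and h: "h \<in> Gam" "ktype h (int N) (int N + (int k - 1))"
  defines "q \<equiv> real CARD('k)"
  shows "ereal (cmod (f g - f h)) \<le>
    ereal (sep_const p (2 * sqrt (q ^ k / q ^ (N + 1))) (q ^ (2 * N + 2) * (2 / (q ^ (N + 1) * q ^ (k - 1))))) * mult_norm p f"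
proof -
  define S :: "'k fls set" where "S = Pd (N + 1)"
  define W :: "'k fls set" where "W = Pd (k - 1)"
  define H where "H = (\<lambda>(b, c). siegel 0 b c :: 'k fls ^4^4) ` (S \<times> S)"
  define sq where "sq = (\<lambda>b :: 'k fls. b * b * tt (- int N))"
  define \<sigma> where "\<sigma> = (\<lambda>b. siegel (tt (int N)) b (polyp (sq b)))"
  define \<zeta> where "\<zeta> = (\<lambda>z. siegel 0 0 z :: 'k fls ^4^4)"
  define Y where "Y = (\<lambda>h. siegel (tt (int N)) 0 0 ** h) ` H"
  have cS: "card S = CARD('k) ^ (N + 1)" "finite S" and cW: "card W = CARD('k) ^ (k - 1)"
    using Pd_card[of "N + 1", where 'k = 'k] Pd_card[of "k - 1", where 'k = 'k] by (simp_all add: S_def W_def)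
  have Sp: "b \<in> polyinv" "b \<in> dg (int N)" if "b \<in> S" for b
    using that Pd_poly Pd_dg[of b "N + 1"] by (auto simp: S_def)
  have SI: "b \<in> S" if "b \<in> polyinv" "b \<in> dg (int N)" for b
    using that Pd_I[of b "int N" "N + 1"] by (simp add: S_def)
  have H: "fin_subgroup H"
    unfolding fin_subgroup_def
  proof (intro conjI ballI subsetI)
    show "finite H" using cS(2) by (simp add: H_def)
    show "g \<in> Gam" if "g \<in> H" for g using that Sp by (auto simp: H_def intro!: siegel_Gam polyinv_simps)
    show "mat 1 \<in> H" unfolding H_def siegel_0[symmetric] using Pd_0 by (auto simp: S_def)
    show "g ** h \<in> H" if "g \<in> H" "h \<in> H" for g h
      using that unfolding H_def S_def by (auto simp: siegel_mult intro!: Pd_add image_eqI[of _ _ "(_, _)"])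
    show "ginv g \<in> H" if gH: "g \<in> H" for g
    proof -
      obtain b c where bc: "g = siegel 0 b c" "b \<in> S" "c \<in> S" using gH by (auto simp: H_def)
      have "ginv g = siegel 0 (- b) (- c)" using ginv_siegel[OF siegel_Gam, of 0 b c] bc Sp polyinv_simps by simp
      then show ?thesis using bc unfolding H_def S_def by (auto intro!: Pd_minus image_eqI[of _ _ "(_, _)"])
    qed
  qed
  have cH: "card H = CARD('k) ^ (2 * N + 2)"
  proof -
    have "inj_on (\<lambda>(b, c). siegel 0 b c :: 'k fls ^4^4) (S \<times> S)" by (auto simp: inj_on_def siegel_eq_iff)
    then have "card H = card (S \<times> S)" by (simp add: H_def card_image)
    then show ?thesis by (simp add: card_cartesian_product cS flip: power_add) (simp add: mult_2)
  qed
  have ttN: "tt (int N) \<in> (polyinv :: 'k fls set)" by (simp add: tt_poly)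
  have sqd: "sq b \<in> dg (int N)" if "b \<in> S" for b
    unfolding sq_def using Sp(2)[OF that] by (intro dg_mult'[OF dg_mult[OF _ _] tt_dg[OF order_refl]]) auto
  have psq: "polyp (sq b) \<in> S" if "b \<in> S" for b by (rule SI[OF polyp_poly polyp_dg[OF sqd[OF that]]])
  have \<sigma>G: "\<sigma> b \<in> Gam" if "b \<in> S" for b unfolding \<sigma>_def using that by (intro siegel_Gam ttN Sp polyp_poly)
  have \<sigma>\<zeta>: "\<sigma> b ** \<zeta> z = siegel (tt (int N)) b (polyp (sq b) + z)" for b z by (simp add: \<sigma>_def \<zeta>_def siegel_mult)
  have ttS: "tt (int k) \<in> S" "tt (int k - 1) \<in> S" unfolding S_def using k by (auto intro!: tt_Pd)
  have WS: "W \<subseteq> S" unfolding W_def S_def using k by (intro Pd_mono) auto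
  have val: "f (\<sigma> b ** \<zeta> (tt e + w)) = f g'"
    if "b \<in> S" "w \<in> W" "e = int k \<or> e = int k - 1" "g' \<in> Gam" "ktype g' (int N) (int N + e)" for b w e g'
  proof (rule K_invariant_ktype[OF f _ that(4) _ that(5)])
    have ttw: "tt e + w \<in> S" using that ttS WS unfolding S_def by (auto intro: Pd_add)
    show "\<sigma> b ** \<zeta> (tt e + w) \<in> Gam" unfolding \<sigma>\<zeta> using that ttw psq by (intro siegel_Gam ttN Sp polyinv_simps)
    \<comment> \<open>The rounding error has degree at most -1, hence below \<open>e\<close> even in
      the extreme case k = 1, e = 0.\<close>
    have "exdeg (tt e + w + (polyp (sq b) - sq b)) e"
    proof (rule exdeg_add)
      show "exdeg (tt e + w) e" using that k by (intro exdeg_cosets) (auto simp: W_def)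
      show "polyp (sq b) - sq b \<in> dg (e - 1)" using polyp_frac by (rule dg_mono) (use that k in auto)
    qed
    moreover have "b * b / tt (int N) = sq b" by (simp add: sq_def divide_inverse tt_inv)
    ultimately have "exdeg (polyp (sq b) + (tt e + w) - b * b / tt (int N)) e" by (simp add: algebra_simps)
    then show "ktype (\<sigma> b ** \<zeta> (tt e + w)) (int N) (int N + e)"
      unfolding \<sigma>\<zeta> using that k Sp(2)[OF that(1)] by (intro ktype_siegel tt_ex) auto
  qed
  have "ereal (cmod (f g - f h)) \<le>
    ereal (sep_const p (2 * sqrt (card (Pd k :: 'k fls set) / card S)) (card H * (2 / (card S * card W)))) * mult_norm p f"
  proof (rule multiplier_difference_bound[where \<sigma> = \<sigma> and \<zeta> = \<zeta> and Z = S and ?z1.0 = "tt (int k)" and ?z2.0 = "tt (int k - 1)", OF H _ Y_def _ _ _ WS ttS])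
    show "siegel (tt (int N)) 0 (0 :: 'k fls) \<in> Gam" by (intro siegel_Gam ttN polyinv_simps)
    show "add_subgroup S" "add_subgroup S" "add_subgroup W" unfolding S_def W_def by (rule Pd_subgroup)+
    show "\<zeta> z \<in> Gam" if "z \<in> S" for z unfolding \<zeta>_def using that by (intro siegel_Gam Sp polyinv_simps)
    show "\<zeta> (x + y) = \<zeta> x ** \<zeta> y" for x y by (simp add: \<zeta>_def siegel_mult)
    show "\<sigma> b ** \<zeta> z \<in> Y" if "b \<in> S" "z \<in> S" for b z
    proof -
      have "\<sigma> b ** \<zeta> z = siegel (tt (int N)) 0 0 ** siegel 0 b (polyp (sq b) + z)" by (simp add: \<sigma>\<zeta> siegel_mult)
      moreover have "siegel 0 b (polyp (sq b) + z) \<in> H"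
        unfolding H_def using that psq[OF that(1)] Pd_add[of "polyp (sq b)" "N + 1" z]
        by (auto simp: S_def intro!: image_eqI[of _ _ "(_, _)"])
      ultimately show ?thesis by (auto simp: Y_def)
    qed
    show "b = b' \<and> z = z'" if "\<sigma> b ** \<zeta> z = \<sigma> b' ** \<zeta> z'" for b z b' z'
      using that by (auto simp: \<sigma>\<zeta> siegel_eq_iff)
    show "tt (int k) - tt (int k - 1) \<notin> W" unfolding W_def by (rule monic_diff_notin[OF k(1)])
    show "Pd k \<subseteq> S" unfolding S_def using k by (intro Pd_mono) auto
    show "Pd k \<noteq> ({} :: 'k fls set)" using Pd_0 by blast
    show "\<exists>g\<in>Gam. \<exists>L. \<exists>s0\<in>S. L s0 + tt (int k - 1) - tt (int k) \<in> W \<and>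
        (\<forall>s\<in>S. L s \<in> S \<and> L (s + s0) = L s + L s0 \<and> ginv (\<sigma> s) ** \<sigma> (s + d) = g ** \<zeta> (L s))"
      if d: "d \<in> S - Pd k" for d
    proof -
      obtain e where e: "exdeg d e" "int k \<le> e" "e \<le> int N"
        using exdeg_Pd_diff[of d "N + 1" k] d by (auto simp: S_def)
      define L where "L = (\<lambda>s. polyp (2 * s * d * tt (- int N)))"
      \<comment> \<open>The exact solution of 2 y d \<pi>^N = \<pi>^(-k) - \<pi>^(-(k-1)), where
        division by 2 is needed. As \<open>d\<close> has degree at least \<open>k\<close>,
        \<open>y\<close> has degree at most \<open>N\<close>; as \<open>d\<close> has degree at most
        \<open>N\<close>, rounding \<open>y\<close> changes the left side only by terms of negative
        degree, which \<open>polyp\<close> removes.\<close>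
      define y where "y = (tt (int k) - tt (int k - 1)) * tt (int N) / (2 * d)"
      have d0: "d \<noteq> 0" using e by (simp add: exdeg_def)
      have two': "(2 :: 'k fls) \<noteq> 0"
      proof
        assume "(2 :: 'k fls) = 0"
        then have "fls_nth (2 :: 'k fls) 0 = 0" by simp
        then show False using two by simp
      qed
      have e2: "exdeg (2 :: 'k fls) 0" using two' by (simp add: exdeg_def)
      have e2d: "exdeg (2 * d) e" using exdeg_mult[OF e2 e(1)] by simp
      have "(tt (int k) - tt (int k - 1)) * tt (int N) \<in> (dg (int k + int N) :: 'k fls set)"
        using exdeg_monic_diff[of "int k", where 'k = 'k] by (intro dg_mult tt_dg) (auto simp: exdeg_alt)
      then have yd: "y \<in> dg (int k + int N - e)" unfolding y_def by (rule exdeg_divide[OF _ e2d])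
      have s0: "polyp y \<in> S" using dg_mono[OF yd, of "int N"] e by (intro SI polyp_poly polyp_dg) auto
      have "2 * polyp y * d * tt (- int N) = (tt (int k) - tt (int k - 1)) + (polyp y - y) * (2 * d) * tt (- int N)"
      proof -
        have "y * (2 * d) * tt (- int N) = (tt (int k) - tt (int k - 1)) * (tt (int N) * tt (- int N))"
          using d0 two' by (simp add: y_def)
        then have "y * (2 * d) * tt (- int N) = tt (int k) - tt (int k - 1)" by (simp add: tt_add)
        then show ?thesis by (simp add: algebra_simps)
      qed
      moreover have "(polyp y - y) * (2 * d) * tt (- int N) \<in> dg (- 1)"
        using e e2d by (intro dg_mult'[OF dg_mult[OF polyp_frac] tt_dg[OF order_refl]]) (auto simp: exdeg_alt)
      ultimately have "L (polyp y) = polyp (tt (int k) - tt (int k - 1))"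
        unfolding L_def by (simp add: polyp_add polyp_small)
      also have "\<dots> = tt (int k) - tt (int k - 1)" using k by (intro polyp_id polyinv_simps tt_poly) auto
      finally have Ls0: "L (polyp y) + tt (int k - 1) - tt (int k) \<in> W" using Pd_0 by (simp add: W_def)
      have "L s \<in> S \<and> L (s + polyp y) = L s + L (polyp y) \<and> ginv (\<sigma> s) ** \<sigma> (s + d) = siegel 0 d (polyp (sq d)) ** \<zeta> (L s)"
        if s: "s \<in> S" for s
      proof (intro conjI)
        have "2 * s * d * tt (- int N) \<in> dg (int N)"
          using Sp(2)[OF s] Sp(2)[of d] d e2
          by (intro dg_mult'[OF dg_mult[OF dg_mult] tt_dg[OF order_refl]]) (auto simp: exdeg_alt)
        then show "L s \<in> S" unfolding L_def by (intro SI polyp_poly polyp_dg)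
        show "L (s + polyp y) = L s + L (polyp y)"
          unfolding L_def polyp_add[symmetric] by (simp add: algebra_simps)
        have "sq (s + d) = sq s + (sq d + 2 * s * d * tt (- int N))" by (simp add: sq_def algebra_simps)
        then have "polyp (sq (s + d)) = polyp (sq s) + (polyp (sq d) + L s)" by (simp add: L_def polyp_add)
        then show "ginv (\<sigma> s) ** \<sigma> (s + d) = siegel 0 d (polyp (sq d)) ** \<zeta> (L s)"
          using \<sigma>G[OF s] by (simp add: \<sigma>_def \<zeta>_def ginv_siegel siegel_mult)
      qed
      moreover have "siegel 0 d (polyp (sq d)) \<in> Gam" using d by (intro siegel_Gam polyinv_simps Sp polyp_poly) auto
      ultimately show ?thesis using s0 Ls0 by blast
    qed
    show "f (\<sigma> s ** \<zeta> (tt (int k) + w)) = f g" if "s \<in> S" "w \<in> W" for s w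
      using val[OF that, of "int k" g] g by simp
    show "f (\<sigma> s ** \<zeta> (tt (int k - 1) + w)) = f h" if "s \<in> S" "w \<in> W" for s w
      using val[OF that, of "int k - 1" h] h by simp
  qed (use \<sigma>G p in auto)
  then show ?thesis using Pd_card[of k, where 'k = 'k] by (simp add: cS cW cH q_def)
qed

text \<open>The factor \<open>mid (tt s) 1 (- 1) 0\<close> shifts the degree of the minors by \<open>s\<close>; without it only even values of
  \<open>i + j\<close> would be reached.\<close>

theorem heis_move:
  fixes f :: "'k::{finite,field} fls ^4^4 \<Rightarrow> complex"
  assumes f: "K_invariant f" and p: "p > 2" and s: "s = 0 \<or> s = 1" and k: "X + s + 1 \<le> k" "k + 1 \<le> 2 * X"
    and g: "g \<in> Gam" "ktype g (int k) (2 * int X + int s)"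
    and h: "h \<in> Gam" "ktype h (int k - 1) (2 * int X + int s)"
  defines "q \<equiv> real CARD('k)"
  shows "ereal (cmod (f g - f h)) \<le>
    ereal (sep_const p (2 * sqrt (q ^ (k + 1) / q ^ (2 * X))) (q ^ (4 * X) * (2 / (q ^ (2 * X) * q ^ (k - 1))))) * mult_norm p f"
proof -
  define P :: "'k fls set" where "P = Pd X"
  define Z :: "'k fls set" where "Z = Pd (2 * X)"
  define S where "S = P \<times> P"
  define W :: "'k fls set" where "W = Pd (k - 1)"
  \<comment> \<open>Differences whose first coordinate has degree at most k - X are too short to
    realise the shift between the two cosets.\<close>
  define D :: "('k fls \<times> 'k fls) set" where "D = Pd (k + 1 - X) \<times> P"
  define T :: "'k fls" where "T = tt (int X)"
  define m where "m = (mid (tt (int s)) 1 (- 1) 0 :: 'k fls ^4^4)"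
  define H where "H = (\<lambda>(x, y, z). heis x y z :: 'k fls ^4^4) ` (P \<times> P \<times> Z)"
  define \<sigma> where "\<sigma> = (\<lambda>(x, y). m ** heis x (T + y) 0)"
  define \<zeta> where "\<zeta> = (\<lambda>z. heis 0 0 z :: 'k fls ^4^4)"
  define g0 where "g0 = m ** heis 0 T 0"
  define Y where "Y = (\<lambda>h. g0 ** h) ` H"
  have X: "X \<ge> 1" using k by linarith
  have cP: "card P = CARD('k) ^ X" "finite P" and cZ: "card Z = CARD('k) ^ (2 * X)" "finite Z"
    and cW: "card W = CARD('k) ^ (k - 1)"
    using Pd_card[of X, where 'k = 'k] Pd_card[of "2 * X", where 'k = 'k] Pd_card[of "k - 1", where 'k = 'k]
    by (simp_all add: P_def Z_def W_def)
  have cS: "card S = CARD('k) ^ (2 * X)" by (simp add: S_def card_cartesian_product cP mult_2 flip: power_add)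
  have cD: "card D = CARD('k) ^ (k + 1)"
    using Pd_card[of "k + 1 - X", where 'k = 'k] k by (simp add: D_def card_cartesian_product cP flip: power_add)
  have Pp: "x \<in> polyinv" "x \<in> dg (int X - 1)" if "x \<in> P" for x
    using that Pd_poly Pd_dg[of x X] by (auto simp: P_def)
  have Zp: "x \<in> polyinv" if "x \<in> Z" for x using that Pd_poly by (auto simp: Z_def)
  have Pm: "x * y \<in> Z" if "x \<in> P" "y \<in> P" for x y using Pd_mult[of x X y X] that by (simp add: P_def Z_def mult_2)
  have Tp: "T \<in> polyinv" by (simp add: T_def tt_poly)
  have TZ: "T * x \<in> Z" if "x \<in> P" for x
    using Pp[OF that] tt_dg[of "int X" "int X"] unfolding Z_def T_def
    by (intro Pd_I[OF _ dg_mult] polyinv_simps tt_poly) auto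
  have mG: "m \<in> Gam" unfolding m_def
    by (intro Sp4_generators(3)[OF subring_polyinv] polyinv_simps tt_poly) auto
  have H: "fin_subgroup H"
    unfolding fin_subgroup_def
  proof (intro conjI ballI subsetI)
    show "finite H" using cP(2) cZ(2) by (simp add: H_def)
    show "g \<in> Gam" if "g \<in> H" for g using that Pp Zp by (auto simp: H_def intro!: heis_Gam)
    show "mat 1 \<in> H" unfolding H_def heis_0[symmetric] using Pd_0 by (auto simp: P_def Z_def intro!: image_eqI[of _ _ "(0, 0, 0)"])
    show "g ** h \<in> H" if gh: "g \<in> H" "h \<in> H" for g h
    proof -
      obtain x y z x' y' z' where 1: "g = heis x y z" "x \<in> P" "y \<in> P" "z \<in> Z"
        and 2: "h = heis x' y' z'" "x' \<in> P" "y' \<in> P" "z' \<in> Z" using gh by (auto simp: H_def)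
      have "z + z' + x * y' - y * x' \<in> Z" using 1 2 Pm unfolding Z_def by (intro Pd_add Pd_diff) auto
      moreover have "x + x' \<in> P" "y + y' \<in> P" using 1 2 unfolding P_def by (auto intro: Pd_add)
      ultimately show ?thesis unfolding H_def 1 2 heis_mult
        by (intro image_eqI[of _ _ "(x + x', y + y', z + z' + x * y' - y * x')"]) auto
    qed
    show "ginv g \<in> H" if gH: "g \<in> H" for g
    proof -
      obtain x y z where 1: "g = heis x y z" "x \<in> P" "y \<in> P" "z \<in> Z" using gH by (auto simp: H_def)
      have "ginv g = heis (- x) (- y) (- z)" unfolding 1(1) using 1 Pp Zp by (intro ginv_heis heis_Gam)
      then show ?thesis using 1 unfolding H_def P_def Z_def
        by (intro image_eqI[of _ _ "(- x, - y, - z)"]) (auto intro: Pd_minus)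
    qed
  qed
  have cH: "card H = CARD('k) ^ (4 * X)"
  proof -
    have "inj_on (\<lambda>(x, y, z). heis x y z :: 'k fls ^4^4) (P \<times> P \<times> Z)" by (auto simp: inj_on_def heis_eq_iff)
    then have "card H = card (P \<times> P \<times> Z)" by (simp add: H_def card_image)
    then show ?thesis by (simp add: card_cartesian_product cP cZ flip: power_add)
  qed
  have \<sigma>\<zeta>: "\<sigma> (x, y) ** \<zeta> z = m ** heis x (T + y) z" for x y z
    by (simp add: \<sigma>_def \<zeta>_def heis_mult flip: matrix_mul_assoc)
  have \<sigma>G: "\<sigma> s \<in> Gam" if "s \<in> S" for s
    using that Pp unfolding S_def \<sigma>_def by (auto intro!: Gam_mult mG heis_Gam polyinv_simps Tp)
  have ttZ: "tt (int k) \<in> Z" "tt (int k - 1) \<in> Z" unfolding Z_def using k by (auto intro!: tt_Pd)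
  have WZ: "W \<subseteq> Z" unfolding W_def Z_def using k by (intro Pd_mono) auto
  have val: "f (\<sigma> (x, y) ** \<zeta> (tt e + w)) = f g'"
    if "x \<in> P" "y \<in> P" "w \<in> W" "e = int k \<or> e = int k - 1" "g' \<in> Gam" "ktype g' e (2 * int X + int s)" for x y w e g'
  proof (rule K_invariant_ktype[OF f _ that(5) _ that(6)])
    have ttw: "tt e + w \<in> Z" using that ttZ WZ unfolding Z_def by (auto intro: Pd_add)
    show "\<sigma> (x, y) ** \<zeta> (tt e + w) \<in> Gam" unfolding \<sigma>\<zeta> using that
      by (intro Gam_mult mG heis_Gam Zp[OF ttw] polyinv_simps(4)[OF Tp] Pp)
    have "exdeg (tt e + w) e" using that k X by (intro exdeg_cosets) (auto simp: W_def)
    moreover have "exdeg (T + y) (int X)" unfolding T_def using Pp(2)[OF that(2)] by (intro exdeg_add tt_ex)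
    ultimately show "ktype (\<sigma> (x, y) ** \<zeta> (tt e + w)) e (2 * int X + int s)"
      unfolding \<sigma>\<zeta> m_def using that k s X Pp(2)[OF that(1)] by (intro ktype_heis) auto
  qed
  have "ereal (cmod (f g - f h)) \<le>
    ereal (sep_const p (2 * sqrt (card D / card S)) (card H * (2 / (card S * card W)))) * mult_norm p f"
  proof (rule multiplier_difference_bound[where \<sigma> = \<sigma> and \<zeta> = \<zeta> and Z = Z and ?z1.0 = "tt (int k)" and ?z2.0 = "tt (int k - 1)", OF H _ Y_def _ _ _ WZ ttZ])
    show "g0 \<in> Gam" unfolding g0_def by (intro Gam_mult mG heis_Gam polyinv_simps Tp)
    show "add_subgroup S"
      using Pd_subgroup[of X, where 'k = 'k] by (auto simp: S_def P_def add_subgroup_def zero_prod_def)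
    show "add_subgroup Z" "add_subgroup W" unfolding Z_def W_def by (rule Pd_subgroup)+
    show "\<zeta> z \<in> Gam" if "z \<in> Z" for z unfolding \<zeta>_def using that by (intro heis_Gam Zp polyinv_simps)
    show "\<zeta> (x + y) = \<zeta> x ** \<zeta> y" for x y by (simp add: \<zeta>_def heis_mult)
    show "\<sigma> b ** \<zeta> z \<in> Y" if bz: "b \<in> S" "z \<in> Z" for b z
    proof -
      obtain x y where b: "b = (x, y)" "x \<in> P" "y \<in> P" using bz by (auto simp: S_def)
      \<comment> \<open>Factoring out the base point with second coordinate \<open>T\<close> costs
        the central term T x.\<close>
      have "\<sigma> b ** \<zeta> z = g0 ** heis x y (z + T * x)"
        by (simp add: b \<sigma>\<zeta> g0_def heis_mult flip: matrix_mul_assoc)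
      moreover have "z + T * x \<in> Z" using bz TZ[OF b(2)] unfolding Z_def by (intro Pd_add) auto
      ultimately show ?thesis using b unfolding Y_def H_def by (auto intro!: imageI image_eqI[of _ _ "(x, y, z + T * x)"])
    qed
    show "b = b' \<and> z = z'" if "\<sigma> b ** \<zeta> z = \<sigma> b' ** \<zeta> z'" for b z b' z'
    proof -
      obtain x y x' y' where b: "b = (x, y)" "b' = (x', y')" by (cases b; cases b') auto
      have "ginv m ** (m ** heis x (T + y) z) = ginv m ** (m ** heis x' (T + y') z')" using that by (simp add: b \<sigma>\<zeta>)
      then show ?thesis by (simp add: ginv_cancel(1)[OF mG] heis_eq_iff b)
    qed
    show "tt (int k) - tt (int k - 1) \<notin> W" unfolding W_def using k by (intro monic_diff_notin) auto
    show "D \<subseteq> S" unfolding D_def S_def P_def using k by (intro Sigma_mono Pd_mono) auto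
    show "D \<noteq> {}" unfolding D_def P_def using Pd_0 by blast
    show "\<exists>g\<in>Gam. \<exists>L. \<exists>s0\<in>S. L s0 + tt (int k - 1) - tt (int k) \<in> W \<and>
        (\<forall>s\<in>S. L s \<in> Z \<and> L (s + s0) = L s + L s0 \<and> ginv (\<sigma> s) ** \<sigma> (s + d) = g ** \<zeta> (L s))"
      if d: "d \<in> S - D" for d
    proof -
      obtain u v where uv: "d = (u, v)" "u \<in> P" "v \<in> P" "u \<notin> Pd (k + 1 - X)" using d by (auto simp: S_def D_def)
      obtain e where e': "exdeg u e" "int (k + 1 - X) \<le> e" "e \<le> int X - 1"
        using exdeg_Pd_diff[of u X "k + 1 - X"] uv unfolding P_def by blast
      have e: "exdeg u e" "int k + 1 - int X \<le> e" "e \<le> int X - 1" using e' by linarith+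
      define L where "L = (\<lambda>(x, y). y * u - x * v)"
      \<comment> \<open>The exact solution of y0 u = \<pi>^(-k) - \<pi>^(-(k-1)). The degree of
        \<open>u\<close> is at least k + 1 - X, so that of \<open>y0\<close> is at most X - 1, and
        its rounding lies in \<open>P\<close>.\<close>
      define y0 where "y0 = (tt (int k) - tt (int k - 1)) / u"
      have u0: "u \<noteq> 0" using e by (simp add: exdeg_def)
      have yd: "y0 \<in> dg (int k - e)" unfolding y0_def
        using exdeg_monic_diff[of "int k", where 'k = 'k] by (intro exdeg_divide[OF _ e(1)]) (auto simp: exdeg_alt)
      have py: "polyp y0 \<in> P" unfolding P_def using e by (intro Pd_I[OF polyp_poly polyp_dg[OF yd]]) auto
      have 0: "(0 :: 'k fls) \<in> P" using Pd_0 by (simp add: P_def)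
      have "L (0, polyp y0) + tt (int k - 1) - tt (int k) = (polyp y0 - y0) * u"
      proof -
        have "y0 * u = tt (int k) - tt (int k - 1)" using u0 by (simp add: y0_def)
        then show ?thesis by (simp add: L_def left_diff_distrib)
      qed
      \<comment> \<open>Here the rounding error need not vanish; it has degree at most k - 2 and is
        absorbed by \<open>W\<close>.\<close>
      moreover have "(polyp y0 - y0) * u \<in> dg (e - 1)" using e by (intro dg_mult'[OF polyp_frac]) (auto simp: exdeg_alt)
      moreover have "L (0, polyp y0) + tt (int k - 1) - tt (int k) \<in> polyinv"
        using k X Pp(1)[OF uv(2)] by (auto simp: L_def intro!: polyinv_simps polyp_poly tt_poly)
      ultimately have Ls0: "L (0, polyp y0) + tt (int k - 1) - tt (int k) \<in> W"
        unfolding W_def using e k by (intro Pd_I[where m = "e - 1"]) auto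
      have "L s \<in> Z \<and> L (s + (0, polyp y0)) = L s + L (0, polyp y0) \<and> ginv (\<sigma> s) ** \<sigma> (s + d) = heis u v (T * u) ** \<zeta> (L s)"
        if s: "s \<in> S" for s
      proof -
        obtain x y where xy: "s = (x, y)" "x \<in> P" "y \<in> P" using s by (auto simp: S_def)
        have "L s \<in> Z" using Pm[OF xy(3) uv(2)] Pm[OF xy(2) uv(3)] by (auto simp: L_def xy Z_def intro: Pd_diff)
        moreover have "L (s + (0, polyp y0)) = L s + L (0, polyp y0)" by (simp add: L_def xy algebra_simps)
        \<comment> \<open>The central coordinate of the quotient is the symplectic pairing of
          \<open>s\<close> and \<open>d\<close>, plus the constant T u due to the base
          point.\<close>
        moreover have "ginv (\<sigma> s) ** \<sigma> (s + d) = heis u v (T * u) ** \<zeta> (L s)"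
        proof -
          have hG: "heis x (T + y) 0 \<in> Gam" using xy Pp by (intro heis_Gam polyinv_simps Tp)
          have "ginv (\<sigma> s) ** \<sigma> (s + d) = ginv (heis x (T + y) 0) ** heis (x + u) (T + (y + v)) 0"
            by (simp add: \<sigma>_def xy uv ginv_mult[OF mG hG] ginv_cancel(1)[OF mG] flip: matrix_mul_assoc)
          also have "\<dots> = heis u v (T * u) ** \<zeta> (L s)"
            unfolding ginv_heis[OF hG] by (simp add: heis_mult \<zeta>_def L_def xy heis_eq_iff algebra_simps)
          finally show ?thesis .
        qed
        ultimately show ?thesis by blast
      qed
      moreover have "heis u v (T * u) \<in> Gam" using uv Pp by (intro heis_Gam polyinv_simps Tp)
      moreover have "(0, polyp y0) \<in> S" using py 0 by (simp add: S_def)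
      ultimately show ?thesis using Ls0 by blast
    qed
    show "f (\<sigma> s ** \<zeta> (tt (int k) + w)) = f g" if "s \<in> S" "w \<in> W" for s w
      using that val[of "fst s" "snd s" w "int k" g] g by (auto simp: S_def)
    show "f (\<sigma> s ** \<zeta> (tt (int k - 1) + w)) = f h" if "s \<in> S" "w \<in> W" for s w
      using that val[of "fst s" "snd s" w "int k - 1" h] h by (auto simp: S_def)
  qed (use \<sigma>G p in auto)
  then show ?thesis by (simp add: cS cW cH cD q_def)
qed

section \<open>Decay\<close>

text \<open>Translation by 1 permutes the field, so comparing the sums of all elements shows that
  the cardinality vanishes in the field; being odd, it would equal 1 if 2 were 0.\<close>

lemma two_neq_zero_if_odd_card:
  assumes "odd CARD('k::{finite,field})" shows "(2::'k) \<noteq> 0"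
proof
  assume two: "(2::'k) = 0"
  have "bij (\<lambda>x::'k. x + 1)" by (rule bij_betw_byWitness[of _ "\<lambda>x. x - 1"]) auto
  then have "(\<Sum>x\<in>UNIV. x) = (\<Sum>x\<in>UNIV. x + (1::'k))"
    using sum.reindex_bij_betw[of "\<lambda>x::'k. x + 1" UNIV UNIV "\<lambda>x. x"] by simp
  then have "of_nat CARD('k) = (0::'k)" by (simp add: sum.distrib)
  moreover obtain m where "CARD('k) = 2 * m + 1" using assms by (auto elim: oddE)
  ultimately show False using two by simp
qed

text \<open>The slack q^(R+2) covers both moves, whose \<open>Q\<close> is 2 q^(R+1) and 2 q^(R+2).
  For infinite \<open>p\<close> the rate is that of the operator norm, q^(-R/2).\<close>

lemma sep_const_decay:
  assumes p: "p > 4" and q: "q > (1::real)"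
  obtains C \<theta> where "0 < C" "0 < \<theta>" "\<theta> < 1"
    "\<And>R Q. 0 < Q \<Longrightarrow> Q \<le> 2 * q ^ (R + 2) \<Longrightarrow> sep_const p (2 * sqrt (1 / q ^ R)) Q \<le> C * \<theta> ^ R"
proof (cases "p = \<infinity>")
  case True
  show thesis
  proof (rule that[of 2 "1 / sqrt q"])
    show "0 < 1 / sqrt q" "1 / sqrt q < 1" using q by auto
    show "sep_const p (2 * sqrt (1 / q ^ R)) Q \<le> 2 * (1 / sqrt q) ^ R" for R Q
      using True by (simp add: sep_const_def real_sqrt_divide real_sqrt_power power_divide)
  qed simp
next
  case False
  define r where "r = real_of_ereal p"
  have r: "r > 4" using p False unfolding r_def by (cases p) auto
  define \<theta> where "\<theta> = q powr (- (r - 4) / (2 * r))"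
  define C where "C = (2 powr (r - 1) * q\<^sup>2) powr (1 / r)"
  show thesis
  proof (rule that[of C \<theta>])
    show "0 < C" "0 < \<theta>" using q by (auto simp: C_def \<theta>_def)
    have "- (r - 4) / (2 * r) < 0" using r by (intro divide_neg_pos) auto
    then have "q powr (- (r - 4) / (2 * r)) < q powr 0" using q by (rule powr_less_mono)
    then show "\<theta> < 1" using q by (simp add: \<theta>_def)
    fix R Q assume Q: "0 < Q" "Q \<le> 2 * q ^ (R + 2)"
    have s: "2 * sqrt (1 / q ^ R) = 2 * q powr (- real R / 2)"
    proof -
      have "q ^ R = q powr real R" using q by (simp add: powr_realpow)
      then have "1 / q ^ R = q powr (- real R)" by (simp only: powr_minus_divide)
      then have "sqrt (1 / q ^ R) = (q powr (- real R)) powr (1 / 2)"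
        using powr_half_sqrt[of "q powr (- real R)"] by simp
      also have "\<dots> = q powr (- real R / 2)" unfolding powr_powr by simp
      finally show ?thesis by simp
    qed
    have "(2 * sqrt (1 / q ^ R)) powr (r - 2) * Q \<le> (2 * q powr (- real R / 2)) powr (r - 2) * (2 * q powr (real R + 2))"
    proof -
      have "q powr (real R + 2) = q ^ (R + 2)" using powr_realpow[of q "R + 2"] q by (simp add: add.commute)
      then show ?thesis unfolding s using Q by (intro mult_left_mono) auto
    qed
    also have "\<dots> = 2 powr (r - 1) * q\<^sup>2 * q powr (- (r - 4) / 2 * real R)"
    proof -
      have "(2::real) powr (r - 2) * 2 = 2 powr (r - 1)"
        using powr_add[of "2::real" "r - 2" 1] by (simp add: add.commute)
      moreover have "q powr (- real R / 2 * (r - 2)) * q powr (real R + 2) = q\<^sup>2 * q powr (- (r - 4) / 2 * real R)"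
      proof -
        have "q powr (- real R / 2 * (r - 2)) * q powr (real R + 2) = q powr (2 + (- (r - 4) / 2 * real R))"
          by (simp add: powr_add[symmetric] field_simps)
        then show ?thesis using q by (simp add: powr_add)
      qed
      ultimately show ?thesis using q by (simp add: powr_mult powr_powr mult_ac)
    qed
    finally have le: "(2 * sqrt (1 / q ^ R)) powr (r - 2) * Q \<le> 2 powr (r - 1) * q\<^sup>2 * q powr (- (r - 4) / 2 * real R)" .
    have "sep_const p (2 * sqrt (1 / q ^ R)) Q = ((2 * sqrt (1 / q ^ R)) powr (r - 2) * Q) powr (1 / r)"
      using False by (simp add: sep_const_def r_def)
    also have "\<dots> \<le> (2 powr (r - 1) * q\<^sup>2 * q powr (- (r - 4) / 2 * real R)) powr (1 / r)"
      using le r Q by (intro powr_mono2) auto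
    also have "\<dots> = C * (q powr (- (r - 4) / 2 * real R)) powr (1 / r)"
      unfolding C_def by (subst powr_mult) auto
    also have "(q powr (- (r - 4) / 2 * real R)) powr (1 / r) = \<theta> ^ R"
    proof -
      have "\<theta> ^ R = \<theta> powr real R" using q by (simp add: powr_realpow \<theta>_def)
      also have "\<dots> = q powr (- (r - 4) / (2 * r) * real R)" by (simp add: \<theta>_def powr_powr)
      finally show ?thesis using r by (simp add: powr_powr field_simps)
    qed
    finally show "sep_const p (2 * sqrt (1 / q ^ R)) Q \<le> C * \<theta> ^ R" .
  qed
qed

text \<open>For i > 0 the matrix \<open>dominant i j\<close> has entries outside the polynomial
  ring; this unipotent element of the same type lies in the lattice.\<close>

definition rep :: "nat \<Rightarrow> nat \<Rightarrow> 'k::field fls ^4^4" where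
  "rep i j = siegel (tt (int i)) 0 (tt (int j))"

lemma rep_Gam: "rep i j \<in> Gam"
  unfolding rep_def by (intro siegel_Gam tt_poly polyinv_simps) auto

lemma rep_ktype: "j \<le> i \<Longrightarrow> ktype (rep i j) (int i) (int i + int j)"
  unfolding rep_def by (intro ktype_siegel tt_ex) (auto simp: tt_ex)

text \<open>The upper right entry of \<open>rep i j\<close> has degree \<open>i\<close>, so a finite
  support bounds \<open>i\<close> uniformly in \<open>j\<close>.\<close>

lemma rep_eventually_zero:
  assumes "finsupp f"
  obtains L where "\<And>i j. L \<le> i \<Longrightarrow> f (rep i j :: 'k::field fls ^4^4) = 0"
proof -
  define A where "A = (\<lambda>g :: 'k fls ^4^4. nat (- fls_subdegree (g$0$3))) ` {g \<in> Gam. f g \<noteq> 0}"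
  have "finite A" using assms by (simp add: A_def finsupp_def)
  then have "\<exists>L. \<forall>n\<in>A. n < L" by (simp only: finite_nat_set_iff_bounded)
  then obtain L where L: "\<And>n. n \<in> A \<Longrightarrow> n < L" by blast
  have "f (rep i j) = 0" if "L \<le> i" for i j
  proof (rule ccontr)
    assume "f (rep i j) \<noteq> 0"
    then have "nat (- fls_subdegree (rep i j $0$3 :: 'k fls)) \<in> A" using rep_Gam by (auto simp: A_def)
    moreover have "nat (- fls_subdegree (rep i j $0$3 :: 'k fls)) = i"
      using tt_ex[of "int i", where 'a = 'k] by (simp add: rep_def siegel_def exdeg_def)
    ultimately show False using L that by fastforce
  qed
  then show thesis using that by blast
qed

lemma K_invariant_decay:
  fixes p :: ereal
  assumes odd: "odd CARD('k::{finite,field})" and p: "p > 4"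
  obtains e :: "nat \<Rightarrow> real" where "summable e" "\<And>n. 0 < e n"
    "\<And>(f :: 'k fls ^4^4 \<Rightarrow> complex) M i j. K_invariant f \<Longrightarrow> finsupp f \<Longrightarrow> mult_norm p f = ereal M \<Longrightarrow>
       6 \<le> i \<Longrightarrow> j \<le> i \<Longrightarrow> cmod (f (rep i j)) \<le> (\<Sum>n. e (n + i)) * M"
proof -
  define q where "q = real CARD('k)"
  have q: "q > 1"
  proof -
    have "card {0::'k, 1} \<le> CARD('k)" by (rule card_mono) auto
    then show ?thesis by (simp add: q_def)
  qed
  have p2: "p > 2" using p by (rule less_trans[rotated]) simp
  obtain C \<theta> where C: "0 < C" "0 < \<theta>" "\<theta> < 1"
    "\<And>R Q. 0 < Q \<Longrightarrow> Q \<le> 2 * q ^ (R + 2) \<Longrightarrow> sep_const p (2 * sqrt (1 / q ^ R)) Q \<le> C * \<theta> ^ R"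
    by (rule sep_const_decay[OF p q]) blast
  define \<rho> where "\<rho> = sqrt \<theta>"
  have \<rho>: "0 < \<rho>" "\<rho> < 1" "\<rho>\<^sup>2 = \<theta>" using C by (auto simp: \<rho>_def)
  \<comment> \<open>The cost of passing from \<open>n\<close> to n + 1: at most n + 1 moves, each
    costing about \<theta>^(n/2) = \<rho>^n. The power \<theta>^3 in the denominator absorbs
    rounding in the exponents.\<close>
  define e where "e = (\<lambda>n. C / \<theta> ^ 3 * (real (Suc n) * \<rho> ^ n))"
  have "summable (\<lambda>n. real (Suc n) * \<rho> ^ n)"
    using geometric_deriv_sums[of \<rho>] \<rho> by (auto simp: sums_iff)
  then have sm: "summable e" unfolding e_def by (rule summable_mult)
  have epos: "0 < e n" for n using C \<rho> by (simp add: e_def)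
  have "cmod (f (rep i j)) \<le> (\<Sum>n. e (n + i)) * M"
    if f: "K_invariant f" "finsupp f" and M: "mult_norm p f = ereal M" and ij: "6 \<le> i" "j \<le> i"
    for f :: "'k fls ^4^4 \<Rightarrow> complex" and M i j
  proof -
    define F where "F = (\<lambda>i j. f (rep i j))"
    have M0: "0 \<le> M"
    proof -
      have "ereal 0 \<le> ereal (cmod (f (mat 1)))" by simp
      also have "\<dots> \<le> ereal M" using multiplier_value_bound[OF Gam_one p2, of f] M by simp
      finally show ?thesis by simp
    qed
    have m1: "cmod (F N k - F N (k - 1)) \<le> C * \<theta> ^ (N + 1 - k) * M" if k: "1 \<le> k" "k \<le> N" for N k
    proof -
      define R where "R = N + 1 - k"
      define Q where "Q = q ^ (2 * N + 2) * (2 / (q ^ (N + 1) * q ^ (k - 1)))"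
      have "q ^ k / q ^ (N + 1) = 1 / q ^ R"
      proof -
        have "q ^ (N + 1) = q ^ R * q ^ k" using k by (simp add: R_def flip: power_add)
        then show ?thesis using q by simp
      qed
      moreover have Qe: "Q = 2 * q ^ (R + 1)"
      proof -
        have "2 * N + 2 = (R + 1) + ((N + 1) + (k - 1))" using k by (simp add: R_def)
        then have "q ^ (2 * N + 2) = q ^ (R + 1) * (q ^ (N + 1) * q ^ (k - 1))" by (simp only: power_add)
        then show ?thesis using q by (simp add: Q_def)
      qed
      moreover have "Q \<le> 2 * q ^ (R + 2)" unfolding Qe using q by (intro mult_left_mono power_increasing) auto
      ultimately have sc: "sep_const p (2 * sqrt (q ^ k / q ^ (N + 1))) Q \<le> C * \<theta> ^ R"
        using C(4)[of Q R] q by simp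
      have t: "ktype (rep N (k - 1) :: 'k fls ^4^4) (int N) (int N + (int k - 1))"
        using rep_ktype[of "k - 1" N, where 'a = 'k] k by (simp add: of_nat_diff)
      have "ereal (cmod (F N k - F N (k - 1))) \<le> ereal (sep_const p (2 * sqrt (q ^ k / q ^ (N + 1))) Q) * ereal M"
        using siegel_move[OF f(1) two_neq_zero_if_odd_card[OF odd] p2 k rep_Gam rep_ktype[OF k(2)] rep_Gam t]
        unfolding F_def Q_def q_def M .
      then have "cmod (F N k - F N (k - 1)) \<le> sep_const p (2 * sqrt (q ^ k / q ^ (N + 1))) Q * M" by simp
      also have "\<dots> \<le> C * \<theta> ^ R * M" using sc M0 by (rule mult_right_mono)
      finally show ?thesis by (simp add: R_def)
    qed
    have m2: "cmod (F i j - F (i + 1) (j - 1)) \<le> C * \<theta> ^ (j - 3) * M" if ij: "3 \<le> j" "j \<le> i" for i j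
    proof -
      define s where "s = (i + j) mod 2"
      define X where "X = (i + j) div 2"
      have s: "s = 0 \<or> s = 1" and Xs: "2 * X + s = i + j" by (auto simp: s_def X_def)
      define k where "k = i + 1"
      \<comment> \<open>If j = i, then i + j is even and s = 0.\<close>
      have js: "j + s \<le> i" using ij s Xs by presburger
      have k: "X + s + 1 \<le> k" "k + 1 \<le> 2 * X" using js Xs s ij by (auto simp: k_def)
      \<comment> \<open>From 2 X = i + j - s and k = i + 1. The subtraction is exact because j >= 3,
        and the exponent j - 3 below absorbs the parity \<open>s\<close>.\<close>
      define R where "R = j - s - 2"
      define Q where "Q = q ^ (4 * X) * (2 / (q ^ (2 * X) * q ^ (k - 1)))"
      have R: "2 * X = R + k + 1" using Xs s ij by (auto simp: R_def k_def)
      have "q ^ (k + 1) / q ^ (2 * X) = 1 / q ^ R"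
      proof -
        have "q ^ (2 * X) = q ^ R * q ^ (k + 1)" unfolding R by (simp flip: power_add)
        then show ?thesis using q by simp
      qed
      moreover have Qe: "Q = 2 * q ^ (R + 2)"
      proof -
        have "4 * X = (R + 2) + (2 * X + (k - 1))" using R k by linarith
        then have "q ^ (4 * X) = q ^ (R + 2) * (q ^ (2 * X) * q ^ (k - 1))" by (simp only: power_add)
        then show ?thesis using q by (simp add: Q_def)
      qed
      ultimately have sc: "sep_const p (2 * sqrt (q ^ (k + 1) / q ^ (2 * X))) Q \<le> C * \<theta> ^ R"
        using C(4)[of Q R] q by simp
      have t1: "ktype (rep (i + 1) (j - 1) :: 'k fls ^4^4) (int k) (2 * int X + int s)"
      proof -
        have "int (i + 1) + int (j - 1) = 2 * int X + int s" using Xs ij by linarith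
        then show ?thesis using rep_ktype[of "j - 1" "i + 1", where 'a = 'k] ij by (simp add: k_def)
      qed
      have t2: "ktype (rep i j :: 'k fls ^4^4) (int k - 1) (2 * int X + int s)"
      proof -
        have "int i + int j = 2 * int X + int s" using Xs by linarith
        then show ?thesis using rep_ktype[of j i, where 'a = 'k] ij by (simp add: k_def)
      qed
      have "ereal (cmod (F (i + 1) (j - 1) - F i j)) \<le> ereal (sep_const p (2 * sqrt (q ^ (k + 1) / q ^ (2 * X))) Q) * ereal M"
        using heis_move[OF f(1) p2 s k rep_Gam t1 rep_Gam t2] unfolding F_def Q_def q_def M .
      then have "cmod (F i j - F (i + 1) (j - 1)) \<le> sep_const p (2 * sqrt (q ^ (k + 1) / q ^ (2 * X))) Q * M"
        by (simp add: norm_minus_commute)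
      also have "\<dots> \<le> C * \<theta> ^ R * M" using sc M0 by (rule mult_right_mono)
      also have "\<dots> \<le> C * \<theta> ^ (j - 3) * M"
        using C M0 s by (intro mult_right_mono mult_left_mono power_decreasing) (auto simp: R_def)
      finally show ?thesis .
    qed
    have step: "\<exists>j'\<le>i + 1. cmod (F i j - F (i + 1) j') \<le> e i * M" if ij: "6 \<le> i" "j \<le> i" for i j
    proof -
      \<comment> \<open>\<open>\<beta>\<close> bounds every move used here: a Siegel move ending at
        most at h + 1 has gap at least i - h, and the Heisenberg move starts at or above h +
        1.\<close>
      define h where "h = i div 2"
      define \<beta> where "\<beta> = C * \<theta> ^ (h - 2) * M"
      have \<beta>0: "0 \<le> \<beta>" using C M0 by (simp add: \<beta>_def)
      have walk: "cmod (F i j - F i (j + n)) \<le> n * \<beta>" if "j + n \<le> h + 1" for n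
        using that
      proof (induction n)
        case (Suc n)
        have "cmod (F i (j + n) - F i (j + Suc n)) \<le> C * \<theta> ^ (i + 1 - (j + Suc n)) * M"
          using m1[of "j + Suc n" i] Suc.prems ij by (simp add: norm_minus_commute h_def)
        also have "\<dots> \<le> \<beta>" unfolding \<beta>_def using C M0 Suc.prems ij
          by (intro mult_right_mono mult_left_mono power_decreasing) (auto simp: h_def)
        finally have "cmod (F i (j + n) - F i (j + Suc n)) \<le> \<beta>" .
        moreover have "cmod (F i j - F i (j + n)) \<le> n * \<beta>" using Suc by simp
        ultimately show ?case
          using norm_triangle_ineq[of "F i j - F i (j + n)" "F i (j + n) - F i (j + Suc n)"] by (simp add: algebra_simps)
      qed simp
      \<comment> \<open>Siegel moves raise \<open>j\<close> only when it lies below h + 1; otherwise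
        the Heisenberg move is made at once.\<close>
      define j1 where "j1 = max j (h + 1)"
      have j1: "j \<le> j1" "h + 1 \<le> j1" "j1 \<le> i" using ij by (auto simp: j1_def h_def)
      have "cmod (F i j - F i j1) \<le> i * \<beta>"
      proof (cases "j \<le> h + 1")
        case True
        then have "cmod (F i j - F i j1) \<le> (h + 1 - j) * \<beta>" using walk[of "h + 1 - j"] by (simp add: j1_def)
        also have "\<dots> \<le> i * \<beta>" using \<beta>0 ij by (intro mult_right_mono) (auto simp: h_def)
        finally show ?thesis .
      next
        case False
        then show ?thesis using \<beta>0 by (simp add: j1_def)
      qed
      moreover have "cmod (F i j1 - F (i + 1) (j1 - 1)) \<le> \<beta>"
      proof -
        have "cmod (F i j1 - F (i + 1) (j1 - 1)) \<le> C * \<theta> ^ (j1 - 3) * M" using m2[of j1 i] j1 ij by (simp add: h_def)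
        also have "\<dots> \<le> \<beta>" unfolding \<beta>_def using C M0 j1
          by (intro mult_right_mono mult_left_mono power_decreasing) auto
        finally show ?thesis .
      qed
      ultimately have "cmod (F i j - F (i + 1) (j1 - 1)) \<le> i * \<beta> + \<beta>"
        using norm_triangle_ineq[of "F i j - F i j1" "F i j1 - F (i + 1) (j1 - 1)"] by simp
      also have "\<dots> = real (Suc i) * C * M * \<theta> ^ (h - 2)" by (simp add: \<beta>_def algebra_simps)
      also have "\<dots> \<le> real (Suc i) * C * M * (\<rho> ^ i / \<theta> ^ 3)"
      proof (rule mult_left_mono)
        have "\<theta> ^ (h - 2) * \<theta> ^ 3 = \<rho> ^ (2 * (h - 2 + 3))"
          by (simp add: \<rho>(3)[symmetric] power_mult[symmetric] power_add[symmetric])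
        also have "\<dots> \<le> \<rho> ^ i" using \<rho> by (intro power_decreasing) (auto simp: h_def)
        finally show "\<theta> ^ (h - 2) \<le> \<rho> ^ i / \<theta> ^ 3" using C by (simp add: pos_le_divide_eq)
      qed (use C M0 in simp)
      also have "\<dots> = e i * M" by (simp add: e_def)
      finally show ?thesis using j1 by (intro exI[of _ "j1 - 1"]) auto
    qed
    obtain L where L: "\<And>i j. L \<le> i \<Longrightarrow> f (rep i j) = 0" using rep_eventually_zero[OF f(2)] by blast
    \<comment> \<open>Induction on the number \<open>d\<close> of increments of \<open>i\<close>
      that suffice to leave the support of \<open>f\<close>.\<close>
    have "cmod (F i j) \<le> (\<Sum>n<d. e (n + i)) * M" if "6 \<le> i" "j \<le> i" "L \<le> i + d" for d i j
      using that
    proof (induction d arbitrary: i j)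
      case 0 then show ?case using L by (simp add: F_def)
    next
      case (Suc d)
      obtain j' where j': "j' \<le> i + 1" "cmod (F i j - F (i + 1) j') \<le> e i * M" using step[OF Suc.prems(1,2)] by blast
      have "cmod (F (i + 1) j') \<le> (\<Sum>n<d. e (n + (i + 1))) * M" using Suc.prems j' by (intro Suc.IH) auto
      then have "cmod (F i j) \<le> e i * M + (\<Sum>n<d. e (n + (i + 1))) * M"
        using j'(2) norm_triangle_ineq[of "F i j - F (i + 1) j'" "F (i + 1) j'"] by simp
      also have "\<dots> = (\<Sum>n<Suc d. e (n + i)) * M"
        by (simp add: sum.lessThan_Suc_shift algebra_simps del: sum.lessThan_Suc)
      finally show ?case .
    qed
    from this[OF ij, of L] have "cmod (F i j) \<le> (\<Sum>n<L. e (n + i)) * M" by simp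
    \<comment> \<open>The infinite tail does not depend on \<open>L\<close>, hence not on the
      support; this lets one function serve all \<open>f\<close>.\<close>
    also have "\<dots> \<le> (\<Sum>n. e (n + i)) * M"
      using M0 epos sm by (intro mult_right_mono sum_le_suminf) (auto simp: summable_iff_shift intro: less_imp_le)
    finally show ?thesis by (simp add: F_def)
  qed
  then show thesis using that[OF sm epos] by blast
qed

section \<open>Vanishing at infinity on the lattice\<close>

definition ideg :: "'k::field fls ^4^4 \<Rightarrow> nat" where
  "ideg A = (LEAST n. ent (int n) A)"

lemma Gam_ktype:
  assumes "g \<in> Gam"
  obtains j where "j \<le> ideg g" "ktype g (int (ideg g)) (int (ideg g) + int j)"
proof -
  obtain i j where ij: "0 \<le> j" "j \<le> i" "keq g (dominant i j)" by (rule cartan_decomposition[OF Gam_UNIV[OF assms]])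
  have t: "ktype g i (i + j)" using keq_ktype[OF ij(3)] ktype_dominant[OF ij(1,2)] by simp
  have "ideg g = nat i" unfolding ideg_def
  proof (rule Least_equality)
    show "ent (int (nat i)) g" using t ij by (simp add: ktype_def)
    fix n assume "ent (int n) g"
    then show "nat i \<le> n" using t ent_mono[of "int n" g "i - 1"] unfolding ktype_def by linarith
  qed
  then show thesis using that[of "nat j"] t ij by simp
qed

text \<open>Bounded degree leaves finitely many polynomial entries over a finite field; this turns
  decay in \<open>ideg\<close> into membership in C_0.\<close>

lemma finite_ideg: "finite {g \<in> Gam. ideg (g :: 'k::{finite,field} fls ^4^4) \<le> n}"
proof (rule finite_subset)
  let ?P = "Pd (n + 1) :: 'k fls set"
  have fin: "finite {v :: 'a ^4. \<forall>i. v $ i \<in> B}" if "finite B" for B :: "'a set"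
  proof -
    have "{v :: 'a ^4. \<forall>i. v $ i \<in> B} \<subseteq> (\<lambda>(a, b, c, d). row4 a b c d) ` (B \<times> B \<times> B \<times> B)"
    proof
      fix v :: "'a ^4" assume v: "v \<in> {v. \<forall>i. v $ i \<in> B}"
      have "v = row4 (v$0) (v$1) (v$2) (v$3)" by (simp add: vec_eq_iff forall_4')
      then show "v \<in> (\<lambda>(a, b, c, d). row4 a b c d) ` (B \<times> B \<times> B \<times> B)"
        using v by (intro image_eqI[of _ _ "(v$0, v$1, v$2, v$3)"]) auto
    qed
    then show ?thesis by (rule finite_subset) (use that in simp)
  qed
  show "finite {A :: 'k fls ^4^4. \<forall>i. A $ i \<in> {v. \<forall>j. v $ j \<in> ?P}}"
    using Pd_card[of "n + 1", where 'k = 'k] by (intro fin) auto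
  show "{g \<in> Gam. ideg g \<le> n} \<subseteq> {A :: 'k fls ^4^4. \<forall>i. A $ i \<in> {v. \<forall>j. v $ j \<in> ?P}}"
  proof clarify
    fix g :: "'k fls ^4^4" and i j assume g: "g \<in> Gam" "ideg g \<le> n"
    obtain l where "ktype g (int (ideg g)) (int (ideg g) + int l)" by (rule Gam_ktype[OF g(1)])
    then have "g $ i $ j \<in> dg (int (ideg g))" by (simp add: ktype_def ent_def)
    moreover have "g $ i $ j \<in> polyinv" using g(1) by (simp add: Sp4_def)
    ultimately show "g $ i $ j \<in> ?P" using g(2) by (intro Pd_I) auto
  qed
qed

theorem theorem2p6:
  fixes p :: ereal
  assumes "odd (CARD('k::{finite,field}))"
    and "p > 4"
  shows "\<exists>\<phi>p :: 'k fls ^4^4 \<Rightarrow> real.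
           (\<forall>\<epsilon>>0. finite {\<gamma> \<in> Gam. \<bar>\<phi>p \<gamma>\<bar> \<ge> \<epsilon>}) \<and>
           (\<forall>f :: 'k fls ^4^4 \<Rightarrow> complex.
              finsupp f \<and>
              (\<forall>\<gamma>\<in>Gam. \<forall>\<gamma>'\<in>Gam.
                 \<gamma> \<in> {k1 ** \<gamma>' ** k2 | k1 k2. k1 \<in> Kcpt \<and> k2 \<in> Kcpt} \<longrightarrow> f \<gamma> = f \<gamma>')
              \<longrightarrow> (\<forall>\<gamma>\<in>Gam. ereal (cmod (f \<gamma>)) \<le> ereal (\<phi>p \<gamma>) * mult_norm p f))"
proof -
  obtain e where e: "summable e" "\<And>n. 0 < e n"
    "\<And>(f :: 'k fls ^4^4 \<Rightarrow> complex) M i j. K_invariant f \<Longrightarrow> finsupp f \<Longrightarrow> mult_norm p f = ereal M \<Longrightarrow>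
       6 \<le> i \<Longrightarrow> j \<le> i \<Longrightarrow> cmod (f (rep i j)) \<le> (\<Sum>n. e (n + i)) * M"
    by (rule K_invariant_decay[OF assms]) blast
  have p2: "p > 2" using assms(2) by (rule less_trans[rotated]) simp
  \<comment> \<open>The zigzag estimate starts at degree 6; below it the trivial bound by the
    multiplier norm is used.\<close>
  define \<phi> where "\<phi> = (\<lambda>g :: 'k fls ^4^4. if ideg g < 6 then 1 else (\<Sum>n. e (n + ideg g)))"
  have tail: "0 < (\<Sum>n. e (n + i))" for i
    using e(1,2) by (intro suminf_pos) (auto simp: summable_iff_shift)
  then have \<phi>pos: "0 < \<phi> g" for g by (simp add: \<phi>_def)
  have "finite {\<gamma> \<in> Gam. \<bar>\<phi> \<gamma>\<bar> \<ge> \<epsilon>}" if \<epsilon>: "0 < \<epsilon>" for \<epsilon>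
  proof -
    obtain N where N: "\<And>n. N \<le> n \<Longrightarrow> norm (\<Sum>i. e (i + n)) < \<epsilon>" using suminf_exist_split[OF \<epsilon> e(1)] by blast
    have "{\<gamma> \<in> Gam. \<bar>\<phi> \<gamma>\<bar> \<ge> \<epsilon>} \<subseteq> {g \<in> Gam. ideg g \<le> max 6 N}"
    proof clarify
      fix g :: "'k fls ^4^4" assume g: "\<epsilon> \<le> \<bar>\<phi> g\<bar>"
      show "ideg g \<le> max 6 N"
      proof (rule ccontr)
        assume "\<not> ideg g \<le> max 6 N"
        then have "N \<le> ideg g" "\<not> ideg g < 6" by auto
        then have "\<bar>\<phi> g\<bar> < \<epsilon>" using N[of "ideg g"] by (simp add: \<phi>_def)
        then show False using g by simp
      qed
    qed
    then show ?thesis by (rule finite_subset) (rule finite_ideg)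
  qed
  moreover have "ereal (cmod (f \<gamma>)) \<le> ereal (\<phi> \<gamma>) * mult_norm p f"
    if f: "finsupp f" "\<forall>\<gamma>\<in>Gam. \<forall>\<gamma>'\<in>Gam.
       \<gamma> \<in> {k1 ** \<gamma>' ** k2 | k1 k2. k1 \<in> Kcpt \<and> k2 \<in> Kcpt} \<longrightarrow> f \<gamma> = f \<gamma>'" and \<gamma>: "\<gamma> \<in> Gam"
    for f :: "'k fls ^4^4 \<Rightarrow> complex" and \<gamma>
  proof -
    have K: "K_invariant f" unfolding K_invariant_def keq_def using f(2) by blast
    have b: "ereal (cmod (f \<gamma>)) \<le> mult_norm p f" by (rule multiplier_value_bound[OF \<gamma> p2])
    show ?thesis
    proof (cases "mult_norm p f")
      case (real M)
      show ?thesis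
      proof (cases "ideg \<gamma> < 6")
        case True
        then show ?thesis using b by (simp add: \<phi>_def real)
      next
        case False
        obtain j where j: "j \<le> ideg \<gamma>" "ktype \<gamma> (int (ideg \<gamma>)) (int (ideg \<gamma>) + int j)" by (rule Gam_ktype[OF \<gamma>])
        have "f \<gamma> = f (rep (ideg \<gamma>) j)" by (rule K_invariant_ktype[OF K \<gamma> rep_Gam j(2) rep_ktype[OF j(1)]])
        then show ?thesis using e(3)[OF K f(1) real _ j(1)] False by (simp add: \<phi>_def real)
      qed
    next
      case PInf
      \<comment> \<open>Strict positivity matters: a positive number times infinity is infinite in
        \<open>ereal\<close>, whereas 0 times infinity is 0.\<close>
      then show ?thesis using \<phi>pos[of \<gamma>] by simp
    next
      case MInf
      then show ?thesis using b by simp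
    qed
  qed
  ultimately show ?thesis by (intro exI[of _ \<phi>]) blast
qed

end
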